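(* There is an algorithm that, given integers $p,q\ge 1$ with $\gcd(p,q)\notin\{p,q\}$ and an integer $h\ge 0$, computes $L(h,p,q)$ in $\mathcal O(\log p+\log q)$ time.
   Context: A partial word of length $n$ is a sequence over $\Sigma\cup\{\diamondsuit\}$, where $\diamondsuit\notin\Sigma$ is a hole. For $a,b\in\Sigma\cup\{\diamondsuit\}$, $a\approx b$ if $a=b$ or one of them is $\diamondsuit$. A positive integer $r$ is a (strong) period of $X$ if there is a word $P\in\Sigma^r$ with $X[i]\approx P[i\bmod r]$ for all positions $i$. $L(h,p,q)$ is the least integer $n_0$ such that every partial word with at most $h$ holes having periods $p$ and $q$ and length at least $n_0$ also has period $\gcd(p,q)$. Running time is measured with unit-cost arithmetic operations on integers. *)

theory Defs
  imports Complex_Main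
begin

section \<open>Partial words\<close>

text \<open>\<^term>\<open>None\<close> is the hole.\<close>

type_synonym 'a pword = "'a option list"

definition pword_over :: "'a set \<Rightarrow> 'a pword \<Rightarrow> bool" where
  "pword_over \<Sigma> X \<longleftrightarrow> set X \<subseteq> insert None (Some ` \<Sigma>)"

definition holes :: "'a pword \<Rightarrow> nat" where
  "holes X = count_list X None"

definition matches :: "'a option \<Rightarrow> 'a option \<Rightarrow> bool" (infix "\<approx>" 50) where
  "a \<approx> b \<longleftrightarrow> a = b \<or> a = None \<or> b = None"

definition has_period :: "'a set \<Rightarrow> 'a pword \<Rightarrow> nat \<Rightarrow> bool" where
  "has_period \<Sigma> X r \<longleftrightarrow> 0 < r \<and>
     (\<exists>P :: 'a list. length P = r \<and> set P \<subseteq> \<Sigma> \<and>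
        (\<forall>i < length X. X ! i \<approx> Some (P ! (i mod r))))"

text \<open>The function \<open>L(h, p, q)\<close>, for words over \<open>\<Sigma>\<close>.\<close>

definition threshold :: "'a set \<Rightarrow> nat \<Rightarrow> nat \<Rightarrow> nat \<Rightarrow> nat" where
  "threshold \<Sigma> h p q = (LEAST n0. \<forall>X.
     pword_over \<Sigma> X \<and> holes X \<le> h \<and> has_period \<Sigma> X p \<and> has_period \<Sigma> X q \<and> n0 \<le> length X
       \<longrightarrow> has_period \<Sigma> X (gcd p q))"

section \<open>Unit-cost integer random access machines\<close>

text \<open>
  Algorithms are finite structured programs over a memory of integer cells, addressed by
  integers either directly or indirectly (through the content of another cell). Every elementary
  instruction, i.e. one arithmetic operation with assignment or one comparison, takes one time
  unit, whatever the size of the integers involved. Division rounds down, and division by zero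
  yields zero. A plain assignment is an addition of the constant zero.
\<close>

type_synonym memory = "int \<Rightarrow> int"

datatype addr = Direct int | Indirect int

datatype operand = Const int | Cell addr

datatype arith = Add | Sub | Mul | Div

datatype test = Less operand operand | Equal operand operand

datatype program =
    Skip
  | Assign addr arith operand operand
  | Seq program program
  | Cond test program program
  | While test program

fun address :: "addr \<Rightarrow> memory \<Rightarrow> int" where
  "address (Direct i) m = i"
| "address (Indirect i) m = m i"

fun operand_val :: "operand \<Rightarrow> memory \<Rightarrow> int" where
  "operand_val (Const k) m = k"
| "operand_val (Cell a) m = m (address a m)"

fun arith_val :: "arith \<Rightarrow> int \<Rightarrow> int \<Rightarrow> int" where
  "arith_val Add x y = x + y"
| "arith_val Sub x y = x - y"
| "arith_val Mul x y = x * y"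
| "arith_val Div x y = x div y"

fun test_val :: "test \<Rightarrow> memory \<Rightarrow> bool" where
  "test_val (Less x y) m \<longleftrightarrow> operand_val x m < operand_val y m"
| "test_val (Equal x y) m \<longleftrightarrow> operand_val x m = operand_val y m"

text \<open>\<open>exec c m t m'\<close>: started in memory \<open>m\<close>, the program \<open>c\<close> terminates after
  exactly \<open>t\<close> time units in memory \<open>m'\<close>.\<close>

inductive exec :: "program \<Rightarrow> memory \<Rightarrow> nat \<Rightarrow> memory \<Rightarrow> bool" where
  Skip: "exec Skip m 1 m"
| Assign: "exec (Assign a f x y) m 1
     (m(address a m := arith_val f (operand_val x m) (operand_val y m)))"
| Seq: "exec c m s m' \<Longrightarrow> exec d m' t m'' \<Longrightarrow> exec (Seq c d) m (s + t) m''"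
| CondTrue: "test_val b m \<Longrightarrow> exec c m t m' \<Longrightarrow> exec (Cond b c d) m (1 + t) m'"
| CondFalse: "\<not> test_val b m \<Longrightarrow> exec d m t m' \<Longrightarrow> exec (Cond b c d) m (1 + t) m'"
| WhileFalse: "\<not> test_val b m \<Longrightarrow> exec (While b c) m 1 m"
| WhileTrue: "test_val b m \<Longrightarrow> exec c m s m' \<Longrightarrow> exec (While b c) m' t m'' \<Longrightarrow>
     exec (While b c) m (1 + s + t) m''"

inductive_cases SkipE: "exec Skip m t m'"
inductive_cases AssignE: "exec (Assign a f x y) m t m'"
inductive_cases SeqE: "exec (Seq c d) m t m'"

lemma exec_deterministic:
  "exec c m t m' \<Longrightarrow> exec c m u m'' \<Longrightarrow> u = t \<and> m'' = m'"
proof (induction arbitrary: u m'' rule: exec.induct)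
  case (Skip m)
  then show ?case by (elim SkipE) simp
next
  case (Assign a f x y m)
  then show ?case by (elim AssignE) simp
next
  case (Seq c m s m' d t m2)
  from Seq.prems obtain s1 m1 t1
    where 1: "u = s1 + t1" "exec c m s1 m1" "exec d m1 t1 m''" by (rule SeqE)
  have 2: "s1 = s \<and> m1 = m'" using 1(2) by (rule Seq.IH(1))
  with 1(3) have "exec d m' t1 m''" by simp
  then have "t1 = t \<and> m'' = m2" by (rule Seq.IH(2))
  with 1(1) 2 show ?case by simp
next
  case (CondTrue b m c t m' d)
  from CondTrue.prems CondTrue.hyps(1) obtain t1 where 1: "u = 1 + t1" "exec c m t1 m''"
    by (cases rule: exec.cases) simp_all
  have "t1 = t \<and> m'' = m'" using 1(2) by (rule CondTrue.IH)
  with 1(1) show ?case by simp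
next
  case (CondFalse b m d t m' c)
  from CondFalse.prems CondFalse.hyps(1) obtain t1 where 1: "u = 1 + t1" "exec d m t1 m''"
    by (cases rule: exec.cases) simp_all
  have "t1 = t \<and> m'' = m'" using 1(2) by (rule CondFalse.IH)
  with 1(1) show ?case by simp
next
  case (WhileFalse b m c)
  from WhileFalse.prems WhileFalse.hyps show ?case
    by (cases rule: exec.cases) simp_all
next
  case (WhileTrue b m c s m' t m2)
  from WhileTrue.prems WhileTrue.hyps(1) obtain s1 m1 t1
    where 1: "u = 1 + s1 + t1" "exec c m s1 m1" "exec (While b c) m1 t1 m''"
    by (cases rule: exec.cases) simp_all
  have 2: "s1 = s \<and> m1 = m'" using 1(2) by (rule WhileTrue.IH(1))
  with 1(3) have "exec (While b c) m' t1 m''" by simp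
  then have "t1 = t \<and> m'' = m2" by (rule WhileTrue.IH(2))
  with 1(1) 2 show ?case by simp
qed

text \<open>The inputs are placed in cells 0, 1, 2; all other cells are initially zero.\<close>

definition input :: "nat \<Rightarrow> nat \<Rightarrow> nat \<Rightarrow> memory" where
  "input p q h = (\<lambda>_. 0)(0 := int p, 1 := int q, 2 := int h)"

text \<open>The output is read from cell 0.\<close>

definition computes_within :: "program \<Rightarrow> memory \<Rightarrow> int \<Rightarrow> real \<Rightarrow> bool" where
  "computes_within c m y T \<longleftrightarrow> (\<exists>t m'. exec c m t m' \<and> m' 0 = y \<and> real t \<le> T)"

end

theory Submission
  imports Defs "HOL-Number_Theory.Cong"
begin

text \<open>
  Dividing by the gcd reduces to coprime \<open>p < q\<close>. A word with both periods that uses two letters colours the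
  residues modulo \<open>p\<close> and modulo \<open>q\<close>, and its holes are the positions at which the two colours differ, so
  the threshold asks for a cheapest cut of the bipartite graph whose edges are the positions. For \<open>p = 2\<close>
  the cuts are explicit. For \<open>p \<ge> 3\<close> two kinds of cuts are optimal. One isolates a single position together with its
  two residue classes. The other splits the cycle of residues modulo \<open>p\<close>, ordered by steps of \<open>q\<close>, into two
  arcs and colours each residue modulo \<open>q\<close> accordingly; it only matters for lengths below \<open>4 q\<close>.
  The lower bound charges every colour change \<open>(i, i + q)\<close> to a cut position, each of which is charged at most twice.

  The arc threshold is explicit. The threshold of the first kind lies between two consecutive multiples of \<open>p\<close> or
  \<open>q\<close>, and its place there is determined by the minima of \<open>- j p mod q\<close> and \<open>- j q mod p\<close> over initial
  ranges of \<open>j\<close>, which a variant of the Euclidean algorithm finds in logarithmic time.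
\<close>

text \<open>The running time may not depend on \<open>h\<close>. Lengthening a word by
  \<open>p * q\<close> makes every isolated position dearer by exactly \<open>p + q - 2\<close>, so
  \<open>h\<close> can be reduced modulo that number; afterwards only lengths up to
  \<open>p * q\<close> matter, where a pair of residues occurs at most once.

  The bound \<open>4 q\<close> comes from the columns, the classes modulo \<open>q\<close>. A column
  coloured like its second entry has one cut per colour change as long as it has at most three
  entries; with four, a change in the middle separates two entries from two and costs two cuts.
  Lengths between \<open>3 q\<close> and \<open>4 q\<close> are the delicate ones: if single
  positions are already too expensive there, quotient arithmetic shows that no such middle change
  occurs. Beyond \<open>4 q\<close> similar arithmetic shows that arcs never decide.

  The minima arise because a position \<open>i\<close> of the least conceivable cost needs
  \<open>n mod p \<le> i mod p\<close> and \<open>n mod q \<le> i mod q\<close>. The best candidates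
  lie right before a multiple of \<open>p\<close> or of \<open>q\<close>: one residue is then
  maximal, and making the other large is a one-sided approximation problem.\<close>

definition class_card :: "nat \<Rightarrow> nat \<Rightarrow> nat \<Rightarrow> nat" where
  "class_card p n u = card {i. i < n \<and> i mod p = u}"

lemma class_card_eq:
  assumes "u < p"
  shows "class_card p n u = n div p + (if u < n mod p then 1 else 0)"
proof (induction n)
  case 0
  show ?case by (simp add: class_card_def)
next
  case (Suc n)
  have "{i. i < Suc n \<and> i mod p = u} =
      (if n mod p = u then insert n {i. i < n \<and> i mod p = u} else {i. i < n \<and> i mod p = u})"
    by (auto simp: less_Suc_eq)
  then have "class_card p (Suc n) u = class_card p n u + (if n mod p = u then 1 else 0)"
    by (simp add: class_card_def)
  moreover have "n mod p < p" using assms by simp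
  ultimately show ?case
    using Suc assms by (auto simp: mod_Suc div_Suc)
qed

text \<open>\<open>A\<close> and \<open>B\<close> are the residues modulo \<open>p\<close> and \<open>q\<close> that carry the first of two letters. The
  positions at which they disagree have to be holes.\<close>

definition cost :: "nat \<Rightarrow> nat \<Rightarrow> nat \<Rightarrow> nat set \<Rightarrow> nat set \<Rightarrow> nat" where
  "cost p q n A B = card {i. i < n \<and> (i mod p \<in> A) \<noteq> (i mod q \<in> B)}"

definition splits :: "nat \<Rightarrow> nat set \<Rightarrow> bool" where
  "splits p A \<longleftrightarrow> (\<exists>u<p. u \<in> A) \<and> (\<exists>u<p. u \<notin> A)"

lemma cost_mono: "n \<le> n' \<Longrightarrow> cost p q n A B \<le> cost p q n' A B"
  unfolding cost_def by (rule card_mono) auto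

lemma cost_compl: "cost p q n (- A) (- B) = cost p q n A B"
  unfolding cost_def by (rule arg_cong[where f = card]) auto

lemma splits_compl: "splits p (- A) \<longleftrightarrow> splits p A"
  by (auto simp: splits_def)

lemma mod_eq_both_iff:
  fixes p q i j :: nat
  assumes "coprime p q"
  shows "i mod p = j mod p \<and> i mod q = j mod q \<longleftrightarrow> i mod (p * q) = j mod (p * q)"
proof
  assume "i mod p = j mod p \<and> i mod q = j mod q"
  then show "i mod (p * q) = j mod (p * q)"
    using coprime_cong_mult_nat[of i j p q] assms by (simp add: cong_def)
next
  assume *: "i mod (p * q) = j mod (p * q)"
  have "x mod (p * q) mod p = x mod p" "x mod (p * q) mod q = x mod q" for x
    by (simp_all add: mod_mod_cancel)
  then show "i mod p = j mod p \<and> i mod q = j mod q" using * by metis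
qed

text \<open>The cut positions form a symmetric difference of two classes. By the Chinese remainder
  theorem their intersection is one class modulo \<open>p * q\<close>, which the right-hand side
  counts twice.\<close>

lemma cost_single:
  assumes "coprime p q"
  shows "cost p q n {i mod p} {i mod q} + 2 * class_card (p * q) n (i mod (p * q)) =
    class_card p n (i mod p) + class_card q n (i mod q)"
proof -
  let ?U = "{j. j < n \<and> j mod p = i mod p}" and ?V = "{j. j < n \<and> j mod q = i mod q}"
  have 1: "{j. j < n \<and> j mod (p * q) = i mod (p * q)} = ?U \<inter> ?V"
    using mod_eq_both_iff[OF assms] by blast
  have 2: "{j. j < n \<and> (j mod p \<in> {i mod p}) \<noteq> (j mod q \<in> {i mod q})} = (?U - ?V) \<union> (?V - ?U)"
    by auto
  have "card ((?U - ?V) \<union> (?V - ?U)) = card (?U - ?V) + card (?V - ?U)"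
    by (rule card_Un_disjoint) auto
  moreover have "card ?U = card (?U \<inter> ?V) + card (?U - ?V)" "card ?V = card (?V \<inter> ?U) + card (?V - ?U)"
    by (auto intro!: card_Int_Diff)
  ultimately show ?thesis
    unfolding cost_def class_card_def 1 2 by (simp add: Int_commute)
qed

section \<open>Colour changes along the step q\<close>

text \<open>For coprime \<open>p\<close> and \<open>q\<close>, steps of \<open>q\<close> run through
  all residues modulo \<open>p\<close> in one cycle. This is the set of edges of that cycle on which
  the colour changes, each named by its starting residue.\<close>

definition changes :: "nat \<Rightarrow> nat \<Rightarrow> nat set \<Rightarrow> nat set" where
  "changes p q A = {b. b < p \<and> (b \<in> A) \<noteq> ((b + q) mod p \<in> A)}"

lemma finite_changes [simp]: "finite (changes p q A)"
  by (simp add: changes_def)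

lemma mod_step_inj:
  fixes x p q s t :: nat
  assumes "coprime p q" "s < p" "t < p" "(x + s * q) mod p = (x + t * q) mod p"
  shows "s = t"
proof -
  have "[s * q = t * q] (mod p)"
    using assms(4) cong_add_lcancel_nat[of x "s * q" "t * q" p] by (simp add: cong_def)
  then have "[s = t] (mod p)"
    using cong_mult_rcancel_nat[of q p s t] assms(1) coprime_commute[of p q] by blast
  then show ?thesis using assms(2,3) by (simp add: cong_def)
qed

lemma mod_step_surj:
  fixes x y p q :: nat
  assumes "coprime p q" "y < p"
  obtains t where "t < p" "(x + t * q) mod p = y"
proof -
  let ?f = "\<lambda>t. (x + t * q) mod p"
  have inj: "inj_on ?f {..<p}"
    by (intro inj_onI) (rule mod_step_inj[OF assms(1)], auto)
  moreover have "?f ` {..<p} \<subseteq> {..<p}" using assms(2) by auto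
  ultimately have "?f ` {..<p} = {..<p}"
    by (intro endo_inj_surj) simp_all
  then have "y \<in> ?f ` {..<p}" using assms(2) by simp
  then show thesis using that by blast
qed

lemma card_changes_ge:
  assumes "coprime p q" "T \<subseteq> {..<p}"
    and "\<And>t. c t \<longleftrightarrow> (x + t * q) mod p \<in> A" "\<And>t. t \<in> T \<Longrightarrow> c t \<noteq> c (Suc t)"
  shows "card T \<le> card (changes p q A)"
proof -
  let ?f = "\<lambda>t. (x + t * q) mod p"
  have "inj_on ?f T"
    using assms(2) by (intro inj_onI) (rule mod_step_inj[OF assms(1)], auto)
  moreover have "?f ` T \<subseteq> changes p q A"
  proof
    fix b assume "b \<in> ?f ` T"
    then obtain t where t: "t \<in> T" "b = ?f t" by auto
    then have "b < p" using assms(2) by auto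
    moreover have "(b + q) mod p = (x + Suc t * q) mod p"
      by (simp add: t(2) mod_simps algebra_simps)
    ultimately show "b \<in> changes p q A"
      using assms(4)[OF t(1)] t(2) unfolding assms(3) by (simp add: changes_def)
  qed
  ultimately show ?thesis by (meson card_inj_on_le finite_changes)
qed

lemma change_between:
  fixes c :: "nat \<Rightarrow> bool"
  assumes "s \<le> t" "c s \<noteq> c t"
  obtains u where "s \<le> u" "u < t" "c u \<noteq> c (Suc u)"
proof -
  have "\<exists>u. s \<le> u \<and> u < t \<and> c u \<noteq> c (Suc u)"
    using assms
  proof (induction t rule: dec_induct)
    case (step n)
    show ?case
    proof (cases "c s = c n")
      case True
      then show ?thesis using step by (intro exI[of _ n]) auto
    next
      case False
      then show ?thesis using step less_SucI by blast
    qed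
  qed simp
  then show thesis using that by blast
qed

text \<open>A walk around the cycle from a residue in \<open>A\<close> has to leave \<open>A\<close>
  before it meets \<open>y\<close>, and to come back before the turn ends.\<close>

lemma card_changes_ge_2:
  assumes "coprime p q" "splits p A"
  shows "2 \<le> card (changes p q A)"
proof -
  obtain x y where x: "x < p" "x \<in> A" and y: "y < p" "y \<notin> A"
    using assms(2) by (auto simp: splits_def)
  obtain t where t: "t < p" "(x + t * q) mod p = y"
    using mod_step_surj[OF assms(1) y(1)] .
  define c where "c s = ((x + s * q) mod p \<in> A)" for s
  have c: "c 0" "\<not> c t" "c p" using x y t by (auto simp: c_def)
  obtain u1 where u1: "0 \<le> u1" "u1 < t" "c u1 \<noteq> c (Suc u1)" using c change_between[of 0 t c] by auto
  obtain u2 where u2: "t \<le> u2" "u2 < p" "c u2 \<noteq> c (Suc u2)" using c t change_between[of t p c] by auto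
  have ch: "c s \<noteq> c (Suc s)" if "s \<in> {u1, u2}" for s using that u1(3) u2(3) by blast
  have "card {u1, u2} \<le> card (changes p q A)"
    using u1(1,2) u2(1,2) by (intro card_changes_ge[OF assms(1) _ c_def ch]) auto
  moreover have "card {u1, u2} = 2" using u1(1,2) u2(1,2) by simp
  ultimately show ?thesis by linarith
qed

text \<open>Two consecutive changes cut off an arc consisting of \<open>b + q\<close> alone. A
  further residue \<open>y\<close> of the same colour lies on another arc, whose two ends are two
  more changes.\<close>

lemma card_changes_ge_4_run1:
  assumes "coprime p q" "b \<in> changes p q A" "(b + q) mod p \<in> changes p q A"
    and y: "y < p" "y \<noteq> (b + q) mod p" "y \<in> A \<longleftrightarrow> (b + q) mod p \<in> A"
  shows "4 \<le> card (changes p q A)"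
proof -
  define x where "x = (b + q) mod p"
  obtain t where t: "t < p" "(x + t * q) mod p = y"
    using mod_step_surj[OF assms(1) y(1)] .
  define c where "c s = ((x + s * q) mod p \<in> A)" for s
  have xp: "x < p" "b < p" using y(1) assms(2) by (auto simp: x_def changes_def)
  have e: "(x + (p - 1) * q) mod p = b"
  proof -
    have "(x + (p - 1) * q) mod p = (b + q + (p - 1) * q) mod p" by (simp add: x_def mod_simps)
    also have "b + q + (p - 1) * q = b + p * q" using y(1) by (cases p) auto
    finally show ?thesis using xp by simp
  qed
  have yx: "y \<noteq> x" "y \<in> A \<longleftrightarrow> x \<in> A" using y by (simp_all add: x_def)
  have c0: "c 0 = (x \<in> A)" "c t = (x \<in> A)" "c p = (x \<in> A)"
    unfolding c_def t(2) yx(2) using xp by simp_all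
  have c1: "c 1 \<noteq> (x \<in> A)" using assms(3) by (auto simp add: c_def changes_def simp flip: x_def)
  have c2: "c (p - 1) \<noteq> (x \<in> A)"
    unfolding c_def e using assms(2) by (simp add: changes_def flip: x_def)
  have "t \<noteq> 0"
  proof
    assume "t = 0"
    then have "y = x" using t(2) xp by simp
    then show False using yx(1) by simp
  qed
  have "1 \<le> t" using \<open>t \<noteq> 0\<close> by simp
  moreover have "c 1 \<noteq> c t" using c0 c1 by blast
  ultimately obtain u1 where u1: "1 \<le> u1" "u1 < t" "c u1 \<noteq> c (Suc u1)"
    using change_between by blast
  have "t \<le> p - 1" using t(1) by linarith
  moreover have "c t \<noteq> c (p - 1)" using c0 c2 by blast
  ultimately obtain u2 where u2: "t \<le> u2" "u2 < p - 1" "c u2 \<noteq> c (Suc u2)" using change_between by blast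
  have "c (Suc (p - 1)) = (x \<in> A)" using c0 y(1) by simp
  have ch: "c s \<noteq> c (Suc s)" if s: "s \<in> {0, u1, u2, p - 1}" for s
  proof -
    consider "s = 0" | "s = u1" | "s = u2" | "s = p - 1" using s by blast
    then show ?thesis
      using u1(3) u2(3) c0 c1 c2 \<open>c (Suc (p - 1)) = (x \<in> A)\<close> by cases simp_all
  qed
  have "card {0, u1, u2, p - 1} \<le> card (changes p q A)"
    using u1(1,2) u2(1,2) xp by (intro card_changes_ge[OF assms(1) _ c_def ch]) auto
  moreover have "card {0, u1, u2, p - 1} = 4" using u1(1,2) u2(1,2) by simp
  ultimately show ?thesis by linarith
qed

text \<open>The same argument for an arc of exactly two residues, \<open>b + q\<close> and
  \<open>b + 2 * q\<close>.\<close>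

lemma card_changes_ge_4_run2:
  assumes "coprime p q" "b \<in> changes p q A" "(b + q) mod p \<notin> changes p q A"
    "(b + 2 * q) mod p \<in> changes p q A"
    and y: "y < p" "y \<noteq> (b + q) mod p" "y \<noteq> (b + 2 * q) mod p" "y \<in> A \<longleftrightarrow> (b + q) mod p \<in> A"
  shows "4 \<le> card (changes p q A)"
proof -
  define x where "x = (b + q) mod p"
  obtain t where t: "t < p" "(x + t * q) mod p = y"
    using mod_step_surj[OF assms(1) y(1)] .
  define c where "c s = ((x + s * q) mod p \<in> A)" for s
  have xp: "x < p" "b < p" using y(1) assms(2) by (auto simp: x_def changes_def)
  have e: "(x + (p - 1) * q) mod p = b"
  proof -
    have "(x + (p - 1) * q) mod p = (b + q + (p - 1) * q) mod p" by (simp add: x_def mod_simps)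
    also have "b + q + (p - 1) * q = b + p * q" using y(1) by (cases p) auto
    finally show ?thesis using xp by simp
  qed
  have e1: "(x + 1 * q) mod p = (b + 2 * q) mod p" by (simp add: x_def mod_simps algebra_simps mult_2_right)
  have e2: "((b + 2 * q) mod p + q) mod p = (x + 2 * q) mod p"
    by (simp add: x_def mod_simps algebra_simps)
  have yx: "y \<noteq> x" "y \<in> A \<longleftrightarrow> x \<in> A" using y by (simp_all add: x_def)
  have c0: "c 0 = (x \<in> A)" "c t = (x \<in> A)" "c p = (x \<in> A)"
    unfolding c_def t(2) yx(2) using xp by simp_all
  have c1: "c 1 = (x \<in> A)"
    using assms(3) xp by (auto simp add: c_def changes_def simp flip: x_def)
  have c2: "c 2 \<noteq> (x \<in> A)"
    using assms(4) e1 e2 c1 unfolding c_def changes_def by (simp; blast)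
  have c3: "c (p - 1) \<noteq> (x \<in> A)"
    unfolding c_def e using assms(2) by (simp add: changes_def flip: x_def)
  have "t \<noteq> 0"
  proof
    assume "t = 0"
    then have "y = x" using t(2) xp by simp
    then show False using yx(1) by simp
  qed
  moreover have "t \<noteq> 1" using t(2) y(3) e1 by blast
  moreover have "t \<noteq> 2" using c0 c2 by metis
  ultimately have tt: "2 < t" by linarith
  have "2 \<le> t" using tt by simp
  moreover have "c 2 \<noteq> c t" using c0 c2 by blast
  ultimately obtain u1 where u1: "2 \<le> u1" "u1 < t" "c u1 \<noteq> c (Suc u1)"
    using change_between by blast
  have "t \<le> p - 1" using t(1) by linarith
  moreover have "c t \<noteq> c (p - 1)" using c0 c3 by blast
  ultimately obtain u2 where u2: "t \<le> u2" "u2 < p - 1" "c u2 \<noteq> c (Suc u2)" using change_between by blast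
  have "c (Suc (p - 1)) = (x \<in> A)" using c0 y(1) by simp
  have ch: "c s \<noteq> c (Suc s)" if s: "s \<in> {1, u1, u2, p - 1}" for s
  proof -
    consider "s = 1" | "s = u1" | "s = u2" | "s = p - 1" using s by blast
    then show ?thesis
      using u1(3) u2(3) c0 c1 c2 c3 \<open>c (Suc (p - 1)) = (x \<in> A)\<close> by cases (simp_all add: numeral_2_eq_2)
  qed
  have "card {1, u1, u2, p - 1} \<le> card (changes p q A)"
    using u1(1,2) u2(1,2) xp by (intro card_changes_ge[OF assms(1) _ c_def ch]) auto
  moreover have "card {1, u1, u2, p - 1} = 4" using u1(1,2) u2(1,2) by simp
  ultimately show ?thesis by linarith
qed

section \<open>Charging colour changes to cut positions\<close>

definition boundary :: "nat \<Rightarrow> nat \<Rightarrow> nat \<Rightarrow> nat set \<Rightarrow> nat set" where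
  "boundary p q n A = {i. i + q < n \<and> i mod p \<in> changes p q A}"

definition cut :: "nat \<Rightarrow> nat \<Rightarrow> nat \<Rightarrow> nat set \<Rightarrow> nat set \<Rightarrow> nat set" where
  "cut p q n A B = {i. i < n \<and> (i mod p \<in> A) \<noteq> (i mod q \<in> B)}"

text \<open>The cost of a two-arc colouring, once its two changes are put at the rarest residues \<open>p - 2\<close> and
  \<open>p - 1\<close>.\<close>

definition arc_cost :: "nat \<Rightarrow> nat \<Rightarrow> nat \<Rightarrow> nat" where
  "arc_cost p q n = 2 * ((n - q) div p) + (if (n - q) mod p = p - 1 then 1 else 0)"

lemma cost_eq_card_cut: "cost p q n A B = card (cut p q n A B)"
  by (simp add: cost_def cut_def)

lemma finite_cut [simp]: "finite (cut p q n A B)"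
  by (simp add: cut_def)

lemma finite_boundary [simp]: "finite (boundary p q n A)"
  by (rule finite_subset[of _ "{..<n}"]) (auto simp: boundary_def)

lemma mod_changes_iff:
  "0 < p \<Longrightarrow> i mod p \<in> changes p q A \<longleftrightarrow> (i mod p \<in> A) \<noteq> ((i + q) mod p \<in> A)"
  by (simp add: changes_def mod_simps)

text \<open>The charging step: \<open>i\<close> and \<open>i + q\<close> have the same residue
  modulo \<open>q\<close>, hence the same colour from \<open>B\<close>, while their colours from
  \<open>A\<close> differ. One of the two must be cut.\<close>

lemma boundary_cut:
  assumes "0 < p" "i \<in> boundary p q n A" "i \<notin> cut p q n A B"
  shows "i + q \<in> cut p q n A B"
  using assms mod_changes_iff[of p i q A] by (auto simp: boundary_def cut_def)

lemma card_boundary: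
  assumes "0 < p"
  shows "card (boundary p q n A) = (\<Sum>b\<in>changes p q A. class_card p (n - q) b)"
proof -
  have "boundary p q n A = (\<Union>b\<in>changes p q A. {i. i < n - q \<and> i mod p = b})"
    by (auto simp: boundary_def)
  then show ?thesis
    unfolding class_card_def by (simp only:) (rule card_UN_disjoint, auto)
qed

lemma card_boundary_ge:
  assumes "0 < p"
  shows "card (changes p q A) * ((n - q) div p) \<le> card (boundary p q n A)"
proof -
  have "(\<Sum>b\<in>changes p q A. (n - q) div p) \<le> (\<Sum>b\<in>changes p q A. class_card p (n - q) b)"
    by (rule sum_mono) (simp add: changes_def class_card_eq)
  then show ?thesis using assms by (simp add: card_boundary)
qed

text \<open>In this case every residue except \<open>p - 1\<close> occurs once more than
  \<open>(n - q) div p\<close> times below \<open>n - q\<close>, so at most one change misses the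
  extra occurrence.\<close>

lemma card_boundary_ge_full:
  assumes "0 < p" "(n - q) mod p = p - 1"
  shows "card (changes p q A) * ((n - q) div p + 1) \<le> card (boundary p q n A) + 1"
proof -
  let ?C = "changes p q A"
  have "(\<Sum>b\<in>?C. (n - q) div p + 1) \<le> (\<Sum>b\<in>?C. class_card p (n - q) b + (if b = p - 1 then 1 else 0))"
    by (rule sum_mono) (use assms in \<open>auto simp: changes_def class_card_eq\<close>)
  also have "\<dots> = card (boundary p q n A) + (\<Sum>b\<in>?C. if b = p - 1 then 1 else 0)"
    using assms(1) by (simp add: card_boundary sum.distrib)
  also have "(\<Sum>b\<in>?C. if b = p - 1 then 1 else 0) \<le> (1::nat)"
    by (simp add: sum.delta)
  finally show ?thesis by simp
qed

lemma arc_cost_le_card_boundary: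
  assumes "0 < p" "2 \<le> card (changes p q A)"
  shows "arc_cost p q n \<le> card (boundary p q n A)"
proof (cases "(n - q) mod p = p - 1")
  case True
  have "2 * ((n - q) div p + 1) \<le> card (changes p q A) * ((n - q) div p + 1)"
    using assms(2) by (rule mult_le_mono1)
  with card_boundary_ge_full[OF assms(1) True, of A] True show ?thesis by (simp add: arc_cost_def)
next
  case False
  have "2 * ((n - q) div p) \<le> card (changes p q A) * ((n - q) div p)"
    using assms(2) by (rule mult_le_mono1)
  then have "2 * ((n - q) div p) \<le> card (boundary p q n A)"
    using card_boundary_ge[OF assms(1), of q A n] by (rule le_trans)
  then show ?thesis using False by (simp add: arc_cost_def)
qed

lemma arc_cost_double_le_card_boundary:
  assumes "0 < p" "4 \<le> card (changes p q A)"
  shows "2 * arc_cost p q n \<le> card (boundary p q n A) + 1"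
proof (cases "(n - q) mod p = p - 1")
  case True
  have "4 * ((n - q) div p + 1) \<le> card (changes p q A) * ((n - q) div p + 1)"
    using assms(2) by (rule mult_le_mono1)
  with card_boundary_ge_full[OF assms(1) True, of A] True show ?thesis by (simp add: arc_cost_def)
next
  case False
  have "4 * ((n - q) div p) \<le> card (changes p q A) * ((n - q) div p)"
    using assms(2) by (rule mult_le_mono1)
  then have "4 * ((n - q) div p) \<le> card (boundary p q n A)"
    using card_boundary_ge[OF assms(1), of q A n] by (rule le_trans)
  then show ?thesis using False by (simp add: arc_cost_def)
qed

lemma boundary_split:
  assumes "0 < p"
  shows "card (boundary p q n A) \<le>
    card (cut p q n A B \<inter> boundary p q n A) + card (cut p q n A B \<inter> (\<lambda>i. i + q) ` boundary p q n A)"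
proof -
  let ?S = "boundary p q n A" and ?C = "cut p q n A B"
  let ?D = "{i \<in> ?S. i + q \<in> ?C}"
  have "?S \<subseteq> (?C \<inter> ?S) \<union> ?D" using boundary_cut[OF assms] by auto
  then have "card ?S \<le> card ((?C \<inter> ?S) \<union> ?D)" by (intro card_mono) auto
  also have "\<dots> \<le> card (?C \<inter> ?S) + card ?D" by (rule card_Un_le)
  also have "card ?D = card ((\<lambda>i. i + q) ` ?D)" by (rule card_image[symmetric]) (simp add: inj_on_def)
  also have "(\<lambda>i. i + q) ` ?D = ?C \<inter> (\<lambda>i. i + q) ` ?S" by auto
  finally show ?thesis by simp
qed

lemma card_boundary_le_double_cost:
  assumes "0 < p"
  shows "card (boundary p q n A) \<le> 2 * cost p q n A B"
proof -
  let ?C = "cut p q n A B"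
  have le: "card (?C \<inter> X) \<le> card ?C" for X by (rule card_mono) auto
  show ?thesis
    using boundary_split[OF assms, of q n A B] le[of "boundary p q n A"]
      le[of "(\<lambda>i. i + q) ` boundary p q n A"]
    unfolding cost_eq_card_cut by linarith
qed

text \<open>Strict because the pair starting at \<open>b\<close> has a cut end that is charged only
  once: \<open>b < q\<close> is not an upper end, and \<open>b + q\<close> is not a lower end, as no
  change starts there.\<close>

lemma card_boundary_less_double_cost:
  assumes "0 < p" "p < q" "2 * q \<le> n" "b \<in> changes p q A" "(b + q) mod p \<notin> changes p q A"
  shows "card (boundary p q n A) < 2 * cost p q n A B"
proof -
  let ?C = "cut p q n A B" and ?S = "boundary p q n A"
  let ?S' = "(\<lambda>i. i + q) ` boundary p q n A"
  have le: "card (?C \<inter> X) \<le> card ?C" for X by (rule card_mono) auto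
  have b: "b < p" using assms(4) by (simp add: changes_def)
  have bS: "b \<in> ?S" using b assms by (simp add: boundary_def)
  show ?thesis
  proof (cases "b \<in> ?C")
    case True
    have "b \<notin> ?S'" using b assms(2) by auto
    with True have "?C \<inter> ?S' \<subset> ?C" by blast
    then have "card (?C \<inter> ?S') < card ?C" by (rule psubset_card_mono[rotated]) simp
    with boundary_split[OF assms(1), of q n A B] le[of ?S] show ?thesis
      unfolding cost_eq_card_cut by linarith
  next
    case False
    then have "b + q \<in> ?C" using boundary_cut[OF assms(1) bS] by blast
    moreover have "b + q \<notin> ?S" using assms(5) by (simp add: boundary_def)
    ultimately have "?C \<inter> ?S \<subset> ?C" by blast
    then have "card (?C \<inter> ?S) < card ?C" by (rule psubset_card_mono[rotated]) simp
    with boundary_split[OF assms(1), of q n A B] le[of ?S'] show ?thesis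
      unfolding cost_eq_card_cut by linarith
  qed
qed

text \<open>At this length a column has at most two entries, so no position lies in two pairs
  \<open>(i, i + q)\<close> and every pair has its own cut position.\<close>

lemma card_boundary_le_cost_short:
  assumes "0 < p" "n \<le> 2 * q"
  shows "card (boundary p q n A) \<le> cost p q n A B"
  unfolding cost_eq_card_cut
proof (rule card_inj_on_le)
  let ?f = "\<lambda>i. if i \<in> cut p q n A B then i else i + q"
  show "inj_on ?f (boundary p q n A)"
    using assms by (auto simp: inj_on_def boundary_def)
  show "?f ` boundary p q n A \<subseteq> cut p q n A B"
    using boundary_cut[OF assms(1)] by auto
qed simp

lemma isolated_changes_inj:
  assumes "0 < p" "\<And>b. b \<in> changes p q A \<Longrightarrow> (b + q) mod p \<notin> changes p q A"
  shows "inj_on (\<lambda>i. if i \<in> cut p q n A B then i else i + q) (boundary p q n A)"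
proof -
  have "i + q \<notin> boundary p q n A" if "i \<in> boundary p q n A" for i
    using that assms(2)[of "i mod p"] by (auto simp: boundary_def mod_simps)
  then show ?thesis by (auto simp: inj_on_def)
qed

lemma card_boundary_le_cost_isolated:
  assumes "0 < p" "\<And>b. b \<in> changes p q A \<Longrightarrow> (b + q) mod p \<notin> changes p q A"
  shows "card (boundary p q n A) \<le> cost p q n A B"
  unfolding cost_eq_card_cut
proof (rule card_inj_on_le[OF isolated_changes_inj[OF assms, where B = B and n = n]])
  show "(\<lambda>i. if i \<in> cut p q n A B then i else i + q) ` boundary p q n A \<subseteq> cut p q n A B"
    using boundary_cut[OF assms(1)] by auto
qed simp_all

text \<open>Around a change \<open>(i, i + q)\<close> in the interior of a column, two positions on the same side are cut, and
  the outer one is charged by no change.\<close>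

lemma card_boundary_less_cost_isolated:
  assumes "0 < p" and iso1: "\<And>b. b \<in> changes p q A \<Longrightarrow> (b + q) mod p \<notin> changes p q A"
    and iso2: "\<And>b. b \<in> changes p q A \<Longrightarrow> (b + 2 * q) mod p \<notin> changes p q A"
    and i: "i mod p \<in> changes p q A" "q \<le> i" "i + 2 * q < n"
  shows "card (boundary p q n A) < cost p q n A B"
proof -
  let ?C = "cut p q n A B" and ?S = "boundary p q n A"
  let ?f = "\<lambda>i. if i \<in> ?C then i else i + q"
  have s1: "x + q \<notin> ?S" if "x \<in> ?S" for x
    using that iso1[of "x mod p"] by (auto simp: boundary_def mod_simps)
  have s2: "x + 2 * q \<notin> ?S" if "x \<in> ?S" for x
    using that iso2[of "x mod p"] by (auto simp: boundary_def mod_simps)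
  have iS: "i \<in> ?S" using i by (simp add: boundary_def)
  have P: "(x mod p \<in> A) = ((x + q) mod p \<in> A)" if "x + q < n" "x \<notin> ?S" for x
    using that mod_changes_iff[OF assms(1), of x q A] by (auto simp: boundary_def)
  have iP: "(i mod p \<in> A) \<noteq> ((i + q) mod p \<in> A)"
    using i(1) mod_changes_iff[OF assms(1), of i q A] by blast
  have "\<exists>x \<in> ?C. x \<notin> ?f ` ?S"
  proof (cases "i \<in> ?C")
    case True
    have im: "i - q \<notin> ?S" using s1[of "i - q"] iS i(2) by auto
    have "((i - q) mod p \<in> A) = (i mod p \<in> A)" using P[of "i - q"] im i by simp
    moreover have "(i - q) mod q = i mod q" using i(2) by (simp add: le_mod_geq)
    ultimately have "i - q \<in> ?C" using True by (auto simp: cut_def)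
    moreover have "i - q \<notin> ?f ` ?S"
    proof
      assume "i - q \<in> ?f ` ?S"
      then obtain x where x: "x \<in> ?S" "i - q = x \<or> i - q = x + q" by (auto split: if_splits)
      then have "i - q = x + q" using im by blast
      then have "i = x + 2 * q" using i(2) by linarith
      then show False using s2[OF x(1)] iS by simp
    qed
    ultimately show ?thesis by blast
  next
    case False
    then have c: "i + q \<in> ?C" using boundary_cut[OF assms(1) iS] by blast
    have ip: "i + q \<notin> ?S" using s1[OF iS] .
    have "((i + q) mod p \<in> A) = ((i + q + q) mod p \<in> A)" using P[of "i + q"] ip i by simp
    then have "i + 2 * q \<in> ?C" using c i(3) by (simp add: cut_def mult_2 flip: add.assoc)
    moreover have "i + 2 * q \<notin> ?f ` ?S"
    proof
      assume "i + 2 * q \<in> ?f ` ?S"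
      then obtain x where x: "x \<in> ?S" "i + 2 * q = x \<or> i + 2 * q = x + q" by (auto split: if_splits)
      moreover have "i + 2 * q \<noteq> x + q"
      proof
        assume "i + 2 * q = x + q"
        then have "x = i + q" by simp
        then show False using ip x(1) by simp
      qed
      ultimately have "x = i + 2 * q" by simp
      then show False using s2[OF iS] x(1) by simp
    qed
    ultimately show ?thesis by blast
  qed
  then have "?f ` ?S \<subset> ?C" using boundary_cut[OF assms(1)] by auto
  then have "card (?f ` ?S) < card ?C" by (rule psubset_card_mono[rotated]) simp
  moreover have "card (?f ` ?S) = card ?S"
    by (rule card_image[OF isolated_changes_inj[OF assms(1) iso1]])
  ultimately show ?thesis by (simp add: cost_eq_card_cut)
qed

section \<open>Lower bounds on the cost\<close>

text \<open>The cost is a sum over the classes modulo \<open>q\<close>, and each summand depends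
  only on whether that class belongs to \<open>B\<close>. Removing it is no loss when at least half
  of its entries lie outside \<open>A\<close>.\<close>

lemma cost_mono_columns:
  assumes "0 < q" "B' \<subseteq> B"
    and "\<And>v. v < q \<Longrightarrow> v \<in> B \<Longrightarrow> v \<notin> B' \<Longrightarrow>
      card {i. i < n \<and> i mod q = v \<and> i mod p \<in> A} \<le> card {i. i < n \<and> i mod q = v \<and> i mod p \<notin> A}"
  shows "cost p q n A B' \<le> cost p q n A B"
proof -
  have col: "cost p q n A E = (\<Sum>v<q. card {i \<in> cut p q n A E. i mod q = v})" for E
  proof -
    have "(\<Sum>v<q. \<Sum>i | i \<in> cut p q n A E \<and> i mod q = v. 1) = (\<Sum>i\<in>cut p q n A E. (1::nat))"
      by (rule sum.group) (use assms(1) in auto)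
    then show ?thesis by (simp add: cost_eq_card_cut)
  qed
  have "card {i \<in> cut p q n A B'. i mod q = v} \<le> card {i \<in> cut p q n A B. i mod q = v}" if "v < q" for v
  proof (cases "v \<in> B \<and> v \<notin> B'")
    case True
    have "{i \<in> cut p q n A B'. i mod q = v} = {i. i < n \<and> i mod q = v \<and> i mod p \<in> A}"
      "{i \<in> cut p q n A B. i mod q = v} = {i. i < n \<and> i mod q = v \<and> i mod p \<notin> A}"
      using True by (auto simp: cut_def)
    then show ?thesis using assms(3)[OF that] True by simp
  next
    case False
    then have "{i \<in> cut p q n A B'. i mod q = v} = {i \<in> cut p q n A B. i mod q = v}"
      using assms(2) by (auto simp: cut_def)
    then show ?thesis by simp
  qed
  then show ?thesis unfolding col by (intro sum_mono) simp
qed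

lemma cost_cong_left:
  assumes "0 < p" "\<And>x. x < p \<Longrightarrow> x \<in> A \<longleftrightarrow> x \<in> A'"
  shows "cost p q n A B = cost p q n A' B"
  using assms by (simp add: cost_def)

text \<open>With \<open>A\<close> reduced to \<open>u\<close>, at least half of the entries of every
  column have another residue: each entry of residue \<open>u\<close> is matched with a neighbour at
  distance \<open>q\<close>. So all columns except \<open>v\<close> may be taken out of
  \<open>B\<close>.\<close>

lemma cost_ge_singletons:
  assumes "coprime p q" "3 \<le> p" "0 < q" "2 * q \<le> n" "\<And>x. x < p \<Longrightarrow> x \<in> A \<longleftrightarrow> x = u" "v \<in> B"
  shows "cost p q n {u} {v} \<le> cost p q n A B"
proof -
  have "cost p q n {u} {v} \<le> cost p q n {u} B"
  proof (rule cost_mono_columns)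
    fix w
    let ?f = "\<lambda>i. if i + q < n then i + q else i - q"
    let ?X = "{i. i < n \<and> i mod q = w \<and> i mod p \<in> {u}}"
    have neq: "(i + q) mod p \<noteq> i mod p" for i
    proof
      assume "(i + q) mod p = i mod p"
      then have "p dvd q" by (metis add_diff_cancel_left' le_add1 mod_eq_dvd_iff_nat)
      then have "is_unit p" using assms(1) coprime_common_divisor[of p q p] by simp
      then show False using assms(2) by simp
    qed
    have neq2: "(i + 2 * q) mod p \<noteq> i mod p" for i
    proof
      assume "(i + 2 * q) mod p = i mod p"
      then have "p dvd 2 * q" by (metis add_diff_cancel_left' le_add1 mod_eq_dvd_iff_nat)
      then have "p dvd 2" using assms(1) by (simp add: coprime_dvd_mult_left_iff)
      then have "p \<le> 2" by (rule dvd_imp_le) simp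
      then show False using assms(2) by simp
    qed
    show "card ?X \<le> card {i. i < n \<and> i mod q = w \<and> i mod p \<notin> {u}}"
    proof (rule card_inj_on_le)
      show "inj_on ?f ?X"
      proof (rule inj_onI)
        fix i j assume ij: "i \<in> ?X" "j \<in> ?X" "?f i = ?f j"
        \<comment> \<open>Two entries sharing their matched neighbour would be at distance
          \<open>2 * q\<close> and both of residue \<open>u\<close>, which coprimality and
          \<open>3 \<le> p\<close> exclude.\<close>
        have no: False if "x \<in> ?X" "y \<in> ?X" "x + q = y - q" "\<not> y + q < n" for x y
        proof -
          have "y = x + 2 * q" using that(3,4) assms(3,4) by linarith
          then show False using neq2[of x] that(1,2) by simp
        qed
        show "i = j"
        proof (cases "i + q < n"; cases "j + q < n")
          assume "\<not> i + q < n" "\<not> j + q < n"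
          then show ?thesis using ij(3) assms(4) by simp
        qed (use ij no[of i j] no[of j i] in \<open>auto split: if_splits\<close>)
      qed
      show "?f ` ?X \<subseteq> {i. i < n \<and> i mod q = w \<and> i mod p \<notin> {u}}"
      proof
        fix y assume "y \<in> ?f ` ?X"
        then obtain i where i: "i \<in> ?X" "y = ?f i" by blast
        show "y \<in> {i. i < n \<and> i mod q = w \<and> i mod p \<notin> {u}}"
        proof (cases "i + q < n")
          case True
          then show ?thesis using i neq[of i] by simp
        next
          case False
          then have "q \<le> i" using assms(4) by simp
          then show ?thesis using i neq[of "i - q"] False by (simp add: le_mod_geq less_imp_diff_less)
        qed
      qed
    qed simp
  qed (use assms in auto)
  also have "\<dots> = cost p q n A B" by (rule cost_cong_left) (use assms in auto)
  finally show ?thesis .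
qed

text \<open>A column has at least four entries and, as \<open>n \<le> p * q\<close>, at most one
  from each of the two classes. So entries in \<open>A\<close> are never a majority, and the empty
  \<open>B\<close> is no worse; it cuts both classes entirely.\<close>

lemma cost_ge_two_classes:
  assumes "coprime p q" "0 < p" "0 < q" "4 * q \<le> n" "n \<le> p * q"
    and A: "\<And>x. x < p \<Longrightarrow> x \<in> A \<Longrightarrow> x = u1 \<or> x = u2"
    and u: "u1 \<in> A" "u2 \<in> A" "u1 \<noteq> u2"
  shows "class_card p n u1 + class_card p n u2 \<le> cost p q n A B"
proof -
  have "cost p q n A {} \<le> cost p q n A B"
  proof (rule cost_mono_columns)
    fix v assume v: "v < q"
    let ?I = "{i. i < n \<and> i mod q = v \<and> i mod p \<in> A}"
    let ?O = "{i. i < n \<and> i mod q = v \<and> i mod p \<notin> A}"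
    have one: "card {i. i < n \<and> i mod q = v \<and> i mod p = u} \<le> 1" for u
    proof -
      have "i = j" if "i < n" "j < n" "i mod q = v" "j mod q = v" "i mod p = u" "j mod p = u" for i j
      proof -
        have "i mod (p * q) = j mod (p * q)"
          using that mod_eq_both_iff[OF assms(1), of i j] by simp
        then show ?thesis using that assms(5) by simp
      qed
      then show ?thesis by (intro card_le_Suc0_iff_eq[THEN iffD2, unfolded One_nat_def[symmetric]]) auto
    qed
    have A': "i mod p = u1 \<or> i mod p = u2" if "i mod p \<in> A" for i
      using A[OF mod_less_divisor[OF assms(2)] that] .
    have "card ?I \<le> card ({i. i < n \<and> i mod q = v \<and> i mod p = u1} \<union> {i. i < n \<and> i mod q = v \<and> i mod p = u2})"
      using A' by (intro card_mono) auto
    also have "\<dots> \<le> card {i. i < n \<and> i mod q = v \<and> i mod p = u1} + card {i. i < n \<and> i mod q = v \<and> i mod p = u2}"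
      by (rule card_Un_le)
    finally have I: "card ?I \<le> 2" using one[of u1] one[of u2] by linarith
    have "n div q \<le> class_card q n v" by (simp add: class_card_eq[OF v])
    moreover have "4 \<le> n div q" using assms(3,4) by (simp add: less_eq_div_iff_mult_less_eq)
    moreover have "class_card q n v = card (?I \<union> ?O)"
      unfolding class_card_def by (rule arg_cong[where f = card]) auto
    moreover have "card (?I \<union> ?O) = card ?I + card ?O" by (rule card_Un_disjoint) auto
    ultimately show "card ?I \<le> card ?O" using I by linarith
  qed (use assms in auto)
  moreover have "class_card p n u1 + class_card p n u2 \<le> cost p q n A {}"
  proof -
    have "card ({i. i < n \<and> i mod p = u1} \<union> {i. i < n \<and> i mod p = u2}) = class_card p n u1 + class_card p n u2"
      unfolding class_card_def using u(3) by (intro card_Un_disjoint) auto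
    moreover have "card ({i. i < n \<and> i mod p = u1} \<union> {i. i < n \<and> i mod p = u2}) \<le> cost p q n A {}"
      unfolding cost_def using u by (intro card_mono) auto
    ultimately show ?thesis by simp
  qed
  ultimately show ?thesis by simp
qed

section \<open>Colourings with at least two residues of each colour\<close>

definition wide :: "nat \<Rightarrow> nat set \<Rightarrow> bool" where
  "wide p A \<longleftrightarrow> (\<exists>u<p. \<exists>w<p. u \<noteq> w \<and> u \<in> A \<and> w \<in> A)"

lemma wide_other:
  assumes "wide p A" "wide p (- A)"
  obtains y where "y < p" "y \<noteq> x" "y \<in> A \<longleftrightarrow> x \<in> A"
  using assms unfolding wide_def by (metis ComplD ComplI)

lemma wide_splits: "wide p A \<Longrightarrow> wide p (- A) \<Longrightarrow> splits p A"
  by (auto simp: wide_def splits_def)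

lemma wide_isolated:
  assumes "coprime p q" "wide p A" "wide p (- A)" "card (changes p q A) < 4" "b \<in> changes p q A"
  shows "(b + q) mod p \<notin> changes p q A"
proof
  assume b: "(b + q) mod p \<in> changes p q A"
  obtain y where "y < p" "y \<noteq> (b + q) mod p" "y \<in> A \<longleftrightarrow> (b + q) mod p \<in> A"
    using wide_other[OF assms(2,3)] .
  then show False using card_changes_ge_4_run1[OF assms(1,5) b] assms(4) by fastforce
qed

text \<open>Fewer than four changes are isolated, so the charging is injective. With four or more, a
  cut position may be charged twice, but there are at least twice as many changes as an arc
  has.\<close>

lemma cost_ge_arc_cost_wide:
  assumes "coprime p q" "0 < p" "wide p A" "wide p (- A)"
  shows "arc_cost p q n \<le> cost p q n A B"
proof (cases "card (changes p q A) < 4")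
  case True
  have "arc_cost p q n \<le> card (boundary p q n A)"
    by (rule arc_cost_le_card_boundary[OF assms(2) card_changes_ge_2[OF assms(1) wide_splits[OF assms(3,4)]]])
  also have "\<dots> \<le> cost p q n A B"
    by (rule card_boundary_le_cost_isolated[OF assms(2)]) (rule wide_isolated[OF assms(1,3,4) True])
  finally show ?thesis .
next
  case False
  then show ?thesis
    using arc_cost_double_le_card_boundary[OF assms(2), of q A n] card_boundary_le_double_cost[OF assms(2), of q n A B]
    by linarith
qed

lemma cost_ge_arc_cost_short:
  assumes "coprime p q" "0 < p" "splits p A" "n \<le> 2 * q"
  shows "arc_cost p q n \<le> cost p q n A B"
  using arc_cost_le_card_boundary[OF assms(2) card_changes_ge_2[OF assms(1,3)], of n]
    card_boundary_le_cost_short[OF assms(2,4), of A B] by linarith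

lemma cost_ge_two_classes_or_compl:
  assumes "coprime p q" "0 < p" "0 < q" "4 * q \<le> n" "n \<le> p * q" "u1 < p" "u2 < p" "u1 \<noteq> u2"
    and u: "u2 \<in> A \<longleftrightarrow> u1 \<in> A" "\<And>x. x < p \<Longrightarrow> (x \<in> A \<longleftrightarrow> u1 \<in> A) \<Longrightarrow> x = u1 \<or> x = u2"
  shows "2 * (n div p) \<le> cost p q n A B"
proof -
  have "class_card p n u1 + class_card p n u2 \<le> cost p q n A B"
  proof (cases "u1 \<in> A")
    case True
    then show ?thesis using assms by (intro cost_ge_two_classes) auto
  next
    case False
    then have "class_card p n u1 + class_card p n u2 \<le> cost p q n (- A) (- B)"
      using assms by (intro cost_ge_two_classes) auto
    then show ?thesis by (simp add: cost_compl)
  qed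
  moreover have "n div p \<le> class_card p n u1" "n div p \<le> class_card p n u2" using assms by (simp_all add: class_card_eq)
  ultimately show ?thesis by linarith
qed

text \<open>In long words the arc bound becomes strict. An arc of two residues costs two full
  classes. Otherwise isolated changes leave an uncharged cut position in the interior of a column.
  From four changes on, either some cut position is charged only once, or every residue is a change,
  and then there are at least five.\<close>

lemma cost_gt_wide_long:
  assumes "coprime p q" "5 \<le> p" "p < q" "4 * q \<le> n" "n \<le> p * q" "wide p A" "wide p (- A)"
  shows "2 * ((n - q) div p) < cost p q n A B"
proof -
  have p: "0 < p" and q: "0 < q" using assms by simp_all
  let ?ch = "changes p q A" and ?k = "(n - q) div p"
  have two: "2 \<le> card ?ch" by (rule card_changes_ge_2[OF assms(1) wide_splits[OF assms(6,7)]])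
  have k1: "?k + 1 \<le> n div p"
  proof -
    have "(n - q + p) div p \<le> n div p" using assms(3,4) by (intro div_le_mono) linarith
    then show ?thesis using p by simp
  qed
  have kp: "1 \<le> ?k" using assms(3,4) p by (simp add: less_eq_div_iff_mult_less_eq)
  have bc: "card ?ch * ?k \<le> card (boundary p q n A)" by (rule card_boundary_ge[OF p])
  show ?thesis
  proof (cases "card ?ch < 4")
    case True
    note iso1 = wide_isolated[OF assms(1,6,7) True]
    show ?thesis
    proof (cases "\<exists>b\<in>?ch. (b + 2 * q) mod p \<in> ?ch")
      case True
      then obtain b where b: "b \<in> ?ch" "(b + 2 * q) mod p \<in> ?ch" by blast
      have ne: "(b + q) mod p \<notin> ?ch" by (rule iso1[OF b(1)])
      have eqA: "(b + 2 * q) mod p \<in> A \<longleftrightarrow> (b + q) mod p \<in> A"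
        using ne p mod_changes_iff[OF p, of "b + q" q A] by (simp add: mult_2 add.assoc)
      have diff: "(b + q) mod p \<noteq> (b + 2 * q) mod p" using ne b(2) by metis
      have "2 * (n div p) \<le> cost p q n A B"
      proof (rule cost_ge_two_classes_or_compl[OF assms(1) p q assms(4,5) _ _ diff eqA])
        fix x assume x: "x < p" "(x \<in> A) = ((b + q) mod p \<in> A)"
        show "x = (b + q) mod p \<or> x = (b + 2 * q) mod p"
        proof (rule ccontr)
          assume "\<not> ?thesis"
          then have "4 \<le> card ?ch"
            using x by (intro card_changes_ge_4_run2[OF assms(1) b(1) ne b(2), where y = x]) auto
          then show False using \<open>card ?ch < 4\<close> by simp
        qed
      qed (use p in simp_all)
      then show ?thesis using k1 by linarith
    next
      case False
      from two obtain b where b: "b \<in> ?ch" by fastforce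
      then have bp: "b < p" by (simp add: changes_def)
      \<comment> \<open>The positions from \<open>q\<close> to \<open>q + p - 1\<close> show every
        residue modulo \<open>p\<close>, and each has one earlier and at least two later entries in
        its column.\<close>
      obtain t where t: "t < p" "(q + t * 1) mod p = b"
        using mod_step_surj[of p 1 b q] bp by auto
      have "card (boundary p q n A) < cost p q n A B"
      proof (rule card_boundary_less_cost_isolated[OF p iso1, where i = "q + t"])
        show "(b' + 2 * q) mod p \<notin> ?ch" if "b' \<in> ?ch" for b' using False that by blast
        show "(q + t) mod p \<in> ?ch" using t b by simp
        show "q + t + 2 * q < n" using t assms(3,4) by linarith
      qed simp_all
      moreover have "2 * ?k \<le> card ?ch * ?k" using two by (rule mult_le_mono1)
      ultimately show ?thesis using bc by linarith
    qed
  next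
    case False
    have four: "4 * ?k \<le> card ?ch * ?k" using False by (intro mult_le_mono1) simp
    show ?thesis
    proof (cases "\<exists>b\<in>?ch. (b + q) mod p \<notin> ?ch")
      case True
      then obtain b where "b \<in> ?ch" "(b + q) mod p \<notin> ?ch" by blast
      then have "card (boundary p q n A) < 2 * cost p q n A B"
        using assms(3,4) by (intro card_boundary_less_double_cost[OF p]) auto
      then show ?thesis using four bc by linarith
    next
      case all: False
      from two obtain b where b: "b \<in> ?ch" by fastforce
      have step: "(b + t * q) mod p \<in> ?ch" for t
      proof (induction t)
        case 0
        then show ?case using b by (simp add: changes_def)
      next
        case (Suc t)
        then have "((b + t * q) mod p + q) mod p \<in> ?ch" using all by blast
        then show ?case by (simp add: mod_simps algebra_simps)
      qed
      have "{..<p} \<subseteq> ?ch"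
      proof
        fix y assume "y \<in> {..<p}"
        then obtain t where "(b + t * q) mod p = y" using mod_step_surj[OF assms(1), of y b] by auto
        then show "y \<in> ?ch" using step by metis
      qed
      then have "card {..<p} \<le> card ?ch" by (rule card_mono[rotated]) simp
      then have "5 * ?k \<le> card ?ch * ?k" using assms(2) by (intro mult_le_mono1) simp
      then show ?thesis
        using bc kp card_boundary_le_double_cost[OF p, of q n A B] by linarith
    qed
  qed
qed

text \<open>A colouring that is not wide isolates one residue modulo \<open>p\<close>, possibly
  after exchanging the two letters, and is then no cheaper than some single position. The bound for
  wide colourings is left as a hypothesis because it depends on the length.\<close>

lemma cost_gt:
  assumes "coprime p q" "3 \<le> p" "p < q" "2 * q \<le> n" "splits p A" "\<exists>v<q. v \<in> B" "\<exists>v<q. v \<notin> B"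
    and single: "\<And>u v. u < p \<Longrightarrow> v < q \<Longrightarrow> h < cost p q n {u} {v}"
    and wide: "wide p A \<Longrightarrow> wide p (- A) \<Longrightarrow> h < cost p q n A B"
  shows "h < cost p q n A B"
proof -
  have q: "0 < q" using assms(3) by simp
  have narrow: "h < cost p q n A' B'" if s: "splits p A'" "\<not> wide p A'" "\<exists>v<q. v \<in> B'" for A' B'
  proof -
    obtain u where u: "u < p" "u \<in> A'" using s(1) by (auto simp: splits_def)
    obtain v where v: "v < q" "v \<in> B'" using s(3) by blast
    have "cost p q n {u} {v} \<le> cost p q n A' B'"
      using s(2) u v by (intro cost_ge_singletons[OF assms(1,2) q assms(4)]) (auto simp: wide_def)
    then show ?thesis using single[OF u(1) v(1)] by linarith
  qed
  show ?thesis
  proof (cases "wide p A"; cases "wide p (- A)")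
    assume "\<not> wide p (- A)"
    then have "h < cost p q n (- A) (- B)" using assms(5,7) by (intro narrow) (auto simp: splits_compl)
    then show ?thesis by (simp add: cost_compl)
  qed (use wide narrow[of A B] assms(5,6) in auto)
qed

section \<open>Words that break the period\<close>

text \<open>Encodes a word of length \<open>n\<close> with two letters and at most \<open>h\<close>
  holes in which both letters are visible. For coprime periods the visibility says that period 1
  fails.\<close>

definition breaks :: "nat \<Rightarrow> nat \<Rightarrow> nat \<Rightarrow> nat \<Rightarrow> bool" where
  "breaks p q n h \<longleftrightarrow> (\<exists>A B. cost p q n A B \<le> h \<and>
     (\<exists>i<n. i mod p \<in> A \<and> i mod q \<in> B) \<and> (\<exists>i<n. i mod p \<notin> A \<and> i mod q \<notin> B))"

lemma cost_single_le:
  assumes "coprime p q" "i < n"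
  shows "cost p q n {i mod p} {i mod q} + 2 \<le> class_card p n (i mod p) + class_card q n (i mod q)"
proof -
  have "i \<in> {j. j < n \<and> j mod (p * q) = i mod (p * q)}" using assms(2) by simp
  then have "0 < class_card (p * q) n (i mod (p * q))" unfolding class_card_def by (subst card_gt_0_iff) auto
  then show ?thesis using cost_single[OF assms(1), of n i] by linarith
qed

lemma cost_single_le_good:
  assumes "coprime p q" "0 < p" "0 < q" "i < n" "n mod p \<le> i mod p" "n mod q \<le> i mod q"
  shows "cost p q n {i mod p} {i mod q} + 2 \<le> n div p + n div q"
  using cost_single_le[OF assms(1,4)] assms by (simp add: class_card_eq)

text \<open>Residue \<open>p - 1\<close> occurs exactly \<open>n div p\<close> times, whatever
  \<open>n\<close> is. Position \<open>p - 1\<close> thus serves as a fallback that needs no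
  knowledge of the remainders of \<open>n\<close>.\<close>

lemma cost_single_le_last:
  assumes "coprime p q" "0 < p" "p < q" "p \<le> n"
  shows "cost p q n {p - 1} {p - 1} + 1 \<le> n div p + n div q"
proof -
  have "n mod p < p" using assms(2) by simp
  then have "\<not> p - 1 < n mod p" by linarith
  then have "class_card p n (p - 1) = n div p" using assms(2) by (simp add: class_card_eq)
  moreover have "class_card q n (p - 1) \<le> n div q + 1" using assms(3) by (simp add: class_card_eq)
  moreover have "p - 1 < n" "(p - 1) mod p = p - 1" "(p - 1) mod q = p - 1" using assms by simp_all
  ultimately show ?thesis using cost_single_le[OF assms(1), of "p - 1" n] by force
qed

text \<open>If no position below \<open>n\<close> has both residues, the isolated letter is not
  visible. But then nothing is saved by a common position either, and the visible position
  \<open>p - 1\<close> is cheaper.\<close>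

lemma single_breaks:
  assumes "coprime p q" "3 \<le> p" "p < q" "2 * q \<le> n" "u < p" "v < q" "cost p q n {u} {v} \<le> h"
  shows "breaks p q n h"
proof -
  have visible: "breaks p q n h" if "u < p" "v < q" "cost p q n {u} {v} \<le> h" "\<exists>i<n. i mod p = u \<and> i mod q = v" for u v
  proof -
    \<comment> \<open>The other letter must be visible too. One of three positions below
      \<open>p\<close> and \<open>q\<close> avoids both \<open>u\<close> and
      \<open>v\<close>.\<close>
    have "\<exists>i. (i = 0 \<or> i = 1 \<or> i = 2) \<and> i \<noteq> u \<and> i \<noteq> v" by presburger
    then obtain i where i: "i = 0 \<or> i = 1 \<or> i = 2" "i \<noteq> u" "i \<noteq> v" by blast
    then have "i < p" "i < q" "i < n" using assms(2-4) by auto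
    then have "\<exists>i<n. i mod p \<notin> {u} \<and> i mod q \<notin> {v}" using i by (intro exI[of _ i]) simp
    then show ?thesis unfolding breaks_def using that(3,4)
      by (intro exI[of _ "{u}"] exI[of _ "{v}"]) simp
  qed
  show ?thesis
  proof (cases "\<exists>i<n. i mod p = u \<and> i mod q = v")
    case True
    then show ?thesis using visible[OF assms(5-7)] by blast
  next
    case False
    obtain w where "[w = u] (mod p)" "[w = v] (mod q)"
      using binary_chinese_remainder_nat[OF assms(1), of u v] by blast
    then have w: "w mod p = u" "w mod q = v" using assms(5,6) by (simp_all add: cong_def)
    have "{j. j < n \<and> j mod (p * q) = w mod (p * q)} = {}"
      using False mod_eq_both_iff[OF assms(1)] w by blast
    then have "class_card (p * q) n (w mod (p * q)) = 0" by (simp add: class_card_def)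
    then have "cost p q n {u} {v} = class_card p n u + class_card q n v"
      using cost_single[OF assms(1), of n w] w by simp
    moreover have "n div p \<le> class_card p n u" "n div q \<le> class_card q n v" using assms(5,6) by (simp_all add: class_card_eq)
    moreover have "cost p q n {p - 1} {p - 1} + 1 \<le> n div p + n div q"
      using assms by (intro cost_single_le_last) auto
    ultimately have "cost p q n {p - 1} {p - 1} \<le> h" using assms(7) by linarith
    then show ?thesis using assms by (intro visible[of "p - 1" "p - 1"]) (auto intro!: exI[of _ "p - 1"])
  qed
qed

text \<open>\<open>A\<close> is the stretch of the walk in steps of \<open>q\<close> that starts
  after \<open>p - 1\<close> and ends with \<open>p - 2\<close>. The changes thus start at the two
  residues that are rarest in every initial segment.\<close>

lemma two_changes:
  assumes "coprime p q" "2 \<le> p"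
  obtains A where "splits p A" "changes p q A \<subseteq> {p - 2, p - 1}"
proof -
  let ?f = "\<lambda>t. (p - 1 + t * q) mod p"
  obtain t0 where t0: "t0 < p" "?f t0 = p - 2"
    using mod_step_surj[OF assms(1), of "p - 2" "p - 1"] assms(2) by auto
  define A where "A = ?f ` {1..t0}"
  have f0: "?f 0 = p - 1" using assms(2) by simp
  have t0pos: "t0 \<noteq> 0"
  proof
    assume "t0 = 0"
    then have "p - 1 = p - 2" using t0(2) f0 by metis
    then show False using assms(2) by simp
  qed
  have inA: "?f t \<in> A \<longleftrightarrow> 1 \<le> t \<and> t \<le> t0" if "t < p" for t
  proof
    assume "?f t \<in> A"
    then obtain s where s: "s \<in> {1..t0}" "?f t = ?f s" unfolding A_def by blast
    then have "t = s" using t0(1) that by (intro mod_step_inj[OF assms(1) _ _ s(2)]) auto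
    then show "1 \<le> t \<and> t \<le> t0" using s(1) by simp
  qed (simp add: A_def)
  have "p - 2 \<in> A" using inA[OF t0(1)] t0 t0pos by simp
  moreover have "p - 1 \<notin> A" using inA[of 0] f0 assms(2) by simp
  ultimately have "splits p A" unfolding splits_def
    using assms(2) by (intro conjI exI[of _ "p - 2"] exI[of _ "p - 1"]) auto
  moreover have "changes p q A \<subseteq> {p - 2, p - 1}"
  proof
    fix b assume b: "b \<in> changes p q A"
    then have "b < p" by (simp add: changes_def)
    then obtain t where t: "t < p" "?f t = b" using mod_step_surj[OF assms(1)] by blast
    have nx: "(b + q) mod p = ?f (Suc t)"
      unfolding t(2)[symmetric] by (simp add: mod_simps algebra_simps)
    have ch: "(b \<in> A) \<noteq> ((b + q) mod p \<in> A)" using b by (simp add: changes_def)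
    have nxA: "?f (Suc t) \<in> A \<longleftrightarrow> Suc t \<le> t0"
    proof (cases "Suc t < p")
      case True
      then show ?thesis using inA[OF True] by simp
    next
      case False
      then have "Suc t = p" using t(1) by simp
      then have "?f (Suc t) = (p - 1 + p * q) mod p" by metis
      also have "\<dots> = p - 1" using assms(2) by (simp only: mod_mult_self2) simp
      finally have "?f (Suc t) = p - 1" .
      then show ?thesis using \<open>p - 1 \<notin> A\<close> \<open>Suc t = p\<close> t0(1) by simp
    qed
    have "(1 \<le> t \<and> t \<le> t0) \<noteq> (Suc t \<le> t0)" using ch nx nxA inA[OF t(1)] t(2) by metis
    then have "t = 0 \<or> t = t0" by linarith
    then show "b \<in> {p - 2, p - 1}" using t(2) t0(2) f0 by (elim disjE) simp_all
  qed
  ultimately show thesis using that by blast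
qed

text \<open>Column \<open>v\<close> takes the colour of its second entry, if there is one. Its first
  and third entries are then cut exactly for a change next to the second one. A fourth entry is cut
  only for a change right before it, since \<open>mid\<close> forbids a change between the second
  and third entries of such a column. So cut positions inject into colour changes.\<close>

lemma boundary_breaks:
  assumes "coprime p q" "2 \<le> p" "p < q" "q \<le> n" "n < 4 * q"
    and mid: "\<And>i. q \<le> i \<Longrightarrow> i + 2 * q < n \<Longrightarrow> i mod p \<notin> {p - 2, p - 1}"
  shows "breaks p q n (class_card p (n - q) (p - 2) + class_card p (n - q) (p - 1))"
proof -
  have p: "0 < p" and q: "0 < q" using assms by simp_all
  obtain A where A: "splits p A" "changes p q A \<subseteq> {p - 2, p - 1}"
    using two_changes[OF assms(1,2)] .
  define B where "B = {v. (if v + q < n then v + q else v) mod p \<in> A}"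
  let ?S = "boundary p q n A"
  have bd: "i \<in> ?S" if "i + q < n" "(i mod p \<in> A) \<noteq> ((i + q) mod p \<in> A)" for i
    using that mod_changes_iff[OF p, of i q A] by (simp add: boundary_def)
  have cut_bd: "(if i < q then i else i - q) \<in> ?S \<and> (i < q \<or> 2 * q \<le> i)" if "i \<in> cut p q n A B" for i
  proof -
    have i: "i < n" "(i mod p \<in> A) \<noteq> (i mod q \<in> B)" using that by (simp_all add: cut_def)
    consider "i < q" | "q \<le> i" "i < 2 * q" | "2 * q \<le> i" "i < 3 * q" | "3 * q \<le> i" "i < 4 * q"
      using i(1) assms(5) by linarith
    then show ?thesis
    proof cases
      case 1
      then have "i mod q = i" by simp
      then show ?thesis using i(2) 1 bd[of i] unfolding B_def by (auto split: if_splits)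
    next
      case 2
      then have m: "i mod q = i - q" by (simp add: le_mod_geq)
      then show ?thesis using i 2 unfolding B_def m by simp
    next
      case 3
      have "i mod q = (i - 2 * q + 2 * q) mod q" using 3 by simp
      also have "\<dots> = i - 2 * q" using 3 by (simp only: mod_mult_self1) simp
      finally have m: "i mod q = i - 2 * q" .
      have e: "i - 2 * q + q = i - q" "i - q + q = i" using 3 by simp_all
      have "((i - q) mod p \<in> A) \<noteq> (i mod p \<in> A)" using i 3 unfolding B_def m by (simp add: e)
      then show ?thesis using bd[of "i - q"] i(1) 3 by (simp add: e)
    next
      case 4
      have "i mod q = (i - 3 * q + 3 * q) mod q" using 4 by simp
      also have "\<dots> = i - 3 * q" using 4 by (simp only: mod_mult_self1) simp
      finally have m: "i mod q = i - 3 * q" .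
      have e: "i - 3 * q + q = i - 2 * q" "i - 2 * q + q = i - q" "i - q + q = i" using 4 by simp_all
      have "(i - 2 * q) mod p \<notin> {p - 2, p - 1}" using 4 i(1) by (intro mid) auto
      then have "(i - 2 * q) mod p \<notin> changes p q A" using A(2) by blast
      then have "((i - 2 * q) mod p \<in> A) = ((i - q) mod p \<in> A)"
        using mod_changes_iff[OF p, of "i - 2 * q" q A] by (simp add: e)
      moreover have "((i - 2 * q) mod p \<in> A) \<noteq> (i mod p \<in> A)" using i 4 unfolding B_def m by (simp add: e)
      ultimately show ?thesis using bd[of "i - q"] i(1) 4 by (simp add: e)
    qed
  qed
  have "cost p q n A B \<le> card ?S"
    unfolding cost_eq_card_cut
  proof (rule card_inj_on_le)
    let ?f = "\<lambda>i. if i < q then i else i - q"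
    show "inj_on ?f (cut p q n A B)"
    proof (rule inj_onI)
      fix i j assume "i \<in> cut p q n A B" "j \<in> cut p q n A B" "?f i = ?f j"
      then show "i = j" using cut_bd[of i] cut_bd[of j] by (auto split: if_splits)
    qed
    show "?f ` cut p q n A B \<subseteq> ?S" using cut_bd by blast
  qed simp
  also have "card ?S \<le> class_card p (n - q) (p - 2) + class_card p (n - q) (p - 1)"
  proof -
    have "?S \<subseteq> {i. i < n - q \<and> i mod p = p - 2} \<union> {i. i < n - q \<and> i mod p = p - 1}"
      using A(2) by (auto simp: boundary_def)
    then have "card ?S \<le> card ({i. i < n - q \<and> i mod p = p - 2} \<union> {i. i < n - q \<and> i mod p = p - 1})"
      by (intro card_mono) auto
    also have "\<dots> \<le> class_card p (n - q) (p - 2) + class_card p (n - q) (p - 1)"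
      unfolding class_card_def by (rule card_Un_le)
    finally show ?thesis .
  qed
  finally have c: "cost p q n A B \<le> class_card p (n - q) (p - 2) + class_card p (n - q) (p - 1)" .
  \<comment> \<open>From \<open>s\<close> on there are \<open>p\<close> consecutive uncut positions,
    which show every residue modulo \<open>p\<close>: second entries of columns are never cut, and
    neither is a first entry without successor.\<close>
  define s where "s = (if n \<le> 2 * q then n - q else q)"
  have vis: "\<exists>i<n. i mod p = u \<and> (i mod q \<in> B \<longleftrightarrow> u \<in> A)" if "u < p" for u
  proof -
    obtain t where t: "t < p" "(s + t * 1) mod p = u" using mod_step_surj[of p 1 u s] \<open>u < p\<close> by auto
    have lt: "s + t < n" using t(1) assms(3,4) by (auto simp: s_def)
    have "s + t \<notin> cut p q n A B"
    proof
      assume "s + t \<in> cut p q n A B"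
      then have "(if s + t < q then s + t else s + t - q) \<in> ?S \<and> (s + t < q \<or> 2 * q \<le> s + t)" by (rule cut_bd)
      then show False using t(1) assms(3,4) lt by (auto simp: s_def boundary_def split: if_splits)
    qed
    then show ?thesis using lt t(2) by (intro exI[of _ "s + t"]) (auto simp: cut_def)
  qed
  obtain u w where u: "u < p" "u \<in> A" and w: "w < p" "w \<notin> A" using A(1) by (auto simp: splits_def)
  have "\<exists>i<n. i mod p \<in> A \<and> i mod q \<in> B" using vis[OF u(1)] u(2) by blast
  moreover have "\<exists>i<n. i mod p \<notin> A \<and> i mod q \<notin> B" using vis[OF w(1)] w(2) by blast
  ultimately show ?thesis unfolding breaks_def using c by blast
qed

definition arc_threshold :: "nat \<Rightarrow> nat \<Rightarrow> nat \<Rightarrow> nat" where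
  "arc_threshold p q h = q + (h div 2 + 1) * p - 1 + h mod 2"

lemma arc_threshold_breaks:
  assumes "coprime p q" "2 \<le> p" "p < q" "arc_threshold p q h \<le> 4 * q"
    and mid: "\<And>i. q \<le> i \<Longrightarrow> i + 2 * q < arc_threshold p q h - 1 \<Longrightarrow> i mod p \<notin> {p - 2, p - 1}"
  shows "breaks p q (arc_threshold p q h - 1) h"
proof -
  let ?k = "h div 2" and ?n = "arc_threshold p q h - 1"
  have n: "?n - q = ?k * p + (p - 2 + h mod 2)" "q \<le> ?n" "?n < 4 * q"
    using assms(2-4) unfolding arc_threshold_def by (simp_all add: algebra_simps)
  have h2: "h mod 2 < 2" "h = 2 * ?k + h mod 2" by simp_all
  have lt: "p - 2 + h mod 2 < p" using h2(1) assms(2) by linarith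
  define N where "N = ?n - q"
  have d: "N div p = ?k" "N mod p = p - 2 + h mod 2"
    unfolding N_def n(1) using lt by simp_all
  have "\<not> p - 1 < p - 2 + h mod 2" "p - 2 < p - 2 + h mod 2 \<longleftrightarrow> h mod 2 = 1"
    using h2(1) assms(2) by linarith+
  moreover have "class_card p N (p - 2) = ?k + (if p - 2 < p - 2 + h mod 2 then 1 else 0)"
    "class_card p N (p - 1) = ?k + (if p - 1 < p - 2 + h mod 2 then 1 else 0)"
    using assms(2) d by (simp_all only: class_card_eq)
  ultimately have "class_card p N (p - 2) + class_card p N (p - 1) = 2 * ?k + h mod 2"
    using h2(1) by presburger
  then have "class_card p (?n - q) (p - 2) + class_card p (?n - q) (p - 1) = h" using h2(2) by (simp only: N_def)
  then show ?thesis using boundary_breaks[OF assms(1-3) n(2,3) mid] by simp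
qed

text \<open>Explains the formula of \<open>arc_threshold\<close>: with \<open>k = h div 2\<close>,
  \<open>arc_cost\<close> reaches \<open>2 * k + 1\<close> when
  \<open>n - q = k * p + (p - 1)\<close>, and \<open>2 * k + 2\<close> one position later.\<close>

lemma arc_cost_gt:
  assumes "2 \<le> p" "p < q" "arc_threshold p q h \<le> n"
  shows "h < arc_cost p q n"
proof -
  let ?k = "h div 2"
  have h: "h = 2 * ?k + h mod 2" "h mod 2 < 2" by simp_all
  have ge: "?k * p + (p - 1 + h mod 2) \<le> n - q"
    using assms by (simp add: arc_threshold_def algebra_simps)
  show ?thesis
  proof (cases "?k + 1 \<le> (n - q) div p")
    case True
    then show ?thesis using h by (simp add: arc_cost_def)
  next
    case False
    have "n - q = (n - q) div p * p + (n - q) mod p" by simp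
    have "?k * p \<le> n - q" using ge by linarith
    then have "?k \<le> (n - q) div p" using assms(1) by (simp add: less_eq_div_iff_mult_less_eq)
    then have k: "(n - q) div p = ?k" using False by simp
    then have "p - 1 + h mod 2 \<le> (n - q) mod p" using ge \<open>n - q = _\<close> by simp
    moreover have "(n - q) mod p < p" using assms(1) by simp
    ultimately have "(n - q) mod p = p - 1" "h mod 2 = 0" by linarith+
    then show ?thesis using h(1) k by (simp add: arc_cost_def)
  qed
qed

lemma arc_cost_le:
  assumes "2 \<le> p" "p < q" "n < arc_threshold p q h"
  shows "arc_cost p q n \<le> h"
proof -
  let ?k = "h div 2"
  have h: "h = 2 * ?k + h mod 2" "h mod 2 < 2" by simp_all
  have le: "n - q < ?k * p + (p - 1 + h mod 2)"
    using assms by (simp add: arc_threshold_def algebra_simps)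
  have e: "n - q = (n - q) div p * p + (n - q) mod p" by simp
  have m: "(n - q) mod p < p" using assms(1) by simp
  show ?thesis
  proof (cases "(n - q) div p < ?k")
    case True
    then have "2 * ((n - q) div p) + 1 \<le> h" using h(1) by linarith
    then show ?thesis by (simp add: arc_cost_def)
  next
    case False
    have "(n - q) div p < ?k + 1"
      using le h(2) assms(1) by (intro less_mult_imp_div_less) (simp add: algebra_simps)
    with False have k: "(n - q) div p = ?k" by simp
    then have "(n - q) mod p < p - 1 + h mod 2" using le e by simp
    then have "(if (n - q) mod p = p - 1 then 1 else 0) \<le> h mod 2" by simp
    then have "2 * ((n - q) div p) + (if (n - q) mod p = p - 1 then 1 else 0) \<le> 2 * ?k + h mod 2"
      unfolding k by (rule add_left_mono)
    then show ?thesis using h(1) by (simp only: arc_cost_def)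
  qed
qed

section \<open>The threshold for coprime periods\<close>

definition singles_gt :: "nat \<Rightarrow> nat \<Rightarrow> nat \<Rightarrow> nat \<Rightarrow> bool" where
  "singles_gt p q h n \<longleftrightarrow> (\<forall>u<p. \<forall>v<q. h < cost p q n {u} {v})"

lemma singles_gt_mono: "singles_gt p q h n \<Longrightarrow> n \<le> n' \<Longrightarrow> singles_gt p q h n'"
  unfolding singles_gt_def using cost_mono by (meson order_less_le_trans)

lemma singles_gt_last:
  assumes "singles_gt p q h n" "coprime p q" "0 < p" "p < q" "p \<le> n"
  shows "h + 2 \<le> n div p + n div q"
proof -
  have "h < cost p q n {p - 1} {p - 1}" using assms by (simp add: singles_gt_def)
  then show ?thesis using cost_single_le_last[OF assms(2-5)] by linarith
qed

lemma singles_gt_good: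
  assumes "singles_gt p q h n" "coprime p q" "0 < p" "0 < q" "i < n" "n mod p \<le> i mod p" "n mod q \<le> i mod q"
  shows "h + 3 \<le> n div p + n div q"
proof -
  have "h < cost p q n {i mod p} {i mod q}" using assms by (simp add: singles_gt_def)
  then show ?thesis using cost_single_le_good[OF assms(2-7)] by linarith
qed

section \<open>Comparing single positions with arcs by division with remainder\<close>

lemma div_mod_mult_add:
  fixes p k x :: nat
  assumes "0 < p"
  shows "(k * p + x) div p = k + x div p" "(k * p + x) mod p = x mod p"
  using assms by simp_all

lemma div_mod_decomp:
  fixes p n T q m a e :: nat
  assumes "0 < p" "n = T * q + m" "q = a * p + e"
  shows "n div p = T * a + (T * e + m) div p" "n mod p = (T * e + m) mod p"
proof -
  have "n = (T * a) * p + (T * e + m)" using assms(2,3) by (simp add: algebra_simps)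
  then show "n div p = T * a + (T * e + m) div p" "n mod p = (T * e + m) mod p"
    by (simp_all only: div_mod_mult_add[OF assms(1)])
qed

lemma div_add_le:
  fixes w e p :: nat
  assumes "e \<le> p" "0 < p"
  shows "w div p \<le> (w + e) div p" "(w + e) div p \<le> w div p + 1"
proof -
  show "w div p \<le> (w + e) div p" by (rule div_le_mono) simp
  have "(w + e) div p \<le> (w + p) div p" using assms(1) by (intro div_le_mono) simp
  then show "(w + e) div p \<le> w div p + 1" using assms(2) by simp
qed

text \<open>The inequalities \<open>h + 2 \<le> n div p + n div q\<close> and
  \<open>2 * ((n - q) div p) \<le> h\<close> leave little room: they force
  \<open>q div p = 1\<close> and small quotients. Of the four remaining cases three are
  contradictory, partly because a position of least conceivable cost exists; in the last one
  \<open>p\<close> is large compared with \<open>n div q\<close>.\<close>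

lemma singles_long:
  assumes "coprime p q" "3 \<le> p" "p < q" "4 * q \<le> n" "singles_gt p q h n" "arc_cost p q n \<le> h"
  shows "5 \<le> p \<and> n \<le> p * q \<and> h \<le> 2 * ((n - q) div p)"
proof -
  define T m a e where "T = n div q" and "m = n mod q" and "a = q div p" and "e = q mod p"
  \<comment> \<open>\<open>w\<close> is what is left of \<open>n - q\<close> after removing
    \<open>(T - 1) * a\<close> multiples of \<open>p\<close>, and \<open>w + e\<close> is what is
    left of \<open>n\<close> after removing \<open>T * a\<close>. The comparison then turns on
    whether adding \<open>e\<close> raises the quotient by \<open>p\<close>.\<close>
  define w where "w = (T - 1) * e + m"
  have q: "0 < q" and p: "0 < p" using assms by simp_all
  have n: "n = T * q + m" by (simp add: T_def m_def)
  have qq: "q = a * p + e" by (simp add: a_def e_def)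
  have ep: "e < p" using p by (simp add: e_def)
  have mq: "m < q" using q by (simp add: m_def)
  have T4: "4 \<le> T" unfolding T_def using assms(4) q by (simp add: less_eq_div_iff_mult_less_eq)
  have a1: "1 \<le> a" unfolding a_def using assms(3) p by (simp add: less_eq_div_iff_mult_less_eq)
  obtain T' where T': "T = T' + 4" using T4 le_Suc_ex by (metis add.commute)
  obtain a' where a': "a = a' + 1" using a1 le_Suc_ex by (metis add.commute)
  have nq: "n - q = (T - 1) * q + m" unfolding n T' by (simp add: algebra_simps)
  have w': "T * e + m = w + e" unfolding w_def T' by (simp add: algebra_simps)
  have K: "n div p = T * a + (w + e) div p" and r: "n mod p = (w + e) mod p"
    using div_mod_decomp[OF p n qq] w' by simp_all
  have k: "(n - q) div p = (T - 1) * a + w div p" and rq: "(n - q) mod p = w mod p"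
    using div_mod_decomp[OF p nq qq] by (simp_all add: w_def)
  note F = div_add_le[OF less_imp_le[OF ep] p, of w]
  have arc_cost: "2 * ((n - q) div p) \<le> h" using assms(6) by (simp add: arc_cost_def split: if_splits)
  have pn: "p \<le> n" using assms by simp
  have last: "h + 2 \<le> T * a + (w + e) div p + T"
    using singles_gt_last[OF assms(5,1) p assms(3) pn] by (simp add: K T_def)
  have good: "h + 3 \<le> T * a + (w + e) div p + T" if "i < n" "n mod p \<le> i mod p" "m \<le> i mod q" for i
    using singles_gt_good[OF assms(5,1) p q that(1,2)] that(3) by (simp add: K T_def m_def)
  have "a' = 0 \<and> w div p < 2"
  proof (rule ccontr)
    assume *: "\<not> ?thesis"
    have "T - 1 = T' + 3" by (simp add: T')
    then have k2: "(n - q) div p = (T' + 3) * (a' + 1) + w div p" using k by (simp only: a')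
    have m: "2 * ((T' + 3) * (a' + 1) + w div p) + 2 \<le> (T' + 4) * (a' + 1) + (w + e) div p + (T' + 4)"
      using last arc_cost unfolding k2 unfolding T' a' by linarith
    define z where "z = T' * a'"
    have e: "(T' + 3) * (a' + 1) = z + 3 * a' + T' + 3" "(T' + 4) * (a' + 1) = z + 4 * a' + T' + 4"
      by (simp_all add: z_def algebra_simps)
    have "z + 2 * a' + 2 * (w div p) \<le> (w + e) div p" using m[unfolded e] by (simp add: algebra_simps)
    then have "2 * a' + 2 * (w div p) \<le> w div p + 1" using F(2) by simp
    then show False using * by simp
  qed
  then have a: "a = 1" and F1: "w div p < 2" using a' by simp_all
  have k': "(n - q) div p = T' + 3 + w div p" using k by (simp add: a T')
  have w_eq: "w = w div p * p + w mod p" by simp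
  have wm: "w mod p < p" using p by simp
  consider "w div p = 1" "(w + e) div p = 1" | "w div p = 1" "(w + e) div p = 2"
    | "w div p = 0" "(w + e) div p = 0" | "w div p = 0" "(w + e) div p = 1"
    using F F1 by linarith
  then show ?thesis
  proof cases
    case 1
    then show ?thesis using last arc_cost by (simp add: a T' k')
  next
    case 2
    have e0: "1 \<le> e" using 2 by (cases e) auto
    have "(w + e) mod p = w + e - 2 * p" using 2(2) by (simp add: minus_div_mult_eq_mod[symmetric])
    \<comment> \<open>As \<open>w < 2 * p\<close>, the remainder \<open>w + e - 2 * p\<close> is
      less than \<open>e\<close>. Position \<open>q - 1\<close>, with residues \<open>e - 1\<close>
      and \<open>q - 1\<close>, therefore dominates both remainders of \<open>n\<close>.\<close>
    then have "n mod p \<le> e - 1" using r w_eq wm 2(1) e0 by simp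
    moreover have "(q - 1) mod p = e - 1"
    proof -
      have "q - 1 = 1 * p + (e - 1)" using e0 qq a by simp
      then show ?thesis using ep by (simp only: div_mod_mult_add[OF p]) simp
    qed
    moreover have "(q - 1) mod q = q - 1" using q by simp
    ultimately have "h + 3 \<le> T * a + (w + e) div p + T"
      using mq assms(4) q by (intro good[of "q - 1"]) auto
    then show ?thesis using arc_cost 2 by (simp add: a T' k')
  next
    case 3
    have "m \<le> p - 1" using 3 w_eq wm by (simp add: w_def)
    moreover have "n mod p \<le> p - 1" using mod_less_divisor[OF p, of n] by linarith
    ultimately have "h + 3 \<le> T * a + (w + e) div p + T"
      using assms(3) pn p by (intro good[of "p - 1"]) auto
    then show ?thesis using arc_cost 3 by (simp add: a T' k')
  next
    case 4
    have wp: "w < p" using 4 w_eq wm by simp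
    have "m \<le> p - 1" using wp by (simp add: w_def)
    moreover have "n mod p \<le> p - 1" using mod_less_divisor[OF p, of n] by linarith
    ultimately have "h + 3 \<le> T * a + (w + e) div p + T"
      using assms(3) pn p by (intro good[of "p - 1"]) auto
    then have hk: "h \<le> 2 * ((n - q) div p)" using arc_cost 4 by (simp add: a T' k')
    \<comment> \<open>Equality would trigger the extra unit in \<open>arc_cost\<close> and push it
      above \<open>h\<close>.\<close>
    have "w \<noteq> p - 1"
    proof
      assume "w = p - 1"
      then have "(n - q) mod p = p - 1" using rq wp by simp
      then have "arc_cost p q n = 2 * ((n - q) div p) + 1" by (simp add: arc_cost_def)
      then show False using assms(6) hk by simp
    qed
    then have w2: "w + 2 \<le> p" using wp by linarith
    have "p \<le> w + e" using 4(2) p by (metis One_nat_def div_less not_less zero_neq_one)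
    then have e2: "2 \<le> e" using w2 by linarith
    have we: "w = T' * e + 3 * e + m" by (simp add: w_def T' algebra_simps)
    have "T' * 2 \<le> T' * e" using e2 by (rule mult_le_mono2)
    then have "T + 1 \<le> p" using w2 we e2 T' by linarith
    then have "(T + 1) * q \<le> p * q" by (rule mult_le_mono1)
    then have "n \<le> p * q" unfolding n using mq by simp
    moreover have "5 \<le> p" using w2 we e2 by linarith
    ultimately show ?thesis using hk by simp
  qed
qed

text \<open>The comparison of quotients at \<open>4 * q - 1\<close> leaves one case,
  \<open>q div p = 1\<close> with \<open>3 * e < p\<close>, and position \<open>q - 1\<close>
  refutes it. So arcs that are affordable at \<open>4 * q\<close> imply an affordable single
  position right before.\<close>

lemma singles_ge_4q:
  assumes "coprime p q" "3 \<le> p" "p < q" "arc_cost p q (4 * q) \<le> h"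
  shows "\<not> singles_gt p q h (4 * q - 1)"
proof
  assume S: "singles_gt p q h (4 * q - 1)"
  define a e where "a = q div p" and "e = q mod p"
  have q: "0 < q" and p: "0 < p" using assms by simp_all
  have qq: "q = a * p + e" by (simp add: a_def e_def)
  have ep: "e < p" using p by (simp add: e_def)
  have e0: "1 \<le> e"
  proof (rule ccontr)
    assume "\<not> 1 \<le> e"
    then have "p dvd q" by (simp add: e_def dvd_eq_mod_eq_0)
    then have "is_unit p" using assms(1) coprime_common_divisor[of p q p] by simp
    then show False using assms(2) by simp
  qed
  have a1: "1 \<le> a" unfolding a_def using assms(3) p by (simp add: less_eq_div_iff_mult_less_eq)
  have n: "4 * q - 1 = (4 * a) * p + (4 * e - 1)" using e0 unfolding qq by simp
  have K: "(4 * q - 1) div p = 4 * a + (4 * e - 1) div p" and r: "(4 * q - 1) mod p = (4 * e - 1) mod p"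
    unfolding n by (simp_all only: div_mod_mult_add[OF p])
  have nq: "4 * q - q = (3 * a) * p + 3 * e" unfolding qq by simp
  have "(4 * q - q) div p = 3 * a + 3 * e div p"
    unfolding nq by (simp only: div_mod_mult_add[OF p])
  then have arc_cost: "6 * a + 2 * (3 * e div p) \<le> h" using assms(4) by (simp add: arc_cost_def split: if_splits)
  have "4 * q - 1 = 3 * q + (q - 1)" using q by simp
  then have T: "(4 * q - 1) div q = 3" and m: "(4 * q - 1) mod q = q - 1"
    using q by (simp_all only: div_mod_mult_add[OF q]) simp_all
  have last: "h + 2 \<le> 4 * a + (4 * e - 1) div p + 3"
    using singles_gt_last[OF S assms(1) p assms(3), unfolded K T] assms(3) by linarith
  have F: "(4 * e - 1) div p \<le> 3 * e div p + 1"
  proof -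
    have "(4 * e - 1) div p \<le> (3 * e + e) div p" by (rule div_le_mono) simp
    then show ?thesis using div_add_le(2)[OF less_imp_le[OF ep] p, of "3 * e"] by linarith
  qed
  have cs: "a = 1" "3 * e div p = 0" "(4 * e - 1) div p = 1" using last arc_cost F a1 by linarith+
  have e3: "3 * e < p" using cs(2) p by (simp add: div_eq_0_iff)
  have "(4 * e - 1) mod p = 4 * e - 1 - p" using cs(3) by (simp add: minus_div_mult_eq_mod[symmetric])
  then have "(4 * q - 1) mod p \<le> e - 1" using r e3 e0 by simp
  moreover have "(q - 1) mod p = e - 1"
  proof -
    have "q - 1 = 1 * p + (e - 1)" using e0 qq cs(1) by simp
    then show ?thesis using ep by (simp only: div_mod_mult_add[OF p]) simp
  qed
  moreover have "(q - 1) mod q = q - 1" using q by simp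
  ultimately have "h + 3 \<le> (4 * q - 1) div p + (4 * q - 1) div q"
    using m q by (intro singles_gt_good[OF S assms(1) p q, of "q - 1"]) simp_all
  then show False using arc_cost unfolding K T cs by simp
qed

text \<open>Supplies the hypothesis \<open>mid\<close> of \<open>arc_threshold_breaks\<close>. With
  \<open>n div q = 3\<close>, the comparison of quotients leaves only a case with
  \<open>q div p = 1\<close> and \<open>e + m \<le> p - 2\<close>. There the second entries of
  four-entry columns have residues below \<open>p - 2\<close>.\<close>

lemma singles_mid:
  assumes "coprime p q" "3 \<le> p" "p < q" "arc_threshold p q h \<le> 4 * q" "singles_gt p q h (arc_threshold p q h - 1)"
    and i: "q \<le> i" "i + 2 * q < arc_threshold p q h - 1"
  shows "i mod p \<notin> {p - 2, p - 1}"
proof -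
  define n k where "n = arc_threshold p q h - 1" and "k = h div 2"
  define m a e where "m = n - 3 * q" and "a = q div p" and "e = q mod p"
  define w where "w = 2 * e + m"
  have q: "0 < q" and p: "0 < p" using assms by simp_all
  have n3: "3 * q < n" using i by (simp add: n_def)
  have n: "n = 3 * q + m" using n3 by (simp add: m_def)
  have qq: "q = a * p + e" by (simp add: a_def e_def)
  have ep: "e < p" using p by (simp add: e_def)
  have h2: "h mod 2 < 2" "h = 2 * k + h mod 2" by (simp_all add: k_def)
  have "n < 4 * q" using assms(4) n3 by (simp add: n_def)
  then have mq: "m < q" using n by simp
  have a1: "1 \<le> a" unfolding a_def using assms(3) p by (simp add: less_eq_div_iff_mult_less_eq)
  have "n - q = k * p + (p - 2 + h mod 2)"
    using assms(2) unfolding n_def arc_threshold_def k_def by (simp add: algebra_simps)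
  moreover have lt: "p - 2 + h mod 2 < p" using h2(1) assms(2) by linarith
  ultimately have nk: "(n - q) div p = k" "(n - q) mod p = p - 2 + h mod 2" using p by simp_all
  have nq: "n - q = 2 * q + m" using n by simp
  have K: "n div p = 3 * a + (w + e) div p" and r: "n mod p = (w + e) mod p"
    using div_mod_decomp[OF p n qq] by (simp_all add: w_def algebra_simps)
  have k: "k = 2 * a + w div p" and wm: "w mod p = p - 2 + h mod 2"
    using div_mod_decomp[OF p nq qq] nk by (simp_all add: w_def)
  have T: "n div q = 3" "n mod q = m" using n mq by simp_all
  have S: "singles_gt p q h n" using assms(5) by (simp add: n_def)
  have pn: "p \<le> n" using assms(3) n3 by simp
  note F = div_add_le[OF less_imp_le[OF ep] p, of w]
  have last: "h + 2 \<le> 3 * a + (w + e) div p + 3"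
    using singles_gt_last[OF S assms(1) p assms(3) pn] by (simp add: K T)
  have good: "h + 3 \<le> 3 * a + (w + e) div p + 3" if "i < n" "n mod p \<le> i mod p" "m \<le> i mod q" for i
    using singles_gt_good[OF S assms(1) p q that(1,2)] that(3) by (simp add: K T)
  have rp: "n mod p \<le> p - 1" using mod_less_divisor[OF p, of n] by linarith
  have good': "h + 3 \<le> 3 * a + (w + e) div p + 3" if "m \<le> p - 1"
    using that rp assms(3) pn p by (intro good[of "p - 1"]) auto
  have w_eq: "w = w div p * p + w mod p" by simp
  have mw: "m \<le> w" by (simp add: w_def)
  have "a + w div p + h mod 2 \<le> 2" using last k h2(2) F by linarith
  then consider "a = 2" "w div p = 0" "h mod 2 = 0" | "a = 1" "w div p = 1" "h mod 2 = 0"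
    | "a = 1" "w div p = 0" "h mod 2 = 1" | "a = 1" "w div p = 0" "h mod 2 = 0"
    using a1 by linarith
  then show ?thesis
  proof cases
    case 1
    then have "m \<le> p - 1" using w_eq wm mw lt by simp
    then show ?thesis using good' k h2(2) 1 F by linarith
  next
    case 2
    then have F2: "(w + e) div p = 2" using last k h2(2) F by linarith
    have w2: "w = 2 * p - 2" using w_eq wm 2 assms(2) by simp
    have "h + 3 \<le> 3 * a + (w + e) div p + 3"
    proof (cases "m \<le> p - 1")
      case True
      then show ?thesis by (rule good')
    next
      case False
      then have e2: "2 * e + 2 \<le> p" using w2 by (simp add: w_def)
      have "(w + e) mod p = w + e - 2 * p" using F2 by (simp add: minus_div_mult_eq_mod[symmetric])
      then have rr: "n mod p \<le> e" using r w2 by simp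
      have e1: "1 \<le> e" using F2 2(2) by (cases e) auto
      have "2 * q - 1 = 2 * p + (2 * e - 1)" using e1 unfolding qq 2(1) by simp
      then have "(2 * q - 1) mod p = (2 * e - 1) mod p" by (simp only: div_mod_mult_add[OF p])
      then have "(2 * q - 1) mod p = 2 * e - 1" using e2 by simp
      moreover have "(2 * q - 1) mod q = q - 1"
      proof -
        have "2 * q - 1 = 1 * q + (q - 1)" using q by simp
        then have "(2 * q - 1) mod q = (q - 1) mod q" by (simp only: div_mod_mult_add[OF q])
        then show ?thesis using q by simp
      qed
      ultimately show ?thesis using rr e1 mq n3 by (intro good[of "2 * q - 1"]) auto
    qed
    then show ?thesis using k h2(2) 2 F2 by linarith
  next
    case 3
    then have "m \<le> p - 1" using w_eq wm mw lt by simp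
    then show ?thesis using good' k h2(2) 3 F by linarith
  next
    case 4
    then have "w = p - 2" using w_eq wm by simp
    then have em: "e + m \<le> p - 2" by (simp add: w_def)
    define y where "y = i - q"
    have y: "y < m" "i = p + (e + y)" using i n qq 4(1) by (auto simp: y_def n_def)
    then have "i mod p = e + y" using em by simp
    then show ?thesis using y em assms(2) by auto
  qed
qed

section \<open>The single-position threshold and the exact formula\<close>

definition single_threshold :: "nat \<Rightarrow> nat \<Rightarrow> nat \<Rightarrow> nat" where
  "single_threshold p q h = (LEAST n. singles_gt p q h n)"

text \<open>At a multiple of \<open>p * q\<close> all classes have equal size, so every pair of
  residues costs \<open>(p + q - 2) * Suc h\<close>. This makes the minimum in
  \<open>single_threshold\<close> meaningful.\<close>

lemma singles_gt_exists:
  assumes "coprime p q" "2 \<le> p" "0 < q"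
  shows "singles_gt p q h (p * q * Suc h)"
  unfolding singles_gt_def
proof (intro allI impI)
  fix u v assume uv: "u < p" "v < q"
  let ?n = "p * q * Suc h"
  obtain w where "[w = u] (mod p)" "[w = v] (mod q)"
    using binary_chinese_remainder_nat[OF assms(1), of u v] by blast
  then have w: "w mod p = u" "w mod q = v" using uv by (simp_all add: cong_def)
  have pq: "0 < p * q" "0 < p" using assms(2,3) by simp_all
  have "class_card m (m * k) x = k" if "x < m" for m k x
    using that by (simp add: class_card_eq)
  from this[of u p "q * Suc h"] this[of v q "p * Suc h"] this[of "w mod (p * q)" "p * q" "Suc h"]
  have "class_card p ?n u = q * Suc h" "class_card q ?n v = p * Suc h" "class_card (p * q) ?n (w mod (p * q)) = Suc h"
    using uv pq by (simp_all only: mult.assoc mult.left_commute[of q p] mod_less_divisor)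
  then have "cost p q ?n {u} {v} + 2 * Suc h = q * Suc h + p * Suc h"
    using cost_single[OF assms(1), of ?n w] unfolding w by (simp only:)
  moreover have "2 * Suc h \<le> p * Suc h" using assms(2) by (rule mult_le_mono1)
  moreover have "1 * Suc h \<le> q * Suc h" using assms(3) by (intro mult_le_mono1) simp
  moreover have "x \<le> c" if "c + 2 * x = Q + P" "2 * x \<le> P" "1 * x \<le> Q" for c x P Q :: nat
    using that by linarith
  ultimately have "Suc h \<le> cost p q ?n {u} {v}" by blast
  then show "h < cost p q ?n {u} {v}" by simp
qed

lemma single_threshold_gt:
  assumes "coprime p q" "2 \<le> p" "0 < q" "single_threshold p q h \<le> n"
  shows "singles_gt p q h n"
proof -
  have "singles_gt p q h (single_threshold p q h)"
    unfolding single_threshold_def using singles_gt_exists[OF assms(1-3)] by (rule LeastI)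
  then show ?thesis using assms(4) by (rule singles_gt_mono)
qed

lemma single_threshold_le: "n < single_threshold p q h \<Longrightarrow> \<not> singles_gt p q h n"
  unfolding single_threshold_def by (rule not_less_Least)

lemma single_threshold_eqI:
  assumes "singles_gt p q h n" "0 < n" "\<not> singles_gt p q h (n - 1)"
  shows "single_threshold p q h = n"
  unfolding single_threshold_def
proof (rule Least_equality)
  show "singles_gt p q h n" by (rule assms(1))
next
  fix y assume "singles_gt p q h y"
  then have "\<not> y \<le> n - 1" using assms(3) singles_gt_mono by blast
  then show "n \<le> y" by linarith
qed

definition coprime_threshold :: "nat \<Rightarrow> nat \<Rightarrow> nat \<Rightarrow> nat" where
  "coprime_threshold p q h =
    (if p = 2 then q * (1 + h div q) + h + 1
     else if arc_threshold p q h \<le> 4 * q then max (single_threshold p q h) (arc_threshold p q h) else single_threshold p q h)"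

lemma breaks_splits:
  assumes "breaks p q n h" "0 < p" "0 < q"
  obtains A B where "splits p A" "splits q B" "cost p q n A B \<le> h"
proof -
  obtain A B i j where "cost p q n A B \<le> h" "i mod p \<in> A" "i mod q \<in> B" "j mod p \<notin> A" "j mod q \<notin> B"
    using assms(1) unfolding breaks_def by blast
  moreover have "x mod p < p" "x mod q < q" for x using assms by simp_all
  ultimately show thesis unfolding splits_def by (intro that[of A B]) (auto simp: splits_def)
qed

text \<open>Up to \<open>2 * q\<close> the arc bound holds for every colouring; beyond, narrow
  colourings are covered by the single positions. If arcs are still affordable at \<open>n\<close>,
  then \<open>n\<close> is at least \<open>4 * q\<close> and the strict bound for long words takes
  over.\<close>

lemma not_breaks_ge_3:
  assumes "coprime p q" "3 \<le> p" "p < q" "coprime_threshold p q h \<le> n"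
  shows "\<not> breaks p q n h"
proof
  assume "breaks p q n h"
  then obtain A B where A: "splits p A" "splits q B" "cost p q n A B \<le> h"
    using breaks_splits assms by (metis gr_zeroI not_less_zero le_zero_eq zero_neq_numeral)
  have p: "0 < p" "2 \<le> p" "0 < q" using assms by simp_all
  have S: "singles_gt p q h n"
    using assms by (intro single_threshold_gt) (auto simp: coprime_threshold_def split: if_splits)
  have gt: "h < cost p q n A B" if "2 * q \<le> n" "wide p A \<Longrightarrow> wide p (- A) \<Longrightarrow> h < cost p q n A B"
  proof (rule cost_gt[OF assms(1-3) that(1) A(1)])
    show "\<exists>v<q. v \<in> B" "\<exists>v<q. v \<notin> B" using A(2) by (simp_all add: splits_def)
    show "h < cost p q n {u} {v}" if "u < p" "v < q" for u v
      using S that by (simp add: singles_gt_def)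
  qed (rule that(2))
  have "h < cost p q n A B"
  proof (cases "arc_threshold p q h \<le> n")
    case True
    then have arc_cost: "h < arc_cost p q n" using arc_cost_gt[OF p(2) assms(3)] by simp
    show ?thesis
    proof (cases "n \<le> 2 * q")
      case True
      then show ?thesis using cost_ge_arc_cost_short[OF assms(1) p(1) A(1) True, of B] arc_cost by simp
    next
      case False
      then have "2 * q \<le> n" by simp
      then show ?thesis
      proof (rule gt)
        assume "wide p A" "wide p (- A)"
        then show "h < cost p q n A B" using cost_ge_arc_cost_wide[OF assms(1) p(1), of A n B] arc_cost by linarith
      qed
    qed
  next
    case False
    have L4: "4 * q < arc_threshold p q h"
      using assms False by (auto simp: coprime_threshold_def split: if_splits)
    then have "arc_cost p q (4 * q) \<le> h" by (intro arc_cost_le[OF p(2) assms(3)])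
    then have "\<not> singles_gt p q h (4 * q - 1)" by (rule singles_ge_4q[OF assms(1-3)])
    then have "\<not> n \<le> 4 * q - 1" using S singles_gt_mono by blast
    then have n4: "4 * q \<le> n" by linarith
    have "arc_cost p q n \<le> h" using False by (intro arc_cost_le[OF p(2) assms(3)]) simp
    then have l: "5 \<le> p \<and> n \<le> p * q \<and> h \<le> 2 * ((n - q) div p)"
      by (rule singles_long[OF assms(1-3) n4 S])
    have "2 * q \<le> n" using n4 by simp
    then show ?thesis
    proof (rule gt)
      assume "wide p A" "wide p (- A)"
      then have "2 * ((n - q) div p) < cost p q n A B"
        using l by (intro cost_gt_wide_long[OF assms(1) _ assms(3) n4]) auto
      then show "h < cost p q n A B" using l by linarith
    qed
  qed
  then show False using A(3) by simp
qed

lemma breaks_ge_3: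
  assumes "coprime p q" "3 \<le> p" "p < q"
  shows "breaks p q (coprime_threshold p q h - 1) h"
proof -
  have p: "0 < p" "2 \<le> p" "0 < q" using assms by simp_all
  have Lspos: "0 < single_threshold p q h"
  proof (rule ccontr)
    assume "\<not> 0 < single_threshold p q h"
    then have "singles_gt p q h 0" by (intro single_threshold_gt[OF assms(1) p(2,3)]) simp
    then have "h < cost p q 0 {0} {0}" using p by (simp add: singles_gt_def)
    then show False by (simp add: cost_def)
  qed
  have single: "breaks p q n h" if "2 * q \<le> n" "\<not> singles_gt p q h n" for n
    using that single_breaks[OF assms that(1)] by (auto simp: singles_gt_def not_less)
  show ?thesis
  proof (cases "arc_threshold p q h \<le> 4 * q")
    case False
    then have "arc_cost p q (4 * q) \<le> h" by (intro arc_cost_le[OF p(2) assms(3)]) simp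
    then have "\<not> singles_gt p q h (4 * q - 1)" by (rule singles_ge_4q[OF assms])
    then have "4 * q - 1 < single_threshold p q h" using single_threshold_gt[OF assms(1) p(2,3)] by (meson not_less)
    then have "breaks p q (single_threshold p q h - 1) h" by (intro single single_threshold_le) auto
    then show ?thesis using False assms by (simp add: coprime_threshold_def)
  next
    case Ld4: True
    show ?thesis
    proof (cases "single_threshold p q h \<le> arc_threshold p q h - 1")
      case True
      then have "singles_gt p q h (arc_threshold p q h - 1)" by (rule single_threshold_gt[OF assms(1) p(2,3)])
      then have "breaks p q (arc_threshold p q h - 1) h"
        using singles_mid[OF assms Ld4] by (intro arc_threshold_breaks[OF assms(1) p(2) assms(3) Ld4])
      moreover have "max (single_threshold p q h) (arc_threshold p q h) = arc_threshold p q h" using True by simp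
      ultimately show ?thesis using Ld4 assms by (simp add: coprime_threshold_def)
    next
      case False
      then have m: "max (single_threshold p q h) (arc_threshold p q h) = single_threshold p q h" by simp
      let ?n = "single_threshold p q h - 1"
      have nS: "\<not> singles_gt p q h ?n" using Lspos by (intro single_threshold_le) simp
      have "breaks p q ?n h"
      proof (cases "2 * q \<le> ?n")
        case True
        then show ?thesis using nS by (rule single)
      next
        case n2: False
        \<comment> \<open>In short words the arc cost bounds every colouring from below. Hence the
          single-position threshold cannot exceed the arc threshold here, the two coincide, and the
          condition on four-entry columns is vacuous.\<close>
        obtain u v where uv: "u < p" "v < q" "cost p q ?n {u} {v} \<le> h"
          using nS by (auto simp: singles_gt_def not_less)
        have "splits p {u}" unfolding splits_def using uv(1) assms(2)
          by (intro conjI exI[of _ u] exI[of _ "if u = 0 then 1 else 0"]) auto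
        then have "arc_cost p q ?n \<le> h"
          using cost_ge_arc_cost_short[OF assms(1) p(1), of "{u}" ?n "{v}"] n2 uv(3) by simp
        then have "?n < arc_threshold p q h" using arc_cost_gt[OF p(2) assms(3), of h ?n] by (meson not_less)
        then have e: "single_threshold p q h = arc_threshold p q h" using False Lspos by simp
        have "i mod p \<notin> {p - 2, p - 1}" if "q \<le> i" "i + 2 * q < arc_threshold p q h - 1" for i
          using that n2 e by simp
        then have "breaks p q (arc_threshold p q h - 1) h" by (intro arc_threshold_breaks[OF assms(1) p(2) assms(3) Ld4])
        then show ?thesis by (simp add: e)
      qed
      then show ?thesis using Ld4 m assms by (simp add: coprime_threshold_def)
    qed
  qed
qed

section \<open>The case p = 2\<close>

lemma cost_2_gt:
  assumes "odd q" "splits 2 A" "q * (1 + h div q) + h + 1 \<le> n"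
  shows "h < cost 2 q n A B"
proof -
  have q: "0 < q" using assms(1) by (cases q) auto
  \<comment> \<open>As \<open>q\<close> is odd, \<open>i\<close> and \<open>i + q\<close> always
    have different colours modulo 2. Starting only in blocks of length \<open>q\<close> with even
    index makes these pairs disjoint, so each needs its own cut.\<close>
  let ?D = "{i. i + q < n \<and> even (i div q)}"
  have par: "(i mod 2 \<in> A) \<noteq> ((i + q) mod 2 \<in> A)" for i
  proof -
    have "(0 \<in> A) \<noteq> (1 \<in> A)" using assms(2) by (auto simp: splits_def less_2_cases_iff)
    moreover have "(i + q) mod 2 = 1 - i mod 2" using assms(1) by presburger
    moreover have "i mod 2 = 0 \<or> i mod 2 = 1" by presburger
    ultimately show ?thesis by auto
  qed
  have fin: "finite ?D" by (rule finite_subset[of _ "{..<n}"]) auto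
  have dv: "(i + q) div q = i div q + 1" for i using q by simp
  have "card ?D \<le> card (cut 2 q n A B)"
  proof (rule card_inj_on_le)
    let ?f = "\<lambda>i. if i \<in> cut 2 q n A B then i else i + q"
    have ne: "i \<noteq> j + q" if "i \<in> ?D" "j \<in> ?D" for i j
    proof
      assume "i = j + q"
      then show False using that dv[of j] by simp
    qed
    show "inj_on ?f ?D"
    proof (rule inj_onI)
      fix i j assume "i \<in> ?D" "j \<in> ?D" "?f i = ?f j"
      then show "i = j" using ne[of i j] ne[of j i] by (auto split: if_splits)
    qed
    have "i + q \<in> cut 2 q n A B" if "i \<in> ?D" "i \<notin> cut 2 q n A B" for i
      using that par[of i] by (simp add: cut_def)
    then show "?f ` ?D \<subseteq> cut 2 q n A B" by auto
  qed simp
  moreover have "card {..h} \<le> card ?D"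
  proof (rule card_inj_on_le[OF _ _ fin])
    let ?g = "\<lambda>x. (2 * (x div q)) * q + x mod q"
    have g: "?g x div q = 2 * (x div q)" "?g x mod q = x mod q" for x
      using q by (simp_all only: div_mod_mult_add[OF q]) simp_all
    show "inj_on ?g {..h}"
    proof (rule inj_onI)
      fix x y assume "?g x = ?g y"
      then have "2 * (x div q) = 2 * (y div q)" "x mod q = y mod q" using g by metis+
      then show "x = y" by (metis mult_cancel1 div_mult_mod_eq zero_neq_numeral)
    qed
    show "?g ` {..h} \<subseteq> ?D"
    proof
      fix y assume "y \<in> ?g ` {..h}"
      then obtain x where x: "x \<le> h" "y = ?g x" by auto
      have "?g x = (x div q) * q + (x div q * q + x mod q)" by (simp only: mult_2 distrib_right add.assoc)
      also have "\<dots> = (x div q) * q + x" by simp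
      also have "\<dots> \<le> (h div q) * q + h" using x(1) by (intro add_mono mult_le_mono1 div_le_mono)
      finally have "y \<le> (h div q) * q + h" using x(2) by simp
      moreover have "(h div q) * q + h + q < n" using assms(3) by (simp add: algebra_simps)
      ultimately have "y + q < n" by linarith
      moreover have "even (y div q)" using g(1)[of x] x(2) by simp
      ultimately show "y \<in> ?D" by simp
    qed
  qed
  ultimately show ?thesis by (simp add: cost_eq_card_cut)
qed

text \<open>With the even residues on both sides, a position is cut exactly when its block index
  \<open>i div q\<close> is odd, because \<open>q\<close> is odd. Each cut then answers one of the
  disjoint pairs of the lower bound.\<close>

lemma breaks_2:
  assumes "odd q" "2 \<le> q"
  shows "breaks 2 q (q * (1 + h div q) + h) h"
proof -
  let ?n = "q * (1 + h div q) + h" and ?A = "{0::nat}" and ?B = "{v::nat. even v}"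
  have q: "0 < q" using assms by simp
  have cut: "i \<in> cut 2 q ?n ?A ?B \<longleftrightarrow> i < ?n \<and> odd (i div q)" for i
  proof -
    have "even i \<longleftrightarrow> even (i div q * q + i mod q)" by simp
    then have "even i \<longleftrightarrow> (even (i div q) \<longleftrightarrow> even (i mod q))" using assms(1) by (simp only: even_add even_mult_iff) blast
    then show ?thesis by (auto simp: cut_def even_iff_mod_2_eq_zero[symmetric] simp del: even_mod_2_iff)
  qed
  have "card (cut 2 q ?n ?A ?B) \<le> card {..<h}"
  proof (rule card_inj_on_le)
    let ?g = "\<lambda>i. (i div q div 2) * q + i mod q"
    have g: "?g i div q = i div q div 2" "?g i mod q = i mod q" for i
      by (simp_all only: div_mod_mult_add[OF q]) (use q in simp_all)
    show "inj_on ?g (cut 2 q ?n ?A ?B)"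
    proof (rule inj_onI)
      fix x y assume xy: "x \<in> cut 2 q ?n ?A ?B" "y \<in> cut 2 q ?n ?A ?B" "?g x = ?g y"
      then have "x div q div 2 = y div q div 2" and m: "x mod q = y mod q" using g by metis+
      moreover have "odd (x div q)" "odd (y div q)" using xy(1,2) cut by blast+
      ultimately have "x div q = y div q" by (metis odd_two_times_div_two_succ)
      then show "x = y" using m by (metis div_mult_mod_eq)
    qed
    show "?g ` cut 2 q ?n ?A ?B \<subseteq> {..<h}"
    proof
      fix y assume "y \<in> ?g ` cut 2 q ?n ?A ?B"
      then obtain i where i: "i < ?n" "odd (i div q)" "y = ?g i" using cut by blast
      define j a where "j = i div q div 2" and "a = h div q"
      have "i div q = 2 * j + 1" using i(2) by (simp add: j_def)
      then have ie: "i = 2 * (j * q) + q + i mod q"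
        by (metis (no_types, opaque_lifting) add_mult_distrib div_mult_mod_eq mult.assoc mult_1)
      have he: "h = a * q + h mod q" by (simp add: a_def)
      have "?n = q + a * q + h" by (simp add: a_def algebra_simps)
      then have lt: "2 * (j * q) + i mod q < 2 * (a * q) + h mod q" using ie he i(1) by linarith
      have mq: "i mod q < q" "h mod q < q" using q by simp_all
      have "j * q + i mod q < h"
      proof (cases "j < a")
        case True
        then have "(j + 1) * q \<le> a * q" by (intro mult_le_mono1) simp
        then have "j * q + q \<le> a * q" by simp
        then show ?thesis using mq he by linarith
      next
        case False
        show ?thesis
        proof (cases "j = a")
          case True
          then show ?thesis using lt he by simp
        next
          case False
          then have "(a + 1) * q \<le> j * q" using \<open>\<not> j < a\<close> by (intro mult_le_mono1) simp
          then have "a * q + q \<le> j * q" by simp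
          then show ?thesis using lt mq by linarith
        qed
      qed
      then show "y \<in> {..<h}" using i(3) by (simp add: j_def)
    qed
  qed simp
  then have "cost 2 q ?n ?A ?B \<le> h" by (simp add: cost_eq_card_cut)
  moreover have "\<exists>i<?n. i mod 2 \<in> ?A \<and> i mod q \<in> ?B" using q by (intro exI[of _ 0]) simp
  moreover have "\<exists>i<?n. i mod 2 \<notin> ?A \<and> i mod q \<notin> ?B" using assms(2) by (intro exI[of _ 1]) simp
  ultimately show ?thesis unfolding breaks_def by - (intro exI[of _ ?A] exI[of _ ?B] conjI)
qed

lemma coprime_threshold:
  assumes "coprime p q" "2 \<le> p" "p < q"
  shows "coprime_threshold p q h \<le> n \<Longrightarrow> \<not> breaks p q n h"
    and "breaks p q (coprime_threshold p q h - 1) h"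
proof -
  have odd: "odd q" if "p = 2" using assms(1) that by simp
  show "\<not> breaks p q n h" if le: "coprime_threshold p q h \<le> n"
  proof (cases "p = 2")
    case True
    show ?thesis
    proof
      assume "breaks p q n h"
      moreover have "0 < p" "0 < q" using assms by simp_all
      ultimately obtain A B where AB: "splits p A" "cost p q n A B \<le> h" using breaks_splits by blast
      have "h < cost 2 q n A B"
        using AB(1) True le odd[OF True] by (intro cost_2_gt) (simp_all add: coprime_threshold_def)
      then show False using AB(2) True by simp
    qed
  next
    case False
    then have "3 \<le> p" using assms(2) by simp
    then show ?thesis using not_breaks_ge_3[OF assms(1) _ assms(3) le] by simp
  qed
  show "breaks p q (coprime_threshold p q h - 1) h"
  proof (cases "p = 2")
    case True
    then show ?thesis using breaks_2[of q h] odd assms by (simp add: coprime_threshold_def)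
  next
    case False
    then have "3 \<le> p" using assms(2) by simp
    then show ?thesis using breaks_ge_3[OF assms(1) _ assms(3)] by simp
  qed
qed

section \<open>Partial words\<close>

lemma has_period_iff:
  "has_period \<Sigma> X r \<longleftrightarrow> 0 < r \<and> (\<exists>f. (\<forall>u<r. f u \<in> \<Sigma>) \<and>
     (\<forall>i<length X. X ! i = None \<or> X ! i = Some (f (i mod r))))"
proof
  assume "has_period \<Sigma> X r"
  then obtain P where P: "0 < r" "length P = r" "set P \<subseteq> \<Sigma>" "\<forall>i < length X. X ! i \<approx> Some (P ! (i mod r))"
    unfolding has_period_def by blast
  then have "(\<forall>u<r. P ! u \<in> \<Sigma>) \<and> (\<forall>i<length X. X ! i = None \<or> X ! i = Some (P ! (i mod r)))"
    by (auto simp: matches_def)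
  then show "0 < r \<and> (\<exists>f. (\<forall>u<r. f u \<in> \<Sigma>) \<and>
     (\<forall>i<length X. X ! i = None \<or> X ! i = Some (f (i mod r))))" using P(1) by blast
next
  assume "0 < r \<and> (\<exists>f. (\<forall>u<r. f u \<in> \<Sigma>) \<and>
     (\<forall>i<length X. X ! i = None \<or> X ! i = Some (f (i mod r))))"
  then obtain f where "0 < r" "\<forall>u<r. f u \<in> \<Sigma>" "\<forall>i<length X. X ! i = None \<or> X ! i = Some (f (i mod r))"
    by blast
  then show "has_period \<Sigma> X r" unfolding has_period_def
    by (intro conjI exI[of _ "map f [0..<r]"]) (auto simp: matches_def)
qed

lemma holes_eq_card: "holes X = card {i. i < length X \<and> X ! i = None}"
  unfolding holes_def count_list_eq_length_filter length_filter_conv_card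
  by (rule arg_cong[where f = card]) auto

text \<open>If period \<open>d\<close> fails, some class modulo \<open>d\<close> shows two different
  letters. On that class the periods become \<open>p\<close> and \<open>q\<close>, and separating
  one of its letters from all the others gives two colours whose disagreements are holes. So two
  letters suffice for any alphabet.\<close>

lemma breaks_if_not_has_period:
  assumes "0 < d" "0 < p" "0 < q"
    and per: "has_period \<Sigma> X (d * p)" "has_period \<Sigma> X (d * q)" and "\<not> has_period \<Sigma> X d"
  obtains n where "length X div d \<le> n" "breaks p q n (holes X)"
proof -
  obtain f where f: "\<forall>u<d * p. f u \<in> \<Sigma>" "\<forall>i<length X. X ! i = None \<or> X ! i = Some (f (i mod (d * p)))"
    using per(1) unfolding has_period_iff by blast
  obtain g where g: "\<forall>i<length X. X ! i = None \<or> X ! i = Some (g (i mod (d * q)))"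
    using per(2) unfolding has_period_iff by blast
  have dp: "0 < d * p" using assms by simp
  have "\<exists>i j a b. i < length X \<and> j < length X \<and> i mod d = j mod d \<and> X ! i = Some a \<and> X ! j = Some b \<and> a \<noteq> b"
  proof (rule ccontr)
    assume no: "\<not> ?thesis"
    \<comment> \<open>A class of holes only gets the default letter \<open>f 0\<close>, which lies
      in \<open>\<Sigma>\<close> because \<open>0 < d * p\<close>.\<close>
    define F where "F u = (if \<exists>i<length X. i mod d = u \<and> X ! i \<noteq> None
      then the (X ! (SOME i. i < length X \<and> i mod d = u \<and> X ! i \<noteq> None)) else f 0)" for u
    have F: "F (i mod d) = a" if "i < length X" "X ! i = Some a" for i a
    proof -
      let ?P = "\<lambda>j. j < length X \<and> j mod d = i mod d \<and> X ! j \<noteq> None"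
      have ex: "\<exists>j. ?P j" using that by (intro exI[of _ i]) simp
      have s: "?P (SOME j. ?P j)" by (rule someI_ex[OF ex])
      then obtain b where b: "X ! (SOME j. ?P j) = Some b" by auto
      then have "b = a" using no s that by (metis (no_types, lifting))
      then show ?thesis unfolding F_def using ex b by auto
    qed
    have Fin: "F u \<in> \<Sigma>" for u
    proof (cases "\<exists>i<length X. i mod d = u \<and> X ! i \<noteq> None")
      case True
      then obtain i a where i: "i < length X" "i mod d = u" "X ! i = Some a" by auto
      then have "F u = a" using F by blast
      moreover have "a = f (i mod (d * p))" using f(2) i by (metis option.distinct(1) option.inject)
      ultimately show ?thesis using f(1) mod_less_divisor[OF dp] by simp
    next
      case False
      then have "F u = f 0" unfolding F_def by (simp only: if_False)
      then show ?thesis using f(1) dp by simp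
    qed
    have "X ! i = None \<or> X ! i = Some (F (i mod d))" if "i < length X" for i
      using F[OF that] by (cases "X ! i") auto
    then have "has_period \<Sigma> X d" unfolding has_period_iff using assms(1) Fin by blast
    then show False using assms(6) by blast
  qed
  then obtain i j a b where ij: "i < length X" "j < length X" "i mod d = j mod d"
    "X ! i = Some a" "X ! j = Some b" "a \<noteq> b" by blast
  define c where "c = i mod d"
  have cd: "c < d" using assms(1) by (simp add: c_def)
  \<comment> \<open>The number of positions congruent to \<open>c\<close> modulo \<open>d\<close>:
    \<open>length X - c\<close> divided by \<open>d\<close>, rounded up.\<close>
  define n where "n = (length X + d - 1 - c) div d"
  have n: "t < n \<longleftrightarrow> c + d * t < length X" for t
  proof -
    have "t < n \<longleftrightarrow> Suc t \<le> n" by (rule less_eq_Suc_le)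
    also have "\<dots> \<longleftrightarrow> Suc t * d \<le> length X + d - 1 - c"
      unfolding n_def by (rule less_eq_div_iff_mult_less_eq[OF assms(1)])
    also have "\<dots> \<longleftrightarrow> c + d * t < length X" using cd by (auto simp: mult.commute)
    finally show ?thesis .
  qed
  have m: "(c + d * t) mod (d * r) = c + d * (t mod r)" for t r
  proof -
    have "(c + d * t) div d = t" "(c + d * t) mod d = c" using cd by simp_all
    then show ?thesis by (simp only: mod_mult2_eq add.commute)
  qed
  define A B where "A = {u. f (c + d * u) = a}" and "B = {v. g (c + d * v) = a}"
  have fX: "x = f (c + d * (t mod p))" "x = g (c + d * (t mod q))" if "t < n" "X ! (c + d * t) = Some x" for t x
    using f(2) g that n[of t] m[of t p] m[of t q] by (metis option.distinct(1) option.inject)+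
  have dec: "x = c + d * (x div d)" if "x mod d = c" for x using that by (metis mod_mult_div_eq)
  have "cost p q n A B \<le> holes X"
    unfolding holes_eq_card cost_eq_card_cut
  proof (rule card_inj_on_le)
    show "inj_on (\<lambda>t. c + d * t) (cut p q n A B)" using assms(1) by (simp add: inj_on_def)
    show "(\<lambda>t. c + d * t) ` cut p q n A B \<subseteq> {i. i < length X \<and> X ! i = None}"
    proof
      fix y assume "y \<in> (\<lambda>t. c + d * t) ` cut p q n A B"
      then obtain t where t: "t \<in> cut p q n A B" "y = c + d * t" by blast
      then have tn: "t < n" by (simp add: cut_def)
      have "X ! y = None"
      proof (rule ccontr)
        assume "X ! y \<noteq> None"
        then obtain x where "X ! (c + d * t) = Some x" using t(2) by auto
        then have "f (c + d * (t mod p)) = g (c + d * (t mod q))" using fX[OF tn] by metis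
        then show False using t(1) by (simp add: cut_def A_def B_def)
      qed
      then show "y \<in> {i. i < length X \<and> X ! i = None}" using n[of t] tn t(2) by simp
    qed
  qed simp
  moreover have "\<exists>t<n. t mod p \<in> A \<and> t mod q \<in> B"
  proof -
    have e: "i = c + d * (i div d)" by (rule dec) (simp add: c_def)
    have "i div d < n" using n[of "i div d"] ij(1) e by simp
    then show ?thesis using fX[of "i div d" a] ij(4) e by (auto simp: A_def B_def)
  qed
  moreover have "\<exists>t<n. t mod p \<notin> A \<and> t mod q \<notin> B"
  proof -
    have e: "j = c + d * (j div d)" by (rule dec) (simp add: c_def ij(3))
    have "j div d < n" using n[of "j div d"] ij(2) e by simp
    then show ?thesis using fX[of "j div d" b] ij(5,6) e by (auto simp: A_def B_def)
  qed
  ultimately have "breaks p q n (holes X)" unfolding breaks_def by blast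
  moreover have "length X div d \<le> n" unfolding n_def using cd by (intro div_le_mono) linarith
  ultimately show thesis using that by blast
qed

text \<open>The pattern sits on the last class modulo \<open>d\<close>, with the letter
  \<open>a\<close> elsewhere. The next position of that class comes as late as possible, so the
  length can be stretched by \<open>d - 1\<close> beyond \<open>d * m\<close>; this makes the
  threshold exactly \<open>d\<close> times the coprime one.\<close>

lemma word_if_breaks:
  assumes "0 < d" "0 < p" "0 < q" "breaks p q m h" and ab: "a \<in> \<Sigma>" "b \<in> \<Sigma>" "a \<noteq> b"
  obtains X where "pword_over \<Sigma> X" "holes X \<le> h" "has_period \<Sigma> X (d * p)" "has_period \<Sigma> X (d * q)"
    "length X = d * m + (d - 1)" "\<not> has_period \<Sigma> X d"
proof -
  obtain A B where AB: "cost p q m A B \<le> h" "\<exists>i<m. i mod p \<in> A \<and> i mod q \<in> B"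
    "\<exists>i<m. i mod p \<notin> A \<and> i mod q \<notin> B"
    using assms(4) unfolding breaks_def by blast
  define letter where "letter E u = (if u mod d = d - 1 \<and> u div d \<in> E then b else a)" for E u
  define g where "g i = (if i mod d = d - 1 \<and> (i div d mod p \<in> A) \<noteq> (i div d mod q \<in> B) then None
    else Some (letter A (i mod (d * p))))" for i
  define n where "n = d * m + (d - 1)"
  define X where "X = map g [0..<n]"
  have mm: "i mod (d * r) mod d = i mod d" "i mod (d * r) div d = i div d mod r" for i r
  proof -
    have "i mod d < d" using assms(1) by simp
    then show "i mod (d * r) mod d = i mod d" "i mod (d * r) div d = i div d mod r"
      by (simp_all add: mod_mult2_eq)
  qed
  have gq: "g i = None \<or> g i = Some (letter B (i mod (d * q)))" for i
    unfolding g_def letter_def mm by auto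
  have len: "length X = n" by (simp add: X_def)
  have X: "X ! i = g i" if "i < n" for i using that by (simp add: X_def)
  have lt: "d * t + (d - 1) < n \<longleftrightarrow> t < m" for t
    unfolding n_def add_less_cancel_right using assms(1) by simp
  have dm: "(d * t + (d - 1)) mod d = d - 1" "(d * t + (d - 1)) div d = t" for t
    unfolding mult.commute[of d t] div_mod_mult_add[OF assms(1)] using assms(1) by simp_all
  have letters: "letter E u \<in> \<Sigma>" for E u using ab by (simp add: letter_def)
  have 1: "pword_over \<Sigma> X"
    using letters by (auto simp: pword_over_def X_def g_def)
  have 2: "has_period \<Sigma> X (d * p)" unfolding has_period_iff
    using letters assms(1,2) by (intro conjI exI[of _ "letter A"]) (auto simp: len X g_def)
  have 3: "has_period \<Sigma> X (d * q)" unfolding has_period_iff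
    using letters assms(1,3) gq by (intro conjI exI[of _ "letter B"]) (auto simp: len X)
  have "card {i. i < length X \<and> X ! i = None} \<le> card (cut p q m A B)"
  proof (rule card_inj_on_le)
    have e: "i = d * (i div d) + (d - 1)" if "i < length X \<and> X ! i = None" for i
    proof -
      have "g i = None" using that len X[of i] by metis
      then have "i mod d = d - 1" by (simp add: g_def split: if_splits)
      then show ?thesis using mult_div_mod_eq[of d i] by simp
    qed
    show "inj_on (\<lambda>i. i div d) {i. i < length X \<and> X ! i = None}"
    proof (rule inj_onI)
      fix i j
      assume ij: "i \<in> {i. i < length X \<and> X ! i = None}" "j \<in> {i. i < length X \<and> X ! i = None}"
        "i div d = j div d"
      then have "i = d * (i div d) + (d - 1)" "j = d * (j div d) + (d - 1)" using e by blast+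
      then show "i = j" using ij(3) by metis
    qed
    show "(\<lambda>i. i div d) ` {i. i < length X \<and> X ! i = None} \<subseteq> cut p q m A B"
    proof
      fix t assume "t \<in> (\<lambda>i. i div d) ` {i. i < length X \<and> X ! i = None}"
      then obtain i where i: "i < length X \<and> X ! i = None" "t = i div d" by blast
      then have "t < m" using e[OF i(1)] lt[of t] len by simp
      moreover have "g i = None" using i(1) len X[of i] by metis
      ultimately show "t \<in> cut p q m A B" using i(2) by (simp add: g_def cut_def split: if_splits)
    qed
  qed simp
  then have 4: "holes X \<le> h" using AB(1) by (simp add: holes_eq_card cost_eq_card_cut)
  have 5: "\<not> has_period \<Sigma> X d"
  proof
    assume "has_period \<Sigma> X d"
    then obtain f where f: "\<forall>i<length X. X ! i = None \<or> X ! i = Some (f (i mod d))"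
      unfolding has_period_iff by blast
    obtain s t where s: "s < m" "s mod p \<in> A" "s mod q \<in> B" and t: "t < m" "t mod p \<notin> A" "t mod q \<notin> B"
      using AB by blast
    have val: "X ! (d * t + (d - 1)) = (if (t mod p \<in> A) \<noteq> (t mod q \<in> B) then None
      else Some (if t mod p \<in> A then b else a))" if "t < m" for t
      unfolding X[OF lt[THEN iffD2, OF that]] g_def letter_def mm dm by simp
    have "X ! (d * s + (d - 1)) = Some b" using val[OF s(1)] s by simp
    moreover have "X ! (d * t + (d - 1)) = Some a" using val[OF t(1)] t by simp
    ultimately have "b = f (d - 1)" "a = f (d - 1)"
      using f s(1) t(1) lt[of s] lt[of t] dm len by (metis option.distinct(1) option.inject)+
    then show False using ab(3) by simp
  qed
  show thesis using that 1 2 3 4 5 len by (simp add: n_def)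
qed

lemma threshold_commute: "threshold \<Sigma> h q p = threshold \<Sigma> h p q"
  unfolding threshold_def gcd.commute[of q p]
  by (rule arg_cong[where f = Least]) (auto simp: fun_eq_iff)

lemma threshold_two_letters:
  assumes "a \<in> \<Sigma>" "b \<in> \<Sigma>" "a \<noteq> b" "0 < d" "coprime p q" "2 \<le> p" "p < q"
  shows "threshold \<Sigma> h (d * p) (d * q) = d * coprime_threshold p q h"
proof -
  let ?T = "coprime_threshold p q h"
  have g: "gcd (d * p) (d * q) = d" using assms(5)
    by (simp add: gcd_mult_distrib_nat[symmetric] coprime_imp_gcd_eq_1)
  have pos: "0 < p" "0 < q" using assms by simp_all
  have T0: "0 < ?T"
  proof (rule ccontr)
    assume "\<not> 0 < ?T"
    then have "?T \<le> ?T - 1" by simp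
    then show False using coprime_threshold[OF assms(5-7)] by blast
  qed
  have upper: "has_period \<Sigma> X d"
    if X: "holes X \<le> h" "has_period \<Sigma> X (d * p)" "has_period \<Sigma> X (d * q)" "d * ?T \<le> length X" for X
  proof (rule ccontr)
    assume "\<not> has_period \<Sigma> X d"
    then obtain n where n: "length X div d \<le> n" "breaks p q n (holes X)"
      using breaks_if_not_has_period[OF assms(4) pos X(2,3)] by blast
    have "?T \<le> length X div d" using X(4) assms(4) by (simp add: less_eq_div_iff_mult_less_eq mult.commute)
    moreover have "breaks p q n h" using n(2) X(1) unfolding breaks_def by (meson le_trans)
    ultimately show False using coprime_threshold(1)[OF assms(5-7), of h n] n(1) by simp
  qed
  obtain X where X: "pword_over \<Sigma> X" "holes X \<le> h" "has_period \<Sigma> X (d * p)" "has_period \<Sigma> X (d * q)"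
    "length X = d * (?T - 1) + (d - 1)" "\<not> has_period \<Sigma> X d"
    using word_if_breaks[OF assms(4) pos coprime_threshold(2)[OF assms(5-7)] assms(1-3)] .
  have len: "length X = d * ?T - 1" using X(5) T0 assms(4) by (cases ?T) (auto simp: algebra_simps)
  show "threshold \<Sigma> h (d * p) (d * q) = d * ?T" unfolding threshold_def g
  proof (rule Least_equality)
    fix y
    assume y: "\<forall>X. pword_over \<Sigma> X \<and> holes X \<le> h \<and> has_period \<Sigma> X (d * p) \<and>
      has_period \<Sigma> X (d * q) \<and> y \<le> length X \<longrightarrow> has_period \<Sigma> X d"
    then have "\<not> y \<le> length X" using X by blast
    then show "d * ?T \<le> y" using len by linarith
  qed (use upper in blast)
qed

text \<open>Having the period \<open>p\<close> already forces a letter to exist, and a single letter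
  can fill all holes.\<close>

lemma threshold_one_letter:
  assumes "\<And>a b. a \<in> \<Sigma> \<Longrightarrow> b \<in> \<Sigma> \<Longrightarrow> a = b" "0 < p"
  shows "threshold \<Sigma> h p q = 0"
proof -
  have "has_period \<Sigma> X (gcd p q)" if X: "pword_over \<Sigma> X" "has_period \<Sigma> X p" for X
  proof -
    obtain f where "\<forall>u<p. f u \<in> \<Sigma>" using X(2) unfolding has_period_iff by blast
    then have a: "f 0 \<in> \<Sigma>" using assms(2) by blast
    have "X ! i = None \<or> X ! i = Some (f 0)" if "i < length X" for i
    proof -
      have "X ! i \<in> insert None (Some ` \<Sigma>)"
        using X(1) nth_mem[OF that] unfolding pword_over_def by blast
      then show ?thesis using assms(1)[OF _ a] by blast
    qed
    then show ?thesis unfolding has_period_iff using a assms(2) by (intro conjI exI[of _ "\<lambda>_. f 0"]) simp_all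
  qed
  then show ?thesis unfolding threshold_def by (intro Least_equality) auto
qed

section \<open>A formula for the threshold\<close>

text \<open>The minimum of \<open>- j a mod m\<close> over \<open>1 \<le> j \<le> J\<close>, where a vanishing residue and an empty range
  both count as \<open>m\<close>.\<close>

definition minmod :: "nat \<Rightarrow> nat \<Rightarrow> nat \<Rightarrow> nat \<Rightarrow> bool" where
  "minmod a m J v \<longleftrightarrow> (\<forall>j. 1 \<le> j \<longrightarrow> j \<le> J \<longrightarrow> v + j * a mod m \<le> m) \<and>
     (v = m \<or> (\<exists>j. 1 \<le> j \<and> j \<le> J \<and> v + j * a mod m = m))"

text \<open>For positive \<open>p\<close> and \<open>q\<close>, the least \<open>n\<close> with
  \<open>c \<le> n div p + n div q\<close>. It is a multiple of \<open>p\<close> or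
  \<open>q\<close>, and \<open>n = p * k\<close> qualifies iff
  \<open>c * q \<le> k * (p + q)\<close>, since \<open>c - k \<le> p * k div q\<close> means
  \<open>(c - k) * q \<le> p * k\<close>. Hence the quotients rounded up.\<close>

definition first_multiple :: "nat \<Rightarrow> nat \<Rightarrow> nat \<Rightarrow> nat" where
  "first_multiple p q c =
     min (p * ((c * q + (p + q) - 1) div (p + q))) (q * ((c * p + (p + q) - 1) div (p + q)))"

lemma ceiling_div:
  fixes x m :: nat
  assumes "0 < m"
  shows "x \<le> ((x + m - 1) div m) * m" "x \<le> k * m \<Longrightarrow> (x + m - 1) div m \<le> k"
proof -
  have "x + m - 1 = ((x + m - 1) div m) * m + (x + m - 1) mod m" by simp
  moreover have "(x + m - 1) mod m < m" using assms by simp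
  ultimately show "x \<le> ((x + m - 1) div m) * m" by linarith
  assume "x \<le> k * m"
  moreover have "(k + 1) * m = k * m + m" by simp
  ultimately have "x + m - 1 < (k + 1) * m" using assms by linarith
  then have "(x + m - 1) div m < k + 1" by (rule less_mult_imp_div_less)
  then show "(x + m - 1) div m \<le> k" by linarith
qed

lemma first_multiple_ge:
  assumes "0 < p" "0 < q"
  shows "c \<le> first_multiple p q c div p + first_multiple p q c div q"
proof -
  have *: "c \<le> (p * k) div p + (p * k) div q" if "0 < p" "0 < q" "c * q \<le> k * (p + q)" for p q k :: nat
  proof -
    have "(c - k) * q \<le> p * k" using that(3) by (simp add: diff_mult_distrib algebra_simps)
    then have "c - k \<le> (p * k) div q" using that(2) by (simp add: less_eq_div_iff_mult_less_eq)
    then show ?thesis using that(1) by simp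
  qed
  have pq: "0 < p + q" using assms(1) by simp
  have "c \<le> first_multiple p q c div p + first_multiple p q c div q"
    if "first_multiple p q c = p * ((c * q + (p + q) - 1) div (p + q))"
    using *[OF assms ceiling_div(1)[OF pq, of "c * q"]] by (simp only: that)
  moreover have "c \<le> first_multiple p q c div p + first_multiple p q c div q"
    if "first_multiple p q c = q * ((c * p + (p + q) - 1) div (p + q))"
    using *[OF assms(2,1), of "(c * p + (p + q) - 1) div (p + q)"] ceiling_div(1)[OF pq, of "c * p"]
    by (simp only: that add.commute)
  ultimately show ?thesis unfolding first_multiple_def min_def by presburger
qed

text \<open>Of the last multiples of \<open>p\<close> and of \<open>q\<close> up to
  \<open>n\<close>, the larger one already satisfies the quotient condition.\<close>

lemma less_first_multiple:
  assumes "0 < p" "0 < q" "n < first_multiple p q c"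
  shows "n div p + n div q < c"
proof (rule ccontr)
  assume "\<not> ?thesis"
  then have c: "c \<le> n div p + n div q" by simp
  define K T where "K = n div p" and "T = n div q"
  have le: "p * K \<le> n" "q * T \<le> n" by (simp_all add: K_def T_def)
  have pq: "0 < p + q" using assms by simp
  show False
  proof (cases "q * T \<le> p * K")
    case True
    have "c * q \<le> (K + T) * q" using c by (simp add: K_def T_def)
    also have "\<dots> \<le> K * (p + q)" using True by (simp add: algebra_simps)
    finally have "p * ((c * q + (p + q) - 1) div (p + q)) \<le> p * K"
      using ceiling_div(2)[OF pq] by simp
    then show False using le assms(3) unfolding first_multiple_def by linarith
  next
    case False
    have "c * p \<le> (K + T) * p" using c by (simp add: K_def T_def)
    also have "\<dots> \<le> T * (p + q)" using False by (simp add: algebra_simps)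
    finally have "q * ((c * p + (p + q) - 1) div (p + q)) \<le> q * T"
      using ceiling_div(2)[OF pq] by simp
    then show False using le assms(3) unfolding first_multiple_def by linarith
  qed
qed

lemma first_multiple_le:
  assumes "0 < p" "c \<le> p + q"
  shows "first_multiple p q c \<le> p * q"
proof -
  have "c * q \<le> q * (p + q)" using assms(2) by simp
  then have "(c * q + (p + q) - 1) div (p + q) \<le> q" using assms by (intro ceiling_div(2)) simp_all
  then have "p * ((c * q + (p + q) - 1) div (p + q)) \<le> p * q" by simp
  then show ?thesis unfolding first_multiple_def by linarith
qed

lemma first_multiple_cases:
  obtains k where "first_multiple p q c = p * k" | l where "first_multiple p q c = q * l"
proof (cases "p * ((c * q + (p + q) - 1) div (p + q)) \<le> q * ((c * p + (p + q) - 1) div (p + q))")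
  case True
  then have "first_multiple p q c = p * ((c * q + (p + q) - 1) div (p + q))"
    unfolding first_multiple_def by (rule min_absorb1)
  then show thesis by (rule that(1))
next
  case False
  then have "first_multiple p q c = q * ((c * p + (p + q) - 1) div (p + q))"
    unfolding first_multiple_def by (intro min_absorb2) linarith
  then show thesis by (rule that(2))
qed

text \<open>Isolating such a position \<open>i\<close> costs \<open>n div p + n div q - 2\<close>, the least conceivable value.\<close>

definition good :: "nat \<Rightarrow> nat \<Rightarrow> nat \<Rightarrow> bool" where
  "good p q n \<longleftrightarrow> (\<exists>i<n. n mod p \<le> i mod p \<and> n mod q \<le> i mod q)"

text \<open>For \<open>n \<le> p * q\<close> the two classes share at most one position, which saves
  2. The full saving also requires both classes to have the smaller size, which is what
  \<open>good\<close> asks.\<close>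

lemma cost_single_ge:
  assumes "coprime p q" "u < p" "v < q" "n \<le> p * q"
  shows "n div p + n div q \<le> cost p q n {u} {v} + (if good p q n then 2 else 1)"
proof -
  obtain w where "[w = u] (mod p)" "[w = v] (mod q)"
    using binary_chinese_remainder_nat[OF assms(1), of u v] by blast
  then have w: "w mod p = u" "w mod q = v" using assms(2,3) by (simp_all add: cong_def)
  let ?w = "w mod (p * q)"
  have wm: "?w mod p = u" "?w mod q = v" using w by (simp_all add: mod_mod_cancel)
  have c: "cost p q n {u} {v} + 2 * class_card (p * q) n ?w = class_card p n u + class_card q n v"
    using cost_single[OF assms(1), of n w] w by simp
  have "{i. i < n \<and> i mod (p * q) = ?w} = (if ?w < n then {?w} else {})"
    using assms(4) by (auto simp: mod_less)
  then have m: "class_card (p * q) n ?w = (if ?w < n then 1 else 0)" by (simp add: class_card_def)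
  have k: "class_card p n u = n div p + (if u < n mod p then 1 else 0)"
    "class_card q n v = n div q + (if v < n mod q then 1 else 0)" using assms(2,3) by (simp_all add: class_card_eq)
  have "n mod p \<le> u \<Longrightarrow> n mod q \<le> v \<Longrightarrow> ?w < n \<Longrightarrow> good p q n"
    unfolding good_def using wm by blast
  then show ?thesis using c m k by (auto split: if_splits)
qed

text \<open>A block of \<open>p * q\<close> positions adds \<open>q + p\<close> class members and
  one common position, which is subtracted twice, for every pair of residues.\<close>

lemma singles_gt_shift:
  assumes "coprime p q" "2 \<le> p" "0 < q"
  shows "singles_gt p q (t * (p + q - 2) + h) (p * q * t + n) \<longleftrightarrow> singles_gt p q h n"
proof -
  have cntm: "class_card a (a * k + x) u = k + class_card a x u" if "u < a" for a k x u
    using that by (simp add: class_card_eq)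
  have "cost p q (p * q * t + n) {u} {v} = t * (p + q - 2) + cost p q n {u} {v}" if uv: "u < p" "v < q" for u v
  proof -
    obtain w where "[w = u] (mod p)" "[w = v] (mod q)"
      using binary_chinese_remainder_nat[OF assms(1), of u v] by blast
    then have w: "w mod p = u" "w mod q = v" using uv by (simp_all add: cong_def)
    let ?w = "w mod (p * q)"
    have "class_card p (p * q * t + n) u = q * t + class_card p n u" "class_card (p * q) (p * q * t + n) ?w = t + class_card (p * q) n ?w"
      using cntm[OF uv(1), of "q * t" n] cntm[of ?w "p * q" t n] assms by (simp_all add: mult.assoc)
    moreover have "class_card q (p * q * t + n) v = p * t + class_card q n v"
      using cntm[OF uv(2), of "p * t" n] by (simp add: mult.assoc mult.left_commute)
    ultimately have "cost p q (p * q * t + n) {u} {v} + 2 * t + 2 * class_card (p * q) n ?w = q * t + p * t + class_card p n u + class_card q n v"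
      using cost_single[OF assms(1), of "p * q * t + n" w] w by simp
    moreover have "cost p q n {u} {v} + 2 * class_card (p * q) n ?w = class_card p n u + class_card q n v"
      using cost_single[OF assms(1), of n w] w by simp
    moreover have "t * (p + q - 2) + 2 * t = q * t + p * t"
    proof -
      have "t * (p + q - 2) + t * 2 = t * (p + q - 2 + 2)" by (simp only: distrib_left)
      also have "p + q - 2 + 2 = p + q" using assms(2) by simp
      finally show ?thesis by (simp add: algebra_simps)
    qed
    ultimately show ?thesis by linarith
  qed
  then show ?thesis by (simp add: singles_gt_def)
qed

lemma minmod_le: "minmod a m J v \<Longrightarrow> v \<le> m"
  unfolding minmod_def by (metis le_add1 order_refl)

text \<open>The multiple \<open>j * p\<close> comes after \<open>i\<close> but before the next
  multiple of \<open>q\<close>, so both lie in one block of length \<open>q\<close> and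
  \<open>i mod q < j * p mod q \<le> q - d\<close>. The two multiples cannot coincide because
  \<open>j < q\<close>.\<close>

lemma next_multiple:
  assumes "coprime p q" "0 < p" "0 < q" "j * p \<le> (i div q + 1) * q" "i < j * p" "j * p \<le> N" "N div p < q"
    and d: "minmod p q (N div p) d"
  shows "i mod q + d < q"
proof -
  have j: "1 \<le> j" using assms(5) by (cases j) auto
  have jN: "j \<le> N div p" using assms(2,6) by (simp add: less_eq_div_iff_mult_less_eq)
  have "j * p \<noteq> (i div q + 1) * q"
  proof
    assume "j * p = (i div q + 1) * q"
    then have "q dvd j * p" by simp
    then have "q dvd j" using assms(1) by (simp add: coprime_dvd_mult_left_iff coprime_commute)
    then have "q \<le> j" using j by (intro dvd_imp_le) auto
    then show False using jN assms(7) by simp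
  qed
  then have lt: "j * p < (i div q + 1) * q" using assms(4) by simp
  have ie: "i = (i div q) * q + i mod q" by simp
  have "j * p = (i div q) * q + (j * p - (i div q) * q)" using ie assms(5) by linarith
  moreover have l: "j * p - (i div q) * q < q"
  proof -
    have "j * p < (i div q) * q + q" using lt by simp
    then show ?thesis using assms(3) by linarith
  qed
  ultimately have "j * p mod q = j * p - (i div q) * q" by (metis mod_less mod_mult_self3)
  then have "i mod q < j * p mod q" using ie assms(5) by linarith
  moreover have "d + j * p mod q \<le> q" using d j jN by (simp add: minmod_def)
  ultimately show ?thesis by linarith
qed

text \<open>The witness is \<open>j * p - 1\<close>, which has the largest residue modulo
  \<open>p\<close> and, modulo \<open>q\<close>, the residue just below that of
  \<open>j * p\<close>.\<close>

lemma minmod_witness: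
  assumes "0 < p" "0 < q" "minmod p q (N div p) d" "d < q"
  obtains i where "i < N" "i mod p = p - 1" "i mod q = q - 1 - d"
proof -
  obtain j where j: "1 \<le> j" "j \<le> N div p" "d + j * p mod q = q"
    using assms(3,4) unfolding minmod_def by auto
  have jp: "1 \<le> j * p" using j(1) assms(1) by simp
  have "j * p \<le> N" using j(2) assms(1) by (simp add: less_eq_div_iff_mult_less_eq)
  then have 1: "j * p - 1 < N" using jp by linarith
  have "j * p - 1 = (j - 1) * p + (p - 1)" using j(1) assms(1) by (cases j) auto
  then have 2: "(j * p - 1) mod p = p - 1" using assms(1) by (simp only: div_mod_mult_add) simp
  have "j * p - 1 = (j * p div q) * q + (j * p mod q - 1)" using j(3) assms(4)
    by (metis Nat.add_diff_assoc add.commute add_cancel_right_left div_mult_mod_eq less_not_refl less_one linorder_not_le)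
  moreover have "j * p mod q - 1 < q" using j(3) assms(2) by linarith
  ultimately have "(j * p - 1) mod q = j * p mod q - 1" using assms(2) by (simp only: div_mod_mult_add) simp
  then have 3: "(j * p - 1) mod q = q - 1 - d" using j(3) by simp
  show thesis by (rule that[OF 1 2 3])
qed

text \<open>How far the length may grow beyond \<open>N\<close> with a position of least conceivable
  cost still present. The two entries of the maximum belong to positions right before a multiple of
  \<open>p\<close> and right before a multiple of \<open>q\<close>; each has to dominate both
  growing remainders.\<close>

definition gap :: "nat \<Rightarrow> nat \<Rightarrow> nat \<Rightarrow> nat \<Rightarrow> nat \<Rightarrow> int" where
  "gap p q N d1 d2 = max (min (int p - 1 - int (N mod p)) (int q - 1 - int d1 - int (N mod q)))
     (min (int p - 1 - int d2 - int (N mod p)) (int q - 1 - int (N mod q)))"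

text \<open>As long as the quotient sum stays at \<open>c\<close>, both remainders grow in step with
  \<open>n\<close>, so a good position must lie before \<open>N0\<close>. The next multiple of
  \<open>p\<close> or \<open>q\<close> after it is at most \<open>N0\<close>, since
  \<open>N0\<close> is itself such a multiple, and the minimal residues bound what the position can
  achieve.\<close>

lemma good_iff:
  fixes X :: int
  assumes "coprime p q" "0 < p" "0 < q" "N0 = first_multiple p q c" "n < first_multiple p q (c + 1)"
    and N0: "0 < c" "N0 < p * q" "N0 \<le> n"
    and d: "minmod p q (N0 div p) d1" "minmod q p (N0 div q) d2"
    and X: "X = gap p q N0 d1 d2"
  shows "good p q n \<longleftrightarrow> int n \<le> int N0 + X"
proof -
  define x where "x = n - N0"
  have n: "n = N0 + x" using N0(3) by (simp add: x_def)
  have sum: "n div p + n div q \<le> N0 div p + N0 div q"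
    using less_first_multiple[OF assms(2,3,5)] first_multiple_ge[OF assms(2,3), of c] assms(4) by simp
  have eqs: "y div p = N0 div p" "y div q = N0 div q" if "N0 \<le> y" "y \<le> n" for y
    using div_le_mono[OF that(1), of p] div_le_mono[OF that(1), of q]
      div_le_mono[OF that(2), of p] div_le_mono[OF that(2), of q] sum by linarith+
  have mods: "(N0 + y) mod p = N0 mod p + y" "(N0 + y) mod q = N0 mod q + y" if "y \<le> x" for y
  proof -
    have *: "(N0 + y) mod z = N0 mod z + y" if "(N0 + y) div z = N0 div z" for z
    proof -
      have "N0 div z * z + (N0 + y) mod z = N0 + y" using div_mult_mod_eq[of "N0 + y" z] that by simp
      moreover have "N0 div z * z + N0 mod z = N0" by simp
      ultimately show ?thesis by linarith
    qed
    show "(N0 + y) mod p = N0 mod p + y" "(N0 + y) mod q = N0 mod q + y"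
      using eqs[of "N0 + y"] that n by (simp_all add: *)
  qed
  have kl: "N0 div p < q" "N0 div q < p"
    using N0(2) assms(2,3) by (simp_all add: div_less_iff_less_mult mult.commute)
  show ?thesis
  proof
    assume "good p q n"
    then obtain i where i: "i < n" "N0 mod p + x \<le> i mod p" "N0 mod q + x \<le> i mod q"
      unfolding good_def n using mods[of x] by auto
    have iN: "i < N0"
    proof (rule ccontr)
      assume "\<not> i < N0"
      then obtain y where y: "i = N0 + y" using le_Suc_ex not_less by blast
      then have "y < x" using i(1) n by simp
      then show False using mods(1)[of y] i(2) y by simp
    qed
    define j j' where "j = i div p + 1" and "j' = i div q + 1"
    have lt: "i < j * p" "i < j' * q"
      using dividend_less_div_times[OF assms(2), of i] dividend_less_div_times[OF assms(3), of i]
      by (simp_all add: j_def j'_def)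
    have "j * p \<le> N0 \<or> j' * q \<le> N0"
    proof (rule first_multiple_cases[of p q c])
      fix k assume "first_multiple p q c = p * k"
      then have "N0 = k * p" using assms(4) by simp
      moreover have "i div p < k" using iN calculation by (simp add: less_mult_imp_div_less)
      then have "j \<le> k" by (simp add: j_def)
      ultimately show ?thesis by simp
    next
      fix k assume "first_multiple p q c = q * k"
      then have "N0 = k * q" using assms(4) by simp
      moreover have "i div q < k" using iN calculation by (simp add: less_mult_imp_div_less)
      then have "j' \<le> k" by (simp add: j'_def)
      ultimately show ?thesis by simp
    qed
    then consider "j * p \<le> j' * q" "j * p \<le> N0" | "j' * q \<le> j * p" "j' * q \<le> N0" by linarith
    then have "int x \<le> X"
    proof cases
      case 1
      then have "i mod q + d1 < q"
        using lt by (intro next_multiple[OF assms(1-3) _ _ _ kl(1) d(1)]) (auto simp: j'_def)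
      moreover have "i mod p < p" using assms(2) by simp
      ultimately show ?thesis using i(2,3) unfolding X gap_def by linarith
    next
      case 2
      have "coprime q p" using assms(1) by (simp add: coprime_commute)
      then have "i mod p + d2 < p"
        using lt 2 by (intro next_multiple[OF _ assms(3,2) _ _ _ kl(2) d(2)]) (auto simp: j_def)
      moreover have "i mod q < q" using assms(3) by simp
      ultimately show ?thesis using i(2,3) unfolding X gap_def by linarith
    qed
    then show "int n \<le> int N0 + X" using n by simp
  next
    assume "int n \<le> int N0 + X"
    then have "int x \<le> X" using n by simp
    then consider "int x \<le> int p - 1 - int (N0 mod p)" "int x \<le> int q - 1 - int d1 - int (N0 mod q)"
      | "int x \<le> int p - 1 - int d2 - int (N0 mod p)" "int x \<le> int q - 1 - int (N0 mod q)"
      unfolding X gap_def by linarith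
    then obtain i where "i < N0" "N0 mod p + x \<le> i mod p" "N0 mod q + x \<le> i mod q"
    proof cases
      case 1
      then have "d1 < q" by linarith
      then obtain i where "i < N0" "i mod p = p - 1" "i mod q = q - 1 - d1"
        using minmod_witness[OF assms(2,3) d(1)] by blast
      then show ?thesis using 1 by (intro that[of i]) linarith+
    next
      case 2
      then have "d2 < p" by linarith
      then obtain i where "i < N0" "i mod q = q - 1" "i mod p = p - 1 - d2"
        using minmod_witness[OF assms(3,2) d(2)] by blast
      then show ?thesis using 2 by (intro that[of i]) linarith+
    qed
    then show "good p q n" unfolding good_def using mods[of x] n by (intro exI[of _ i]) auto
  qed
qed

lemma gap_ge:
  fixes X :: int
  assumes "0 < p" "0 < q" "N0 = first_multiple p q c" "0 < c"
    and d: "minmod p q (N0 div p) d1"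
    and X: "X = gap p q N0 d1 d2"
  shows "-1 \<le> X"
proof -
  have "N0 mod p < p" using assms(1) by simp
  moreover have "d1 + N0 mod q \<le> q"
  proof (rule first_multiple_cases[of p q c])
    fix k assume "first_multiple p q c = p * k"
    then have k: "N0 = k * p" using assms(3) by simp
    have "N0 \<noteq> 0" using first_multiple_ge[OF assms(1,2), of c] assms(3,4) by (cases "N0 = 0") auto
    then have "1 \<le> k" using k by (cases k) auto
    moreover have "k \<le> N0 div p" using k assms(1) by simp
    ultimately show ?thesis using d k unfolding minmod_def by blast
  next
    fix l assume "first_multiple p q c = q * l"
    then have "N0 mod q = 0" using assms(3) by simp
    then show ?thesis using minmod_le[OF d] by simp
  qed
  ultimately show ?thesis unfolding X gap_def by linarith
qed

text \<open>The cheapest single position costs \<open>n div p + n div q\<close> minus 1, or minus 2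
  if a good position exists. With \<open>c = h' + 2\<close>, all of them exceed \<open>h'\<close>
  once the sum is at least \<open>c + 1\<close>, or at least \<open>c\<close> without a good
  position. The sum reaches \<open>c\<close> at \<open>N0\<close> and \<open>c + 1\<close> at
  \<open>N1\<close>.\<close>

lemma single_threshold_formula:
  fixes X :: int
  assumes "coprime p q" "2 \<le> p" "p < q" "h' < p + q - 2" "c = h' + 2"
    and N: "N0 = first_multiple p q c" "N1 = first_multiple p q (c + 1)"
    and d: "N0 < N1 \<Longrightarrow> minmod p q (N0 div p) d1 \<and> minmod q p (N0 div q) d2"
    and X: "X = gap p q N0 d1 d2"
  shows "int (single_threshold p q (t * (p + q - 2) + h')) =
    int (p * q * t) + (if N0 < N1 then min (int N1) (int N0 + 1 + X) else int N1)"
proof -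
  have p: "0 < p" and q: "0 < q" using assms by simp_all
  have N1: "N1 \<le> p * q" unfolding N using assms(4,5) p by (intro first_multiple_le) auto
  have f1: "c + 1 \<le> N1 div p + N1 div q" using first_multiple_ge[OF p q, of "c + 1"] N by simp
  have f0: "c \<le> N0 div p + N0 div q" using first_multiple_ge[OF p q, of c] N by simp
  have N01: "N0 \<le> N1"
  proof (rule ccontr)
    assume "\<not> N0 \<le> N1"
    then show False using less_first_multiple[OF p q, of N1 c] N(1) f1 by simp
  qed
  define L where "L = (if N0 < N1 then nat (min (int N1) (int N0 + 1 + X)) else N1)"
  have Lint: "int L = (if N0 < N1 then min (int N1) (int N0 + 1 + X) else int N1)" and NL: "N0 \<le> L" "L \<le> N1"
  proof -
    have gX: "-1 \<le> X" if "N0 < N1"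
      using d[OF that] assms(5) by (intro gap_ge[OF p q N(1) _ _ X]) auto
    have "int L = (if N0 < N1 then min (int N1) (int N0 + 1 + X) else int N1) \<and> N0 \<le> L \<and> L \<le> N1"
    proof (cases "N0 < N1")
      case True
      then show ?thesis using gX[OF True] unfolding L_def by (simp add: min_def nat_le_iff le_nat_iff)
    next
      case False
      then show ?thesis using N01 by (simp add: L_def)
    qed
    then show "int L = (if N0 < N1 then min (int N1) (int N0 + 1 + X) else int N1)" "N0 \<le> L" "L \<le> N1"
      by blast+
  qed
  have good: "good p q n \<longleftrightarrow> int n \<le> int N0 + X" if "N0 \<le> n" "n < N1" for n
    using that d N1 assms(5) N by (intro good_iff[OF assms(1) p q N(1) _ _ _ that(1) _ _ X]) auto
  have L0: "0 < L"
  proof -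
    have "N0 \<noteq> 0" using f0 assms(5) by (cases "N0 = 0") auto
    then show ?thesis using NL by simp
  qed
  have up: "singles_gt p q h' L"
    unfolding singles_gt_def
  proof (intro allI impI)
    fix u v assume uv: "u < p" "v < q"
    have le: "L div p + L div q \<le> cost p q L {u} {v} + (if good p q L then 2 else 1)"
      using NL N1 by (intro cost_single_ge[OF assms(1) uv]) simp
    show "h' < cost p q L {u} {v}"
    proof (cases "L = N1")
      case True
      then show ?thesis using le f1 assms(5) by (simp split: if_splits)
    next
      case False
      then have "L < N1" using NL by simp
      then have "int L = int N0 + 1 + X" using Lint by (auto simp: min_def split: if_splits)
      then have "\<not> good p q L" using good[OF NL(1) \<open>L < N1\<close>] by simp
      moreover have "c \<le> L div p + L div q"
        using f0 div_le_mono[OF NL(1), of p] div_le_mono[OF NL(1), of q] by linarith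
      ultimately show ?thesis using le assms(5) by simp
    qed
  qed
  have low: "\<not> singles_gt p q h' (L - 1)"
  proof
    assume S: "singles_gt p q h' (L - 1)"
    show False
    proof (cases "N0 \<le> L - 1")
      case True
      then have lt: "L - 1 < N1" using NL L0 by simp
      have "int (L - 1) \<le> int N0 + X" using True Lint L0 lt by (auto simp: of_nat_diff split: if_splits)
      then obtain i where i: "i < L - 1" "(L - 1) mod p \<le> i mod p" "(L - 1) mod q \<le> i mod q"
        using good[OF True lt] unfolding good_def by blast
      have "h' + 3 \<le> (L - 1) div p + (L - 1) div q"
        by (rule singles_gt_good[OF S assms(1) p q i])
      moreover have "(L - 1) div p + (L - 1) div q < c + 1"
        using lt N by (intro less_first_multiple[OF p q]) simp
      ultimately show False using assms(5) by simp
    next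
      case False
      then have lt: "(L - 1) div p + (L - 1) div q < c"
        using N by (intro less_first_multiple[OF p q]) simp
      show False
      proof (cases "p \<le> L - 1")
        case True
        then show False using singles_gt_last[OF S assms(1) p assms(3)] lt assms(5) by simp
      next
        case False
        \<comment> \<open>Such a short word does not reach position \<open>p - 1\<close> at
          all.\<close>
        have "cost p q (L - 1) {p - 1} {p - 1} = 0"
          unfolding cost_def using False assms(3) by (auto simp: mod_less)
        moreover have "h' < cost p q (L - 1) {p - 1} {p - 1}"
          using S assms(2,3) by (simp add: singles_gt_def)
        ultimately show False by simp
      qed
    qed
  qed
  have "single_threshold p q (t * (p + q - 2) + h') = p * q * t + L"
  proof (rule single_threshold_eqI)
    show "singles_gt p q (t * (p + q - 2) + h') (p * q * t + L)"
      using up singles_gt_shift[OF assms(1,2) q] by blast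
    have "p * q * t + L - 1 = p * q * t + (L - 1)" using L0 by simp
    then show "\<not> singles_gt p q (t * (p + q - 2) + h') (p * q * t + L - 1)"
      using low singles_gt_shift[OF assms(1,2) q] by simp
  qed (use L0 in simp)
  then show ?thesis using Lint by simp
qed

section \<open>Straight-line code and loops\<close>

datatype expr = Num int | Var int | Op arith expr expr

fun expr_val :: "expr \<Rightarrow> memory \<Rightarrow> int" where
  "expr_val (Num k) s = k"
| "expr_val (Var x) s = s x"
| "expr_val (Op f a b) s = arith_val f (expr_val a s) (expr_val b s)"

fun expr_ok :: "expr \<Rightarrow> bool" where
  "expr_ok (Num k) \<longleftrightarrow> True"
| "expr_ok (Var x) \<longleftrightarrow> x < 100"
| "expr_ok (Op f a b) \<longleftrightarrow> expr_ok a \<and> expr_ok b"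

fun expr_cost :: "expr \<Rightarrow> nat" where
  "expr_cost (Num k) = 1"
| "expr_cost (Var x) = 1"
| "expr_cost (Op f a b) = expr_cost a + (expr_cost b + 1)"

text \<open>Program variables live in the cells below 100. The cells from 100 on are the evaluation stack.\<close>

fun comp_expr :: "expr \<Rightarrow> int \<Rightarrow> program" where
  "comp_expr (Num k) d = Assign (Direct d) Add (Const k) (Const 0)"
| "comp_expr (Var x) d = Assign (Direct d) Add (Cell (Direct x)) (Const 0)"
| "comp_expr (Op f a b) d = Seq (comp_expr a d) (Seq (comp_expr b (d + 1))
     (Assign (Direct d) f (Cell (Direct d)) (Cell (Direct (d + 1)))))"

definition agree :: "memory \<Rightarrow> memory \<Rightarrow> bool" where
  "agree m s \<longleftrightarrow> (\<forall>i<100. m i = s i)"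

lemma expr_val_agree: "expr_ok e \<Longrightarrow> agree m s \<Longrightarrow> expr_val e m = expr_val e s"
  by (induction e) (auto simp: agree_def)

lemma exec_Assign:
  "m' = m(address a m := arith_val f (operand_val x m) (operand_val y m)) \<Longrightarrow> exec (Assign a f x y) m 1 m'"
  by (simp add: exec.Assign del: One_nat_def)

lemma exec_comp_expr:
  assumes "expr_ok e" "100 \<le> d"
  shows "\<exists>m'. exec (comp_expr e d) m (expr_cost e) m' \<and> m' d = expr_val e m \<and> (\<forall>i<d. m' i = m i)"
  using assms
proof (induction e arbitrary: d m)
  case (Num k)
  then show ?case using exec_Assign[OF refl, of "Direct d" Add "Const k" "Const 0" m] by force
next
  case (Var x)
  then show ?case using exec_Assign[OF refl, of "Direct d" Add "Cell (Direct x)" "Const 0" m] by force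
next
  case (Op f a b)
  obtain m1 where m1: "exec (comp_expr a d) m (expr_cost a) m1" "m1 d = expr_val a m" "\<forall>i<d. m1 i = m i"
    using Op.IH(1)[of d m] Op.prems by auto
  obtain m2 where m2: "exec (comp_expr b (d + 1)) m1 (expr_cost b) m2" "m2 (d + 1) = expr_val b m1"
    "\<forall>i<d + 1. m2 i = m1 i"
    using Op.IH(2)[of "d + 1" m1] Op.prems by auto
  have "agree m1 m" using m1(3) Op.prems by (simp add: agree_def)
  then have b: "expr_val b m1 = expr_val b m" using Op.prems expr_val_agree by simp
  define m3 where "m3 = m2(d := arith_val f (m2 d) (m2 (d + 1)))"
  have "exec (Assign (Direct d) f (Cell (Direct d)) (Cell (Direct (d + 1)))) m2 1 m3"
    by (rule exec_Assign) (simp add: m3_def)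
  then have "exec (comp_expr (Op f a b) d) m (expr_cost (Op f a b)) m3"
    unfolding comp_expr.simps expr_cost.simps by (intro exec.Seq[OF m1(1)] exec.Seq[OF m2(1)])
  moreover have "m3 d = expr_val (Op f a b) m" using m1 m2 b by (simp add: m3_def)
  moreover have "\<forall>i<d. m3 i = m i" using m1(3) m2(3) by (simp add: m3_def)
  ultimately show ?case by blast
qed

text \<open>Here \<open>s\<close> is an idealised memory which the real one matches below cell 100,
  so the evaluation stack is invisible. The final \<open>s'\<close> is existential, hence
  \<open>Q\<close> need not be stable under changes of the stack.\<close>

definition does :: "program \<Rightarrow> memory \<Rightarrow> nat \<Rightarrow> (memory \<Rightarrow> bool) \<Rightarrow> bool" where
  "does c s T Q \<longleftrightarrow> (\<forall>m. agree m s \<longrightarrow> (\<exists>t m' s'. exec c m t m' \<and> t \<le> T \<and> agree m' s' \<and> Q s'))"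

lemma does_mono: "does c s T Q \<Longrightarrow> T \<le> T' \<Longrightarrow> (\<And>s'. Q s' \<Longrightarrow> Q' s') \<Longrightarrow> does c s T' Q'"
  unfolding does_def by (meson le_trans)

lemma does_Skip: "Q s \<Longrightarrow> does Skip s 1 Q"
  unfolding does_def using exec.Skip by blast

lemma does_Seq:
  assumes "does c s T Q" "\<And>s'. Q s' \<Longrightarrow> does d s' U R"
  shows "does (Seq c d) s (T + U) R"
  unfolding does_def
proof (intro allI impI)
  fix m assume "agree m s"
  then obtain t m' s' where 1: "exec c m t m'" "t \<le> T" "agree m' s'" "Q s'"
    using assms(1) unfolding does_def by blast
  then obtain u m'' s'' where "exec d m' u m''" "u \<le> U" "agree m'' s''" "R s''"
    using assms(2) unfolding does_def by blast
  then show "\<exists>t m' s'. exec (Seq c d) m t m' \<and> t \<le> T + U \<and> agree m' s' \<and> R s'"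
    using exec.Seq[OF 1(1)] 1(2) add_mono by blast
qed

definition assign :: "int \<Rightarrow> expr \<Rightarrow> program" where
  "assign x e = Seq (comp_expr e 100) (Assign (Direct x) Add (Cell (Direct 100)) (Const 0))"

lemma does_assign:
  assumes "expr_ok e" "x < 100" "Q (s(x := expr_val e s))"
  shows "does (assign x e) s (expr_cost e + 1) Q"
  unfolding does_def
proof (intro allI impI)
  fix m assume m: "agree m s"
  obtain m1 where m1: "exec (comp_expr e 100) m (expr_cost e) m1" "m1 100 = expr_val e m" "\<forall>i<100. m1 i = m i"
    using exec_comp_expr[OF assms(1), of 100 m] by auto
  define m2 where "m2 = m1(x := m1 100)"
  have "exec (Assign (Direct x) Add (Cell (Direct 100)) (Const 0)) m1 1 m2"
    by (rule exec_Assign) (simp add: m2_def)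
  then have "exec (assign x e) m (expr_cost e + 1) m2"
    unfolding assign_def by (rule exec.Seq[OF m1(1)])
  moreover have "agree m2 (s(x := expr_val e s))"
    using m m1 expr_val_agree[OF assms(1) m] by (simp add: agree_def m2_def)
  ultimately show "\<exists>t m' s'. exec (assign x e) m t m' \<and> t \<le> expr_cost e + 1 \<and> agree m' s' \<and> Q s'"
    using assms(3) by blast
qed

fun operand_ok :: "operand \<Rightarrow> bool" where
  "operand_ok (Const k) \<longleftrightarrow> True"
| "operand_ok (Cell (Direct x)) \<longleftrightarrow> x < 100"
| "operand_ok (Cell (Indirect x)) \<longleftrightarrow> False"

fun test_ok :: "test \<Rightarrow> bool" where
  "test_ok (Less x y) \<longleftrightarrow> operand_ok x \<and> operand_ok y"
| "test_ok (Equal x y) \<longleftrightarrow> operand_ok x \<and> operand_ok y"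

lemma operand_val_agree: "operand_ok x \<Longrightarrow> agree m s \<Longrightarrow> operand_val x m = operand_val x s"
  by (induction x rule: operand_ok.induct) (auto simp: agree_def)

lemma test_val_agree: "test_ok b \<Longrightarrow> agree m s \<Longrightarrow> test_val b m \<longleftrightarrow> test_val b s"
  by (cases b) (simp_all add: operand_val_agree)

lemma does_Cond:
  assumes "test_ok b" "test_val b s \<Longrightarrow> does c s T Q" "\<not> test_val b s \<Longrightarrow> does d s T Q"
  shows "does (Cond b c d) s (1 + T) Q"
  unfolding does_def
proof (intro allI impI)
  fix m assume m: "agree m s"
  show "\<exists>t m' s'. exec (Cond b c d) m t m' \<and> t \<le> 1 + T \<and> agree m' s' \<and> Q s'"
  proof (cases "test_val b s")
    case True
    then obtain t m' s' where "exec c m t m'" "t \<le> T" "agree m' s'" "Q s'"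
      using assms(2) m unfolding does_def by blast
    moreover have "test_val b m" using True test_val_agree[OF assms(1) m] by simp
    ultimately show ?thesis using exec.CondTrue add_left_mono by blast
  next
    case False
    then obtain t m' s' where "exec d m t m'" "t \<le> T" "agree m' s'" "Q s'"
      using assms(3) m unfolding does_def by blast
    moreover have "\<not> test_val b m" using False test_val_agree[OF assms(1) m] by simp
    ultimately show ?thesis using exec.CondFalse add_left_mono by blast
  qed
qed

text \<open>The index of the invariant bounds the number of remaining iterations; in particular
  \<open>I 0\<close> must force the loop to stop.\<close>

lemma does_While:
  assumes "test_ok b"
    and body: "\<And>k s. I k s \<Longrightarrow> test_val b s \<Longrightarrow> 0 < k \<and> does c s T (I (k - 1))"
    and exit: "\<And>k s. I k s \<Longrightarrow> \<not> test_val b s \<Longrightarrow> Q s"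
    and "I k s"
  shows "does (While b c) s (1 + k * (1 + T)) Q"
  using assms(4)
proof (induction k arbitrary: s)
  case 0
  have b: "\<not> test_val b s" using body[OF 0] by blast
  show ?case
    unfolding does_def
  proof (intro allI impI)
    fix m assume m: "agree m s"
    then have "\<not> test_val b m" using b test_val_agree[OF assms(1) m] by simp
    then have "exec (While b c) m 1 m" by (rule exec.WhileFalse)
    then show "\<exists>t m' s'. exec (While b c) m t m' \<and> t \<le> 1 + 0 * (1 + T) \<and> agree m' s' \<and> Q s'"
      using m exit[OF 0 b] by (intro exI[of _ 1] exI[of _ m] exI[of _ s]) simp
  qed
next
  case (Suc k)
  show ?case
    unfolding does_def
  proof (intro allI impI)
    fix m assume m: "agree m s"
    show "\<exists>t m' s'. exec (While b c) m t m' \<and> t \<le> 1 + Suc k * (1 + T) \<and> agree m' s' \<and> Q s'"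
    proof (cases "test_val b s")
      case True
      then have "does c s T (I k)" using body[OF Suc.prems] by simp
      then obtain t m1 s1 where 1: "exec c m t m1" "t \<le> T" "agree m1 s1" "I k s1"
        using m unfolding does_def by blast
      obtain u m2 s2 where 2: "exec (While b c) m1 u m2" "u \<le> 1 + k * (1 + T)" "agree m2 s2" "Q s2"
        using Suc.IH[OF 1(4)] 1(3) unfolding does_def by blast
      have "test_val b m" using True test_val_agree[OF assms(1) m] by simp
      then have "exec (While b c) m (1 + t + u) m2" using 1(1) 2(1) by (rule exec.WhileTrue)
      moreover have "1 + t + u \<le> 1 + Suc k * (1 + T)" using 1(2) 2(2) by simp
      ultimately show ?thesis using 2(3,4) by blast
    next
      case False
      then have "\<not> test_val b m" using test_val_agree[OF assms(1) m] by simp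
      then have "exec (While b c) m 1 m" by (rule exec.WhileFalse)
      then show ?thesis using m exit[OF Suc.prems False] by (intro exI[of _ 1] exI[of _ m] exI[of _ s]) simp
    qed
  qed
qed

section \<open>A language of assignments, minima and maxima\<close>

datatype instr = Set int expr | Min int int | Max int int

fun run :: "instr list \<Rightarrow> memory \<Rightarrow> memory" where
  "run [] s = s"
| "run (Set x e # c) s = run c (s(x := expr_val e s))"
| "run (Min x y # c) s = run c (s(x := min (s x) (s y)))"
| "run (Max x y # c) s = run c (s(x := max (s x) (s y)))"

fun code :: "instr list \<Rightarrow> program" where
  "code [] = Skip"
| "code (Set x e # c) = Seq (assign x e) (code c)"
| "code (Min x y # c) =
     Seq (Cond (Less (Cell (Direct y)) (Cell (Direct x))) (assign x (Var y)) (assign x (Var x))) (code c)"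
| "code (Max x y # c) =
     Seq (Cond (Less (Cell (Direct x)) (Cell (Direct y))) (assign x (Var y)) (assign x (Var x))) (code c)"

fun code_ok :: "instr list \<Rightarrow> bool" where
  "code_ok [] \<longleftrightarrow> True"
| "code_ok (Set x e # c) \<longleftrightarrow> x < 100 \<and> expr_ok e \<and> code_ok c"
| "code_ok (Min x y # c) \<longleftrightarrow> x < 100 \<and> y < 100 \<and> code_ok c"
| "code_ok (Max x y # c) \<longleftrightarrow> x < 100 \<and> y < 100 \<and> code_ok c"

fun code_cost :: "instr list \<Rightarrow> nat" where
  "code_cost [] = 1"
| "code_cost (Set x e # c) = expr_cost e + 1 + code_cost c"
| "code_cost (Min x y # c) = 3 + code_cost c"
| "code_cost (Max x y # c) = 3 + code_cost c"

lemma does_code: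
  assumes "code_ok c" "Q (run c s)"
  shows "does (code c) s (code_cost c) Q"
  using assms
proof (induction c arbitrary: s rule: code.induct)
  case 1
  then show ?case by (simp add: does_Skip del: One_nat_def)
next
  case (2 x e c)
  have "does (assign x e) s (expr_cost e + 1) (\<lambda>s'. Q (run c s'))"
    using 2 by (intro does_assign) simp_all
  then show ?case unfolding code.simps code_cost.simps
    by (rule does_Seq) (use 2 in simp)
next
  case (3 x y c)
  have "does (assign x (Var z)) s 2 (\<lambda>s'. Q (run c s'))" if "z < 100" "min (s x) (s y) = s z" for z
    using 3 that does_assign[of "Var z" x "\<lambda>s'. Q (run c s')" s] by (simp add: numeral_2_eq_2)
  then have "does (Cond (Less (Cell (Direct y)) (Cell (Direct x))) (assign x (Var y)) (assign x (Var x)))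
      s (1 + 2) (\<lambda>s'. Q (run c s'))"
    using 3 by (intro does_Cond) simp_all
  then have "does (code (Min x y # c)) s (1 + 2 + code_cost c) Q"
    unfolding code.simps by (rule does_Seq) (use 3 in simp)
  then show ?case by (simp add: numeral_3_eq_3)
next
  case (4 x y c)
  have "does (assign x (Var z)) s 2 (\<lambda>s'. Q (run c s'))" if "z < 100" "max (s x) (s y) = s z" for z
    using 4 that does_assign[of "Var z" x "\<lambda>s'. Q (run c s')" s] by (simp add: numeral_2_eq_2)
  then have "does (Cond (Less (Cell (Direct x)) (Cell (Direct y))) (assign x (Var y)) (assign x (Var x)))
      s (1 + 2) (\<lambda>s'. Q (run c s'))"
    using 4 by (intro does_Cond) simp_all
  then have "does (code (Max x y # c)) s (1 + 2 + code_cost c) Q"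
    unfolding code.simps by (rule does_Seq) (use 4 in simp)
  then show ?case by (simp add: numeral_3_eq_3)
qed

definition mod_expr :: "expr \<Rightarrow> expr \<Rightarrow> expr" where
  "mod_expr a b = Op Sub a (Op Mul (Op Div a b) b)"

lemma mod_expr_simps [simp]:
  "expr_val (mod_expr a b) s = expr_val a s mod expr_val b s"
  "expr_ok (mod_expr a b) \<longleftrightarrow> expr_ok a \<and> expr_ok b"
  by (auto simp: mod_expr_def minus_div_mult_eq_mod)

fun target :: "instr \<Rightarrow> int" where
  "target (Set x e) = x"
| "target (Min x y) = x"
| "target (Max x y) = x"

lemma run_frame: "x \<notin> target ` set c \<Longrightarrow> run c s x = s x"
  by (induction c s rule: run.induct) auto

section \<open>The greatest common divisor\<close>

definition gcd_init :: "instr list" where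
  "gcd_init = [Set 3 (Var 0), Max 3 1, Set 4 (Var 0), Min 4 1]"

definition gcd_body :: "instr list" where
  "gcd_body = [Set 5 (mod_expr (Var 3) (Var 4)), Set 3 (Var 4), Set 4 (Var 5)]"

definition gcd_prog :: program where
  "gcd_prog = Seq (code gcd_init)
     (While (Less (Const 0) (Cell (Direct 4))) (code gcd_body))"

text \<open>Each division step at least halves the product of the two numbers, since
  \<open>2 * (x mod y) \<le> x\<close> for \<open>0 < y \<le> x\<close>. The inputs are sorted first
  to ensure \<open>y \<le> x\<close>.\<close>

lemma does_gcd_prog:
  assumes "0 < s 0" "0 < s 1" "s 0 * s 1 < 2 ^ k"
  shows "does gcd_prog s (code_cost gcd_init + (1 + k * (1 + code_cost gcd_body)))
    (\<lambda>s'. s' 0 = s 0 \<and> s' 1 = s 1 \<and> s' 2 = s 2 \<and> s' 3 = gcd (s 0) (s 1))"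
  unfolding gcd_prog_def
proof (rule does_Seq)
  let ?I = "\<lambda>k (s' :: memory). s' 0 = s 0 \<and> s' 1 = s 1 \<and> s' 2 = s 2 \<and> 0 \<le> s' 4 \<and> s' 4 \<le> s' 3 \<and> 0 < s' 3 \<and>
    s' 3 * s' 4 < 2 ^ k \<and> gcd (s' 3) (s' 4) = gcd (s 0) (s 1)"
  have "max (s 0) (s 1) * min (s 0) (s 1) = s 0 * s 1" "gcd (max (s 0) (s 1)) (min (s 0) (s 1)) = gcd (s 0) (s 1)"
    by (auto simp: max_def min_def gcd.commute)
  then show "does (code gcd_init) s
      (code_cost gcd_init) (?I k)"
    using assms by (intro does_code) (auto simp: gcd_init_def)
  fix s1 :: memory assume I1: "?I k s1"
  show "does (While (Less (Const 0) (Cell (Direct 4))) (code gcd_body)) s1 (1 + k * (1 + code_cost gcd_body))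
     (\<lambda>s'. s' 0 = s 0 \<and> s' 1 = s 1 \<and> s' 2 = s 2 \<and> s' 3 = gcd (s 0) (s 1))"
  proof (rule does_While[where I = ?I])
    show "?I k s1" by (rule I1)
  next
    fix k and s' :: memory assume I: "?I k s'" and "test_val (Less (Const 0) (Cell (Direct 4))) s'"
    then have pos: "0 < s' 4" by simp
    have "0 < k"
    proof (rule ccontr)
      assume "\<not> 0 < k"
      then have "s' 3 * s' 4 < 1" using I by simp
      moreover have "0 < s' 3 * s' 4" using I pos by simp
      ultimately show False by simp
    qed
    moreover have "does (code gcd_body) s' (code_cost gcd_body) (?I (k - 1))"
    proof (rule does_code)
      let ?r = "s' 3 mod s' 4"
      have r: "0 \<le> ?r" "?r < s' 4" using pos by simp_all
      have "2 * ?r \<le> s' 3"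
      proof -
        have e: "s' 3 = s' 3 div s' 4 * s' 4 + ?r" by simp
        have "0 < s' 3 div s' 4" using I pos by (simp add: pos_imp_zdiv_pos_iff)
        then have "1 \<le> s' 3 div s' 4" by linarith
        then have "1 * s' 4 \<le> s' 3 div s' 4 * s' 4" using pos by (intro mult_right_mono) auto
        then show ?thesis using e r by linarith
      qed
      then have "2 * ?r * s' 4 \<le> s' 3 * s' 4" using pos by (intro mult_right_mono) auto
      also have "s' 3 * s' 4 < 2 ^ k" using I by simp
      also have "(2::int) ^ k = 2 * 2 ^ (k - 1)" using \<open>0 < k\<close> by (simp add: power_eq_if)
      finally have "s' 4 * ?r < 2 ^ (k - 1)" by (simp add: mult.commute)
      moreover have "gcd (s' 4) ?r = gcd (s 0) (s 1)" using I by (simp add: gcd_red_int[symmetric])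
      moreover have "?r \<le> s' 4" using r(2) by simp
      ultimately show "?I (k - 1) (run gcd_body s')" using I r(1) pos by (simp add: gcd_body_def)
    qed (simp add: gcd_body_def)
    ultimately show "0 < k \<and> does (code gcd_body) s' (code_cost gcd_body) (?I (k - 1))" by (rule conjI)
  next
    fix k and s' :: memory assume I: "?I k s'" and "\<not> test_val (Less (Const 0) (Cell (Direct 4))) s'"
    then have "s' 4 = 0" by simp
    then show "s' 0 = s 0 \<and> s' 1 = s 1 \<and> s' 2 = s 2 \<and> s' 3 = gcd (s 0) (s 1)"
      using I abs_of_pos[of "s' 3"] by simp
  qed simp
qed

section \<open>Minimal residues\<close>

text \<open>Consecutive best one-sided approximations: \<open>v1\<close> and \<open>v2\<close> are the record values of
  \<open>- x a mod m\<close> and \<open>x a mod m\<close>, attained at \<open>x1\<close> and \<open>x2\<close>. They form a lattice basis, which is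
  what the equation \<open>v1 * x2 + v2 * x1 = m\<close> says.\<close>

definition records :: "int \<Rightarrow> int \<Rightarrow> int \<Rightarrow> int \<Rightarrow> int \<Rightarrow> int \<Rightarrow> int \<Rightarrow> bool" where
  "records a m J x1 v1 x2 v2 \<longleftrightarrow> 0 \<le> x1 \<and> x1 \<le> J \<and> 1 \<le> x2 \<and> 1 \<le> v1 \<and> v1 \<le> m \<and> 1 \<le> v2 \<and> v2 \<le> v1 \<and>
     v1 * x2 + v2 * x1 = m \<and> m dvd v1 + x1 * a \<and> m dvd x2 * a - v2 \<and> coprime v1 v2 \<and> (x1 = 0 \<longrightarrow> v1 = m)"

text \<open>One round performs two batches of subtractions, as in the extended Euclidean algorithm;
  the first is cut short when \<open>x1\<close> would leave the range. The quotients use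
  \<open>v1 - 1\<close> and \<open>v2 - 1\<close> to keep both values positive, since a vanishing
  residue is not a record. A first batch that is not cut short ends with
  \<open>v1' \<le> v2\<close>, and so at least halves \<open>v1\<close>.\<close>

lemma records_step:
  fixes a m J x1 v1 x2 v2 :: int
  assumes rec: "records a m J x1 v1 x2 v2" and J: "x1 + x2 \<le> J" "J < m"
    and t: "t = min ((v1 - 1) div v2) ((J - x1) div x2)"
    and 1: "x1' = x1 + t * x2" "v1' = v1 - t * v2"
    and t': "t' = (v2 - 1) div v1'"
    and 2: "x2' = x2 + t' * x1'" "v2' = v2 - t' * v1'"
  shows "records a m J x1' v1' x2' v2'" "J < x1' + x2' \<or> 2 * v1' \<le> v1"
proof -
  have r: "0 \<le> x1" "x1 \<le> J" "1 \<le> x2" "1 \<le> v1" "v1 \<le> m" "1 \<le> v2" "v2 \<le> v1"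
    "v1 * x2 + v2 * x1 = m" "m dvd v1 + x1 * a" "m dvd x2 * a - v2" "coprime v1 v2"
    using rec by (simp_all add: records_def)
  \<comment> \<open>Equal coprime values would both be 1, and the basis equation would give
    \<open>x1 + x2 = m > J\<close>.\<close>
  have "v2 \<noteq> v1"
  proof
    assume e: "v2 = v1"
    then have "is_unit v1" using r(11) by simp
    then have "v1 = 1" using r(4) by simp
    then show False using r(8) e J by simp
  qed
  then have lt: "v2 < v1" using r(7) by simp
  define d1 d2 where "d1 = (v1 - 1) div v2" and "d2 = (J - x1) div x2"
  have d1: "v1 - 1 = d1 * v2 + (v1 - 1) mod v2" "0 \<le> (v1 - 1) mod v2" "(v1 - 1) mod v2 < v2"
    using r(6) by (simp_all add: d1_def)
  have d2: "J - x1 = d2 * x2 + (J - x1) mod x2" "0 \<le> (J - x1) mod x2" "(J - x1) mod x2 < x2"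
    using r(3) by (simp_all add: d2_def)
  have td: "t = d1 \<or> t = d2" "t \<le> d1" "t \<le> d2" using t by (auto simp: d1_def d2_def)
  have "1 \<le> d1" unfolding d1_def using lt r(6) by (simp add: int_one_le_iff_zero_less pos_imp_zdiv_pos_iff)
  moreover have "1 \<le> d2" unfolding d2_def using J r(3) by (simp add: int_one_le_iff_zero_less pos_imp_zdiv_pos_iff)
  ultimately have t1: "1 \<le> t" using td by auto
  have tv: "t * v2 \<le> d1 * v2" "t * x2 \<le> d2 * x2" "v2 \<le> t * v2" "x2 \<le> t * x2"
    using td t1 r(3,6) by (simp_all add: mult_right_mono)
  have v1': "1 \<le> v1'" using 1 tv(1) d1 by linarith
  have x1': "0 \<le> x1'" "x1' \<le> J" "1 \<le> x1'" using 1 tv(2,4) d2 r by linarith+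
  define e where "e = (v2 - 1) mod v1'"
  have e: "v2 - 1 = t' * v1' + e" "0 \<le> e" "e < v1'" using v1' by (simp_all add: e_def t')
  have t'0: "0 \<le> t'" unfolding t' using r(6) v1' by (simp add: pos_imp_zdiv_nonneg_iff)
  have v2': "1 \<le> v2'" "v2' \<le> v1'" using 2 e by linarith+
  have x2': "x2 \<le> x2'" using 2 t'0 x1' by simp
  have "v1' * x2 + v2 * x1' = m" unfolding 1 using r(8) by (simp add: algebra_simps)
  then have det: "v1' * x2' + v2' * x1' = m" unfolding 2 by (simp add: algebra_simps)
  have "v1' + x1' * a = (v1 + x1 * a) + t * (x2 * a - v2)" unfolding 1 by (simp add: algebra_simps)
  then have dv1: "m dvd v1' + x1' * a" using r(9,10) by simp
  have "x2' * a - v2' = (x2 * a - v2) + t' * (v1' + x1' * a)" unfolding 2 by (simp add: algebra_simps)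
  then have dv2: "m dvd x2' * a - v2'" using r(10) dv1 by simp
  have "gcd v1' v2 = 1"
  proof -
    have "gcd v1' v2 = gcd v2 ((- t) * v2 + v1)" unfolding 1 by (simp add: gcd.commute)
    also have "\<dots> = gcd v2 v1" by (rule gcd_add_mult)
    finally show ?thesis using r(11) by (simp add: gcd.commute coprime_iff_gcd_eq_1)
  qed
  moreover have "gcd v1' v2' = gcd v1' v2"
  proof -
    have "v2' = (- t') * v1' + v2" unfolding 2 by simp
    then show ?thesis by (simp only: gcd_add_mult)
  qed
  ultimately have cop: "coprime v1' v2'" by (simp add: coprime_iff_gcd_eq_1)
  have "v1' \<le> m" using 1 tv(3) r(5,6) by linarith
  then show "records a m J x1' v1' x2' v2'"
    unfolding records_def using v1' x1' v2' x2' r(3) det dv1 dv2 cop by simp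
  show "J < x1' + x2' \<or> 2 * v1' \<le> v1"
  proof (cases "t = d1")
    case True
    have "v1' \<le> v2" using 1(2) d1 unfolding True by linarith
    then show ?thesis using 1 tv(3) by linarith
  next
    case False
    then have td2: "t = d2" using td by blast
    have "J < x1' + x2" using 1(1) d2 unfolding td2 by linarith
    then show ?thesis using x2' by linarith
  qed
qed

text \<open>Every point \<open>(j, w)\<close> with \<open>m\<close> dividing
  \<open>w + j * a\<close> is an integer combination
  \<open>\<alpha> * (x1, v) + \<beta> * (x2, - v2)\<close>. Positive \<open>j\<close> and
  \<open>w\<close> force \<open>\<alpha> \<ge> 1\<close>, and \<open>w < v\<close> then forces
  \<open>\<beta> \<ge> 1\<close>, so \<open>j \<ge> x1 + x2 > J\<close>.\<close>

lemma records_minmod: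
  assumes rec: "records (int a) (int m) (int J) x1 (int v) x2 v2" and J: "int J < x1 + x2" and m: "0 < m"
  shows "minmod a m J v"
proof -
  have r: "0 \<le> x1" "x1 \<le> int J" "1 \<le> x2" "1 \<le> int v" "int v \<le> int m" "1 \<le> v2"
    "int v * x2 + v2 * x1 = int m" "int m dvd int v + x1 * int a" "int m dvd x2 * int a - v2"
    "x1 = 0 \<longrightarrow> int v = int m"
    using rec by (simp_all add: records_def)
  have le: "v + j * a mod m \<le> m" if j: "1 \<le> j" "j \<le> J" for j
  proof (rule ccontr)
    assume "\<not> ?thesis"
    define w where "w = int m - int (j * a mod m)"
    have w: "1 \<le> w" "w < int v"
      using \<open>\<not> v + j * a mod m \<le> m\<close> mod_less_divisor[OF m, of "j * a"] unfolding w_def by linarith+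
    have "w + int j * int a = int m * (1 + int (j * a div m))"
    proof -
      have "int (j * a) = int (m * (j * a div m) + j * a mod m)" by simp
      then have "int j * int a = int m * int (j * a div m) + int (j * a mod m)"
        by (simp only: of_nat_mult of_nat_add)
      then show ?thesis by (simp add: w_def distrib_left)
    qed
    then have dw: "int m dvd w + int j * int a" by simp
    have "int j * v2 + w * x2 = x2 * (w + int j * int a) - int j * (x2 * int a - v2)"
      by (simp add: algebra_simps)
    then have "int m dvd int j * v2 + w * x2" using dw r(9) by (simp add: dvd_diff)
    then obtain \<alpha> where \<alpha>: "int j * v2 + w * x2 = int m * \<alpha>" by (elim dvdE)
    have "int j * int v - w * x1 = int j * (int v + x1 * int a) - x1 * (w + int j * int a)"
      by (simp add: algebra_simps)
    then have "int m dvd int j * int v - w * x1" using dw r(8) by (simp add: dvd_diff)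
    then obtain \<beta> where \<beta>: "int j * int v - w * x1 = int m * \<beta>" by (elim dvdE)
    have "int m * (\<alpha> * x1 + \<beta> * x2) = int m * int j"
    proof -
      have "int m * (\<alpha> * x1 + \<beta> * x2) = (int m * \<alpha>) * x1 + (int m * \<beta>) * x2" by (simp add: algebra_simps)
      also have "\<dots> = int j * (int v * x2 + v2 * x1)" unfolding \<alpha>[symmetric] \<beta>[symmetric] by (simp add: algebra_simps)
      finally show ?thesis unfolding r(7) by simp
    qed
    then have jx: "\<alpha> * x1 + \<beta> * x2 = int j" using m by simp
    have "int m * (\<alpha> * int v - \<beta> * v2) = int m * w"
    proof -
      have "int m * (\<alpha> * int v - \<beta> * v2) = (int m * \<alpha>) * int v - (int m * \<beta>) * v2" by (simp add: algebra_simps)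
      also have "\<dots> = w * (int v * x2 + v2 * x1)" unfolding \<alpha>[symmetric] \<beta>[symmetric] by (simp add: algebra_simps)
      finally show ?thesis unfolding r(7) by simp
    qed
    then have wv: "\<alpha> * int v - \<beta> * v2 = w" using m by simp
    have "0 < int j * v2 + w * x2" using j r(3,6) w by (intro add_pos_pos mult_pos_pos) auto
    then have a1: "1 \<le> \<alpha>" using m unfolding \<alpha> by (simp add: zero_less_mult_iff)
    have "1 \<le> \<beta>"
    proof (rule ccontr)
      assume "\<not> 1 \<le> \<beta>"
      then have "\<beta> * v2 \<le> 0" using r(6) by (simp add: mult_nonpos_nonneg)
      moreover have "1 * int v \<le> \<alpha> * int v" using a1 by (intro mult_right_mono) auto
      ultimately show False using wv w by linarith
    qed
    then have "1 * x2 \<le> \<beta> * x2" using r(3) by (intro mult_right_mono) simp_all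
    moreover have "1 * x1 \<le> \<alpha> * x1" using a1 r(1) by (rule mult_right_mono)
    ultimately show False using jx J j by linarith
  qed
  have "v = m \<or> (\<exists>j. 1 \<le> j \<and> j \<le> J \<and> v + j * a mod m = m)"
  proof (cases "x1 = 0")
    case True
    then show ?thesis using r(10) by simp
  next
    case False
    define j where "j = nat x1"
    have j: "1 \<le> j" "j \<le> J" "x1 = int j" using False r(1,2) by (auto simp: j_def)
    have "int m dvd int (v + j * a)" using r(8) j(3) by simp
    then have "m dvd v + j * a" by (simp only: of_nat_dvd_iff)
    moreover have "v + j * a = (v + j * a mod m) + m * (j * a div m)" by simp
    ultimately have dv: "m dvd (v + j * a mod m)" by (metis dvd_add_left_iff dvd_triv_left)
    have "0 < v + j * a mod m" using r(4) by simp
    then have "m \<le> v + j * a mod m" by (rule dvd_imp_le[OF dv])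
    then have "v + j * a mod m = m" using le[OF j(1,2)] by (intro le_antisym)
    then show ?thesis using j by blast
  qed
  then show ?thesis using le by (simp add: minmod_def)
qed

text \<open>Cells 20 to 23 hold \<open>x1\<close>, \<open>v1\<close>, \<open>x2\<close>,
  \<open>v2\<close>, and cells 30 to 32 hold \<open>a\<close>, \<open>m\<close>, \<open>J\<close>.
  Cell 26 is the slack \<open>J - x1 - x2\<close>; the loop runs while it is nonnegative.\<close>

definition minmod_init :: "instr list" where
  "minmod_init = [Set 20 (Num 0), Set 21 (Var 31), Set 22 (Num 1), Set 23 (Var 30),
     Set 26 (Op Sub (Var 32) (Num 1))]"

definition minmod_body :: "instr list" where
  "minmod_body =
    [Set 24 (Op Div (Op Sub (Var 21) (Num 1)) (Var 23)),
     Set 25 (Op Div (Op Sub (Var 32) (Var 20)) (Var 22)),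
     Min 24 25,
     Set 20 (Op Add (Var 20) (Op Mul (Var 24) (Var 22))),
     Set 21 (Op Sub (Var 21) (Op Mul (Var 24) (Var 23))),
     Set 24 (Op Div (Op Sub (Var 23) (Num 1)) (Var 21)),
     Set 22 (Op Add (Var 22) (Op Mul (Var 24) (Var 20))),
     Set 23 (Op Sub (Var 23) (Op Mul (Var 24) (Var 21))),
     Set 26 (Op Sub (Op Sub (Var 32) (Var 20)) (Var 22))]"

definition minmod_prog :: program where
  "minmod_prog = Seq (code minmod_init) (While (Less (Const (- 1)) (Cell (Direct 26))) (code minmod_body))"

definition minmod_cost :: "nat \<Rightarrow> nat" where
  "minmod_cost k = code_cost minmod_init + (1 + k * (1 + code_cost minmod_body))"

lemma does_minmod_prog:
  assumes s: "s 30 = int a" "s 31 = int m" "s 32 = int J"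
    and a: "0 < a" "a < m" "coprime a m" "J < m" "m < 2 ^ k"
  shows "does minmod_prog s (minmod_cost k)
    (\<lambda>s'. (\<forall>x. x < 20 \<or> 26 < x \<longrightarrow> s' x = s x) \<and> (\<exists>v. s' 21 = int v \<and> minmod a m J v))"
  unfolding minmod_prog_def minmod_cost_def
proof (rule does_Seq)
  \<comment> \<open>The bound on cell 21 is given up once the range is exhausted, because the last
    round need not halve it.\<close>
  let ?I = "\<lambda>k (s' :: memory). (\<forall>x. x < 20 \<or> 26 < x \<longrightarrow> s' x = s x) \<and> s' 26 = s 32 - s' 20 - s' 22 \<and>
    records (s 30) (s 31) (s 32) (s' 20) (s' 21) (s' 22) (s' 23) \<and> (s 32 < s' 20 + s' 22 \<or> s' 21 < 2 ^ k)"
  have "int m < 2 ^ k" using a(5) by (metis of_nat_less_iff of_nat_numeral of_nat_power)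
  moreover have "coprime (int m) (int a)" using a(3) by (simp add: coprime_commute)
  ultimately have "?I k (run minmod_init s)"
    using s a unfolding minmod_init_def records_def by simp
  then show "does (code minmod_init) s (code_cost minmod_init) (?I k)"
    by (intro does_code) (simp_all add: minmod_init_def)
  fix s1 :: memory assume I1: "?I k s1"
  show "does (While (Less (Const (- 1)) (Cell (Direct 26))) (code minmod_body)) s1
      (1 + k * (1 + code_cost minmod_body))
      (\<lambda>s'. (\<forall>x. x < 20 \<or> 26 < x \<longrightarrow> s' x = s x) \<and> (\<exists>v. s' 21 = int v \<and> minmod a m J v))"
  proof (rule does_While[where I = ?I])
    show "?I k s1" by (rule I1)
  next
    fix k and s' :: memory assume I: "?I k s'" and "test_val (Less (Const (- 1)) (Cell (Direct 26))) s'"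
    then have J: "s' 20 + s' 22 \<le> s 32" by simp
    have rec: "records (s 30) (s 31) (s 32) (s' 20) (s' 21) (s' 22) (s' 23)" using I by blast
    have lt: "s' 21 < 2 ^ k" using I J by auto
    have k: "0 < k"
    proof (rule ccontr)
      assume "\<not> 0 < k"
      then show False using lt rec by (simp add: records_def)
    qed
    have s32: "s' 32 = s 32" using I by simp
    have Jm: "s 32 < s 31" using s a by simp
    note st = records_step[OF rec J Jm refl refl refl refl refl refl]
    have k2: "(2::int) ^ k = 2 * 2 ^ (k - 1)" using k by (simp add: power_eq_if)
    let ?s = "run minmod_body s'"
    have i1: "records (s 30) (s 31) (s 32) (?s 20) (?s 21) (?s 22) (?s 23)"
      using st(1) s32 by (simp add: minmod_body_def)
    have "s 32 < ?s 20 + ?s 22 \<or> 2 * ?s 21 \<le> s' 21"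
      using st(2) s32 by (simp add: minmod_body_def)
    then have i2: "s 32 < ?s 20 + ?s 22 \<or> ?s 21 < 2 ^ (k - 1)" using lt k2 by linarith
    have i3: "\<forall>x. x < 20 \<or> 26 < x \<longrightarrow> ?s x = s x"
    proof (intro allI impI)
      fix x :: int assume x: "x < 20 \<or> 26 < x"
      then have "x \<notin> target ` set minmod_body" by (auto simp: minmod_body_def)
      then have "?s x = s' x" by (rule run_frame)
      also have "s' x = s x" using I x by blast
      finally show "?s x = s x" .
    qed
    have i4: "?s 26 = s 32 - ?s 20 - ?s 22" using s32 by (simp add: minmod_body_def)
    have "?I (k - 1) ?s" by (intro conjI i1 i2 i3 i4)
    then have "does (code minmod_body) s' (code_cost minmod_body) (?I (k - 1))"
      by (rule does_code[where Q = "?I (k - 1)", rotated]) (simp add: minmod_body_def)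
    then show "0 < k \<and> does (code minmod_body) s' (code_cost minmod_body) (?I (k - 1))" using k by (intro conjI)
  next
    fix k and s' :: memory assume I: "?I k s'" and t: "\<not> test_val (Less (Const (- 1)) (Cell (Direct 26))) s'"
    have rec: "records (int a) (int m) (int J) (s' 20) (s' 21) (s' 22) (s' 23)" using I s by simp
    then have "s' 21 = int (nat (s' 21))" by (simp add: records_def)
    moreover from this rec have "records (int a) (int m) (int J) (s' 20) (int (nat (s' 21))) (s' 22) (s' 23)" by simp
    then have "minmod a m J (nat (s' 21))" using I t s a by (intro records_minmod) auto
    ultimately show "(\<forall>x. x < 20 \<or> 26 < x \<longrightarrow> s' x = s x) \<and> (\<exists>v. s' 21 = int v \<and> minmod a m J v)"
      using I by blast
  qed simp
qed

section \<open>The algorithm\<close>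

lemma int_first_multiple:
  assumes "0 < p"
  shows "int (first_multiple p q c) =
    min (int p * ((int c * int q + (int p + int q) - 1) div (int p + int q)))
        (int q * ((int c * int p + (int p + int q) - 1) div (int p + int q)))"
proof -
  have "int (x + (p + q) - 1) = int x + (int p + int q) - 1" for x using assms by simp
  then show ?thesis
    unfolding first_multiple_def by (simp add: of_nat_min zdiv_int of_nat_mult)
qed

text \<open>Cells: 0 and 1 hold the input periods, 2 holds \<open>h\<close>, 3 their gcd, 6 and 7 the reduced periods
  \<open>p < q\<close>, 8 the result, 9 the quotient of \<open>h\<close> by \<open>p + q - 2\<close>, 10 the remainder plus 2,
  11 and 13 the bounds \<open>N0\<close> and \<open>N1\<close>, 15 and 16 the two minimal residues.\<close>

definition reduce_code :: "instr list" where
  "reduce_code = [Set 6 (Var 0), Min 6 1, Set 6 (Op Div (Var 6) (Var 3)),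
     Set 7 (Var 0), Max 7 1, Set 7 (Op Div (Var 7) (Var 3))]"

definition two_code :: "instr list" where
  "two_code = [Set 8 (Op Add (Op Mul (Var 7) (Op Add (Num 1) (Op Div (Var 2) (Var 7)))) (Op Add (Var 2) (Num 1)))]"

definition multiple_expr :: "expr \<Rightarrow> int \<Rightarrow> int \<Rightarrow> expr" where
  "multiple_expr c x y = Op Mul (Var x) (Op Div
     (Op Sub (Op Add (Op Mul c (Var y)) (Op Add (Var 6) (Var 7))) (Num 1)) (Op Add (Var 6) (Var 7)))"

definition quotient_code :: "instr list" where
  "quotient_code =
    [Set 9 (Op Div (Var 2) (Op Sub (Op Add (Var 6) (Var 7)) (Num 2))),
     Set 10 (Op Add (mod_expr (Var 2) (Op Sub (Op Add (Var 6) (Var 7)) (Num 2))) (Num 2))]"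

definition interval_code :: "instr list" where
  "interval_code =
    [Set 11 (multiple_expr (Var 10) 6 7), Set 12 (multiple_expr (Var 10) 7 6), Min 11 12,
     Set 13 (multiple_expr (Op Add (Var 10) (Num 1)) 6 7),
     Set 12 (multiple_expr (Op Add (Var 10) (Num 1)) 7 6), Min 13 12,
     Set 8 (Var 13)]"

definition residue1_code :: "instr list" where
  "residue1_code = [Set 30 (Var 6), Set 31 (Var 7), Set 32 (Op Div (Var 11) (Var 6))]"

text \<open>The loop starts with \<open>v2 = a\<close> and needs \<open>a < m\<close>, so
  \<open>q\<close> is first reduced modulo \<open>p\<close>. The first minimum is saved before cell
  21 is reused.\<close>

definition residue2_code :: "instr list" where
  "residue2_code = [Set 15 (Var 21), Set 30 (mod_expr (Var 7) (Var 6)), Set 31 (Var 6),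
     Set 32 (Op Div (Var 11) (Var 7))]"

definition gap_code :: "instr list" where
  "gap_code =
    [Set 16 (Var 21),
     Set 17 (Op Sub (Op Sub (Var 6) (Num 1)) (mod_expr (Var 11) (Var 6))),
     Set 18 (Op Sub (Op Sub (Op Sub (Var 7) (Num 1)) (Var 15)) (mod_expr (Var 11) (Var 7))),
     Min 17 18,
     Set 19 (Op Sub (Op Sub (Op Sub (Var 6) (Num 1)) (Var 16)) (mod_expr (Var 11) (Var 6))),
     Set 18 (Op Sub (Op Sub (Var 7) (Num 1)) (mod_expr (Var 11) (Var 7))),
     Min 19 18, Max 17 19,
     Set 18 (Op Add (Op Add (Var 11) (Num 1)) (Var 17)), Min 8 18]"

definition gap_prog :: program where
  "gap_prog = Seq (code residue1_code) (Seq minmod_prog (Seq (code residue2_code) (Seq minmod_prog (code gap_code))))"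

definition combine_code :: "instr list" where
  "combine_code =
    [Set 8 (Op Add (Op Mul (Op Mul (Var 6) (Var 7)) (Var 9)) (Var 8)),
     Set 17 (Op Add (Op Sub (Op Add (Var 7) (Op Mul (Op Add (Op Div (Var 2) (Num 2)) (Num 1)) (Var 6))) (Num 1))
       (mod_expr (Var 2) (Num 2))),
     Set 18 (Op Mul (Num 4) (Var 7))]"

text \<open>The minima are computed only for \<open>N0 < N1\<close>. Then \<open>N0 < p * q\<close>,
  which keeps their ranges shorter than the moduli.\<close>

definition threshold_prog :: program where
  "threshold_prog = Seq (Seq (code quotient_code) (code interval_code)) (Seq
     (Cond (Less (Cell (Direct 11)) (Cell (Direct 13))) gap_prog Skip) (Seq (code combine_code)
     (Cond (Less (Cell (Direct 18)) (Cell (Direct 17))) Skip (code [Max 8 17]))))"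

definition main_prog :: program where
  "main_prog = Seq gcd_prog (Seq (code reduce_code) (Seq
     (Cond (Equal (Cell (Direct 6)) (Const 2)) (code two_code) threshold_prog)
     (code [Set 0 (Op Mul (Var 3) (Var 8))])))"

lemma code_ok_all [simp]:
  "code_ok reduce_code" "code_ok two_code" "code_ok quotient_code" "code_ok interval_code" "code_ok residue1_code"
  "code_ok residue2_code" "code_ok gap_code" "code_ok combine_code"
  by (simp_all add: reduce_code_def two_code_def quotient_code_def interval_code_def residue1_code_def residue2_code_def
      gap_code_def combine_code_def multiple_expr_def)

lemma does_Cond':
  assumes "test_ok b" "test_val b s \<Longrightarrow> does c s T Q" "\<not> test_val b s \<Longrightarrow> does d s U Q"
  shows "does (Cond b c d) s (1 + (T + U)) Q"
proof (rule does_Cond[OF assms(1)])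
  assume "test_val b s"
  then show "does c s (T + U) Q" by (intro does_mono[OF assms(2)]) simp_all
next
  assume "\<not> test_val b s"
  then show "does d s (T + U) Q" by (intro does_mono[OF assms(3)]) simp_all
qed

definition gap_cost :: "nat \<Rightarrow> nat" where
  "gap_cost k = code_cost residue1_code + (minmod_cost k + (code_cost residue2_code + (minmod_cost k + code_cost gap_code)))"

lemma does_gap_prog:
  assumes s: "s 6 = int p" "s 7 = int q" "s 11 = int N"
    and pq: "coprime p q" "2 \<le> p" "p < q" "N < p * q" "q < 2 ^ k"
  shows "does gap_prog s (gap_cost k)
    (\<lambda>s'. s' 2 = s 2 \<and> s' 3 = s 3 \<and> s' 6 = s 6 \<and> s' 7 = s 7 \<and> s' 9 = s 9 \<and>
    (\<exists>d1 d2. minmod p q (N div p) d1 \<and> minmod q p (N div q) d2 \<and>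
      s' 8 = min (s 8) (int N + 1 + gap p q N d1 d2)))"
    (is "does _ _ _ ?R")
  unfolding gap_prog_def gap_cost_def
proof (rule does_Seq)
  have kl: "N div p < q" "N div q < p"
    using pq by (simp_all add: div_less_iff_less_mult mult.commute)
  have pk: "p < 2 ^ k" using pq by linarith
  let ?F = "\<lambda>s' :: memory. s' 2 = s 2 \<and> s' 3 = s 3 \<and> s' 6 = s 6 \<and> s' 7 = s 7 \<and> s' 8 = s 8 \<and> s' 9 = s 9 \<and> s' 11 = s 11"
  let ?A = "\<lambda>s' :: memory. ?F s' \<and> s' 30 = int p \<and> s' 31 = int q \<and> s' 32 = int (N div p)"
  show "does (code residue1_code) s (code_cost residue1_code) ?A"
    by (rule does_code[where Q = ?A]) (use s in \<open>simp_all add: residue1_code_def zdiv_int\<close>)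
  fix s1 :: memory assume A: "?A s1"
  let ?B = "\<lambda>s' :: memory. ?F s' \<and> (\<exists>d. s' 21 = int d \<and> minmod p q (N div p) d)"
  show "does (Seq minmod_prog (Seq (code residue2_code) (Seq minmod_prog (code gap_code)))) s1
    (minmod_cost k + (code_cost residue2_code + (minmod_cost k + code_cost gap_code)))
    ?R"
  proof (rule does_Seq)
    have "does minmod_prog s1 (minmod_cost k)
      (\<lambda>s'. (\<forall>x. x < 20 \<or> 26 < x \<longrightarrow> s' x = s1 x) \<and> (\<exists>v. s' 21 = int v \<and> minmod p q (N div p) v))"
      using A pq kl by (intro does_minmod_prog) simp_all
    then show "does minmod_prog s1 (minmod_cost k) ?B"
      using A by (elim does_mono) simp_all
    fix s2 :: memory assume "?B s2"
    then obtain d1 where F2: "?F s2" and d1: "s2 21 = int d1" "minmod p q (N div p) d1" by blast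
    let ?C = "\<lambda>s' :: memory. ?F s' \<and> s' 15 = int d1 \<and> s' 30 = int (q mod p) \<and> s' 31 = int p \<and> s' 32 = int (N div q)"
    show "does (Seq (code residue2_code) (Seq minmod_prog (code gap_code))) s2
      (code_cost residue2_code + (minmod_cost k + code_cost gap_code))
      ?R"
    proof (rule does_Seq)
      show "does (code residue2_code) s2 (code_cost residue2_code) ?C"
        by (rule does_code[where Q = ?C]) (use s F2 d1 in \<open>simp_all add: residue2_code_def zdiv_int zmod_int\<close>)
      fix s3 :: memory assume C: "?C s3"
      let ?D = "\<lambda>s' :: memory. ?F s' \<and> s' 15 = int d1 \<and> (\<exists>d. s' 21 = int d \<and> minmod q p (N div q) d)"
      show "does (Seq minmod_prog (code gap_code)) s3 (minmod_cost k + code_cost gap_code)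
        ?R"
      proof (rule does_Seq)
        have cop: "coprime (q mod p) p" using pq by (simp add: coprime_mod_left_iff coprime_commute)
        moreover have "0 < q mod p"
        proof (rule ccontr)
          assume "\<not> 0 < q mod p"
          then have "coprime 0 p" using cop by simp
          then show False using pq by simp
        qed
        ultimately have "does minmod_prog s3 (minmod_cost k)
          (\<lambda>s'. (\<forall>x. x < 20 \<or> 26 < x \<longrightarrow> s' x = s3 x) \<and> (\<exists>v. s' 21 = int v \<and> minmod (q mod p) p (N div q) v))"
          using C pq kl pk by (intro does_minmod_prog) simp_all
        moreover have "minmod (q mod p) p (N div q) v = minmod q p (N div q) v" for v
          by (simp add: minmod_def mod_mult_right_eq)
        ultimately show "does minmod_prog s3 (minmod_cost k) ?D"
          using C by (elim does_mono) simp_all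
        fix s4 :: memory assume "?D s4"
        then obtain d2 where F4: "?F s4" "s4 15 = int d1" and d2: "s4 21 = int d2" "minmod q p (N div q) d2" by blast
        let ?r = "run gap_code s4"
        have "?r 8 = min (s 8) (int N + 1 + gap p q N d1 d2)"
          using s F4 d2 by (simp add: gap_code_def gap_def zmod_int)
        moreover have "?r 2 = s 2" "?r 3 = s 3" "?r 6 = s 6" "?r 7 = s 7" "?r 9 = s 9"
          using F4 by (simp_all add: run_frame gap_code_def)
        ultimately have "?R ?r" using d1(2) d2(2) by blast
        then show "does (code gap_code) s4 (code_cost gap_code) ?R"
          by (rule does_code[where Q = ?R, rotated]) simp
      qed
    qed
  qed
qed

definition threshold_cost :: "nat \<Rightarrow> nat" where
  "threshold_cost k = (code_cost quotient_code + code_cost interval_code) + ((1 + (gap_cost k + 1)) +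
     (code_cost combine_code + (1 + (1 + code_cost [Max 8 17]))))"

lemma does_threshold_prog:
  assumes s: "s 2 = int h" "s 6 = int p" "s 7 = int q"
    and pq: "coprime p q" "3 \<le> p" "p < q" "q < 2 ^ k"
  shows "does threshold_prog s (threshold_cost k) (\<lambda>s'. s' 3 = s 3 \<and> s' 8 = int (coprime_threshold p q h))"
  unfolding threshold_prog_def threshold_cost_def
proof (rule does_Seq)
  define t h' where "t = h div (p + q - 2)" and "h' = h mod (p + q - 2)"
  define c where "c = h' + 2"
  define N0 N1 where "N0 = first_multiple p q c" and "N1 = first_multiple p q (c + 1)"
  have hh: "h = t * (p + q - 2) + h'" unfolding t_def h'_def by (rule div_mult_mod_eq[symmetric])
  have h': "h' < p + q - 2" using pq by (simp add: h'_def)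
  have p: "0 < p" "0 < q" "2 \<le> p" using pq by simp_all
  have N1: "N1 \<le> p * q" unfolding N1_def c_def using h' p by (intro first_multiple_le) simp_all
  have it: "int t = int h div (int p + int q - 2)" and ic: "int c = int h mod (int p + int q - 2) + 2"
    using p by (simp_all add: t_def h'_def c_def zdiv_int zmod_int of_nat_diff)
  let ?F = "\<lambda>s' :: memory. s' 2 = int h \<and> s' 3 = s 3 \<and> s' 6 = int p \<and> s' 7 = int q \<and> s' 9 = int t"
  let ?A = "\<lambda>s' :: memory. ?F s' \<and> s' 11 = int N0 \<and> s' 13 = int N1 \<and> s' 8 = int N1"
  let ?Z = "\<lambda>s' :: memory. ?F s' \<and> s' 10 = int c"
  show "does (Seq (code quotient_code) (code interval_code)) s (code_cost quotient_code + code_cost interval_code) ?A"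
  proof (rule does_Seq)
    show "does (code quotient_code) s (code_cost quotient_code) ?Z"
      by (rule does_code[where Q = ?Z]) (use s it ic in \<open>simp_all add: quotient_code_def\<close>)
    fix s0 :: memory assume Z: "?Z s0"
    have c1: "int (c + 1) = int c + 1" by simp
    show "does (code interval_code) s0 (code_cost interval_code) ?A"
    proof (rule does_code[where Q = ?A])
      show "?A (run interval_code s0)"
        using Z unfolding N0_def N1_def int_first_multiple[OF p(1)] c1
        by (simp add: interval_code_def multiple_expr_def)
    qed simp
  qed
  fix s1 :: memory assume A: "?A s1"
  let ?B = "\<lambda>s' :: memory. ?F s' \<and> int (p * q * t) + s' 8 = int (single_threshold p q h)"
  show "does (Seq (Cond (Less (Cell (Direct 11)) (Cell (Direct 13))) gap_prog Skip) (Seq (code combine_code)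
     (Cond (Less (Cell (Direct 18)) (Cell (Direct 17))) Skip (code [Max 8 17])))) s1
     ((1 + (gap_cost k + 1)) + (code_cost combine_code + (1 + (1 + code_cost [Max 8 17]))))
     (\<lambda>s'. s' 3 = s 3 \<and> s' 8 = int (coprime_threshold p q h))"
  proof (rule does_Seq)
    note formula = single_threshold_formula[OF pq(1) p(3) pq(3) h' c_def N0_def N1_def _ refl, of _ _ t, folded hh]
    show "does (Cond (Less (Cell (Direct 11)) (Cell (Direct 13))) gap_prog Skip) s1 (1 + (gap_cost k + 1)) ?B"
    proof (rule does_Cond')
      assume "test_val (Less (Cell (Direct 11)) (Cell (Direct 13))) s1"
      then have lt: "N0 < N1" using A by simp
      let ?G = "\<lambda>s' :: memory. s' 2 = s1 2 \<and> s' 3 = s1 3 \<and> s' 6 = s1 6 \<and> s' 7 = s1 7 \<and> s' 9 = s1 9 \<and>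
        (\<exists>d1 d2. minmod p q (N0 div p) d1 \<and> minmod q p (N0 div q) d2 \<and>
          s' 8 = min (s1 8) (int N0 + 1 + gap p q N0 d1 d2))"
      have "does gap_prog s1 (gap_cost k) ?G"
        using A pq lt N1 p by (intro does_gap_prog) simp_all
      then show "does gap_prog s1 (gap_cost k) ?B"
      proof (rule does_mono)
        fix s' :: memory
        assume "?G s'"
        then obtain d1 d2 where fr: "s' 2 = s1 2" "s' 3 = s1 3" "s' 6 = s1 6" "s' 7 = s1 7" "s' 9 = s1 9"
          and d: "minmod p q (N0 div p) d1 \<and> minmod q p (N0 div q) d2"
          and e: "s' 8 = min (s1 8) (int N0 + 1 + gap p q N0 d1 d2)"
          by blast
        have "s1 8 = int N1" using A by blast
        then have "int (p * q * t) + s' 8 = int (single_threshold p q h)"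
          using formula[OF d] lt unfolding e by (simp only: if_True)
        then show "?B s'" using A fr by simp
      qed simp
    next
      assume "\<not> test_val (Less (Cell (Direct 11)) (Cell (Direct 13))) s1"
      then have lt: "\<not> N0 < N1" using A by simp
      then have "int (p * q * t) + s1 8 = int (single_threshold p q h)"
        using formula[of 0 0] A by simp
      then show "does Skip s1 1 ?B" using A by (intro does_Skip) simp
    qed simp
    fix s2 :: memory assume B: "?B s2"
    let ?C = "\<lambda>s' :: memory. s' 3 = s 3 \<and> s' 8 = int (single_threshold p q h) \<and> s' 17 = int (arc_threshold p q h) \<and> s' 18 = int (4 * q)"
    have arc_threshold: "int (arc_threshold p q h) = int q + (int h div 2 + 1) * int p - 1 + int h mod 2"
    proof -
      have "1 \<le> q + (h div 2 + 1) * p" using p by simp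
      then show ?thesis unfolding arc_threshold_def by (simp add: of_nat_diff zdiv_int zmod_int algebra_simps)
    qed
    show "does (Seq (code combine_code) (Cond (Less (Cell (Direct 18)) (Cell (Direct 17))) Skip (code [Max 8 17]))) s2
      (code_cost combine_code + (1 + (1 + code_cost [Max 8 17])))
      (\<lambda>s'. s' 3 = s 3 \<and> s' 8 = int (coprime_threshold p q h))"
    proof (rule does_Seq)
      show "does (code combine_code) s2 (code_cost combine_code) ?C"
      proof (rule does_code[where Q = ?C])
        show "?C (run combine_code s2)" using B unfolding arc_threshold by (simp add: combine_code_def)
      qed simp
      fix s3 :: memory assume C: "?C s3"
      have T: "coprime_threshold p q h = (if arc_threshold p q h \<le> 4 * q then max (single_threshold p q h) (arc_threshold p q h) else single_threshold p q h)"
        using pq(2) by (simp add: coprime_threshold_def)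
      show "does (Cond (Less (Cell (Direct 18)) (Cell (Direct 17))) Skip (code [Max 8 17])) s3 (1 + (1 + code_cost [Max 8 17]))
        (\<lambda>s'. s' 3 = s 3 \<and> s' 8 = int (coprime_threshold p q h))"
      proof (rule does_Cond')
        assume "test_val (Less (Cell (Direct 18)) (Cell (Direct 17))) s3"
        then have "\<not> arc_threshold p q h \<le> 4 * q" using C by simp
        then show "does Skip s3 1 (\<lambda>s'. s' 3 = s 3 \<and> s' 8 = int (coprime_threshold p q h))"
          using C T by (intro does_Skip) simp
      next
        assume "\<not> test_val (Less (Cell (Direct 18)) (Cell (Direct 17))) s3"
        then have "arc_threshold p q h \<le> 4 * q" using C by simp
        then show "does (code [Max 8 17]) s3 (code_cost [Max 8 17]) (\<lambda>s'. s' 3 = s 3 \<and> s' 8 = int (coprime_threshold p q h))"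
          using C T by (intro does_code) (simp_all add: of_nat_max)
      qed simp
    qed
  qed
qed

definition main_cost :: "nat \<Rightarrow> nat" where
  "main_cost k = (code_cost gcd_init + (1 + k * (1 + code_cost gcd_body))) +
     (code_cost reduce_code + ((1 + (code_cost two_code + threshold_cost k)) + code_cost [Set 0 (Op Mul (Var 3) (Var 8))]))"

text \<open>Only the three loops depend on \<open>k\<close>: one for the gcd and two for the minimal
  residues.\<close>

lemma main_cost_linear:
  obtains c0 c1 where "\<And>k. main_cost k = c0 + k * c1"
proof
  show "main_cost k = main_cost 0 + k * (1 + code_cost gcd_body + 2 * (1 + code_cost minmod_body))" for k
    by (simp add: main_cost_def threshold_cost_def gap_cost_def minmod_cost_def algebra_simps)
qed

lemma does_main_prog:
  assumes "P = d * p \<and> Q = d * q \<or> P = d * q \<and> Q = d * p" "0 < d" "coprime p q" "2 \<le> p" "p < q" "P * Q < 2 ^ k"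
  shows "does main_prog (input P Q h) (main_cost k) (\<lambda>s'. s' 0 = int (d * coprime_threshold p q h))"
  unfolding main_prog_def main_cost_def
proof (rule does_Seq)
  let ?s = "input P Q h"
  have in0: "?s 0 = int P" "?s 1 = int Q" "?s 2 = int h" by (simp_all add: input_def)
  have pos: "0 < P" "0 < Q" using assms by auto
  have "P * Q = (d * q) * (d * p)" using assms(1) by auto
  also have "\<dots> \<ge> q * 1" using assms by (intro mult_le_mono) auto
  finally have qk: "q < 2 ^ k" using assms(6) by simp
  have "gcd P Q = d"
    using assms(1,3) by (auto simp: gcd_mult_distrib_nat[symmetric] coprime_imp_gcd_eq_1 gcd.commute[of q p])
  then have g: "gcd (?s 0) (?s 1) = int d" by (simp add: in0)
  let ?A = "\<lambda>s' :: memory. s' 0 = ?s 0 \<and> s' 1 = ?s 1 \<and> s' 2 = ?s 2 \<and> s' 3 = gcd (?s 0) (?s 1)"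
  have "int (P * Q) < int (2 ^ k)" using assms(6) by (simp only: of_nat_less_iff)
  then show "does gcd_prog ?s (code_cost gcd_init + (1 + k * (1 + code_cost gcd_body))) ?A"
    using pos by (intro does_gcd_prog) (simp_all add: in0)
  fix s1 :: memory assume "?A s1"
  then have A: "s1 0 = int P" "s1 1 = int Q" "s1 2 = int h" "s1 3 = int d" using in0 g by simp_all
  let ?B = "\<lambda>s' :: memory. s' 2 = int h \<and> s' 3 = int d \<and> s' 6 = int p \<and> s' 7 = int q"
  show "does (Seq (code reduce_code) (Seq (Cond (Equal (Cell (Direct 6)) (Const 2)) (code two_code) threshold_prog)
     (code [Set 0 (Op Mul (Var 3) (Var 8))]))) s1
     (code_cost reduce_code + ((1 + (code_cost two_code + threshold_cost k)) + code_cost [Set 0 (Op Mul (Var 3) (Var 8))]))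
     (\<lambda>s'. s' 0 = int (d * coprime_threshold p q h))"
  proof (rule does_Seq)
    have mm: "min (int P) (int Q) = int d * int p" "max (int P) (int Q) = int d * int q"
      using assms(1,2,5) by (auto simp: min_def max_def)
    show "does (code reduce_code) s1 (code_cost reduce_code) ?B"
    proof (rule does_code[where Q = ?B])
      show "?B (run reduce_code s1)" using A assms(2) mm by (simp add: reduce_code_def)
    qed simp
    fix s2 :: memory assume B: "?B s2"
    let ?C = "\<lambda>s' :: memory. s' 3 = int d \<and> s' 8 = int (coprime_threshold p q h)"
    show "does (Seq (Cond (Equal (Cell (Direct 6)) (Const 2)) (code two_code) threshold_prog)
      (code [Set 0 (Op Mul (Var 3) (Var 8))])) s2
      ((1 + (code_cost two_code + threshold_cost k)) + code_cost [Set 0 (Op Mul (Var 3) (Var 8))])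
      (\<lambda>s'. s' 0 = int (d * coprime_threshold p q h))"
    proof (rule does_Seq)
      show "does (Cond (Equal (Cell (Direct 6)) (Const 2)) (code two_code) threshold_prog) s2
        (1 + (code_cost two_code + threshold_cost k)) ?C"
      proof (rule does_Cond')
        assume "test_val (Equal (Cell (Direct 6)) (Const 2)) s2"
        then have "p = 2" using B by simp
        then show "does (code two_code) s2 (code_cost two_code) ?C"
          using B by (intro does_code) (simp_all add: two_code_def coprime_threshold_def zdiv_int distrib_left)
      next
        assume "\<not> test_val (Equal (Cell (Direct 6)) (Const 2)) s2"
        then have "3 \<le> p" using B assms(4) by simp
        then have "does threshold_prog s2 (threshold_cost k) (\<lambda>s'. s' 3 = s2 3 \<and> s' 8 = int (coprime_threshold p q h))"
          using B assms qk by (intro does_threshold_prog) simp_all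
        then show "does threshold_prog s2 (threshold_cost k) ?C" using B by (elim does_mono) simp_all
      qed simp
      fix s3 :: memory assume "?C s3"
      then show "does (code [Set 0 (Op Mul (Var 3) (Var 8))]) s3 (code_cost [Set 0 (Op Mul (Var 3) (Var 8))])
        (\<lambda>s'. s' 0 = int (d * coprime_threshold p q h))"
        by (intro does_code) simp_all
    qed
  qed
qed

section \<open>Reduction to coprime periods and the logarithmic bound\<close>

lemma coprime_decomposition:
  fixes p q :: nat
  assumes "1 \<le> p" "1 \<le> q" "gcd p q \<notin> {p, q}"
  obtains a b where "coprime a b" "2 \<le> a" "a < b"
    "p = gcd p q * a \<and> q = gcd p q * b \<or> p = gcd p q * b \<and> q = gcd p q * a"
proof -
  let ?d = "gcd p q"
  define x y where "x = p div ?d" and "y = q div ?d"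
  have d: "0 < ?d" using assms by simp
  have x: "p = ?d * x" "q = ?d * y" by (simp_all add: x_def y_def)
  have cop: "coprime x y" unfolding x_def y_def using assms(1) by (intro div_gcd_coprime) simp
  have "x \<noteq> 0" "y \<noteq> 0" using x assms by (metis mult_0_right not_one_le_zero)+
  moreover have "x \<noteq> 1" "y \<noteq> 1" using x assms(3) by (metis insertCI mult_1_right)+
  ultimately have ge: "2 \<le> x" "2 \<le> y" by simp_all
  have "x \<noteq> y" using cop ge by (metis coprime_self nat_dvd_1_iff_1 not_less_eq_eq numeral_2_eq_2 One_nat_def order_refl)
  then consider "x < y" | "y < x" by linarith
  then show thesis
  proof cases
    case 1
    then show thesis using that[of x y] cop ge x by blast
  next
    case 2
    then show thesis using that[of y x] cop ge x by (metis coprime_commute)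
  qed
qed

theorem theorem30:
  fixes \<Sigma> :: "'a set"
  shows "\<exists>(alg :: program) (C :: real). \<forall>p q h :: nat.
           1 \<le> p \<longrightarrow> 1 \<le> q \<longrightarrow> gcd p q \<notin> {p, q} \<longrightarrow>
             computes_within alg (input p q h) (int (threshold \<Sigma> h p q))
               (C * (log 2 (real p) + log 2 (real q)))"
proof -
  have logs: "1 \<le> log 2 (real p) + log 2 (real q)" if "1 \<le> p" "1 \<le> q" "gcd p q \<notin> {p, q}" for p q :: nat
  proof -
    \<comment> \<open>\<open>p = 1\<close> would give \<open>gcd p q = p\<close>. So the logarithms
      sum to at least 1 and can absorb additive constants.\<close>
    have "p \<noteq> 1" using that(3) by auto
    then have "log 2 2 \<le> log 2 (real p)" using that(1) by (intro log_mono) simp_all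
    moreover have "0 \<le> log 2 (real q)" using that(2) by simp
    ultimately show ?thesis by simp
  qed
  show ?thesis
  proof (cases "\<exists>a\<in>\<Sigma>. \<exists>b\<in>\<Sigma>. a \<noteq> b")
    case False
    \<comment> \<open>Over at most one letter the threshold is 0, and a constant program
      suffices.\<close>
    have "computes_within (assign 0 (Num 0)) (input p q h) (int (threshold \<Sigma> h p q))
        (2 * (log 2 (real p) + log 2 (real q)))"
      if pq: "1 \<le> p" "1 \<le> q" "gcd p q \<notin> {p, q}" for p q h
    proof -
      have "threshold \<Sigma> h p q = 0" using False pq by (intro threshold_one_letter) auto
      moreover have "does (assign 0 (Num 0)) (input p q h) (expr_cost (Num 0) + 1) (\<lambda>s'. s' 0 = 0)"
        by (rule does_assign) simp_all
      then have "\<exists>t m' s'. exec (assign 0 (Num 0)) (input p q h) t m' \<and> t \<le> 2 \<and> agree m' s' \<and> s' 0 = 0"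
        unfolding does_def by (simp add: agree_def numeral_2_eq_2)
      then obtain t m' where "exec (assign 0 (Num 0)) (input p q h) t m'" "t \<le> 2" "m' 0 = 0"
        by (auto simp: agree_def)
      moreover have "real t \<le> 2 * (log 2 (real p) + log 2 (real q))"
      proof -
        have "real t \<le> 2 * 1" using \<open>t \<le> 2\<close> by simp
        also have "\<dots> \<le> 2 * (log 2 (real p) + log 2 (real q))"
          using logs[OF pq] by (rule mult_left_mono) simp
        finally show ?thesis .
      qed
      ultimately show ?thesis unfolding computes_within_def by auto
    qed
    then show ?thesis by blast
  next
    case True
    then obtain a b where ab: "a \<in> \<Sigma>" "b \<in> \<Sigma>" "a \<noteq> b" by blast
    obtain c0 c1 where lin: "\<And>k. main_cost k = c0 + k * c1" by (rule main_cost_linear) blast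
    have "computes_within main_prog (input p q h) (int (threshold \<Sigma> h p q))
        (real (c0 + 2 * c1) * (log 2 (real p) + log 2 (real q)))"
      if pq: "1 \<le> p" "1 \<le> q" "gcd p q \<notin> {p, q}" for p q h
    proof -
      let ?d = "gcd p q" and ?l = "log 2 (real p) + log 2 (real q)"
      obtain x y where xy: "coprime x y" "2 \<le> x" "x < y"
        "p = ?d * x \<and> q = ?d * y \<or> p = ?d * y \<and> q = ?d * x"
        using coprime_decomposition[OF pq] .
      have d: "0 < ?d" using pq by simp
      have th: "threshold \<Sigma> h p q = ?d * coprime_threshold x y h"
        using xy(4) threshold_two_letters[OF ab d xy(1-3), of h] threshold_commute[of \<Sigma> h q p] by metis
      \<comment> \<open>Rounding up gives \<open>p * q < 2 ^ k\<close>. As \<open>?l\<close> is at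
        least 1, \<open>k\<close> is at most \<open>2 * ?l\<close>, which explains the factor 2 in
        \<open>c0 + 2 * c1\<close>.\<close>
      define k where "k = nat \<lfloor>?l\<rfloor> + 1"
      have l1: "1 \<le> ?l" by (rule logs[OF pq])
      have k: "?l < real k" "real k \<le> ?l + ?l" using l1 unfolding k_def by linarith+
      have "log 2 (real (p * q)) = ?l" using pq by (simp add: log_mult)
      moreover have "0 < real (p * q)" using pq by simp
      ultimately have "real (p * q) < 2 powr real k"
        using log_less_iff[of 2 "real (p * q)" "real k"] k(1) by simp
      then have "real (p * q) < real (2 ^ k)" by (simp add: powr_realpow)
      then have pqk: "p * q < 2 ^ k" by (simp only: of_nat_less_iff)
      have "does main_prog (input p q h) (main_cost k) (\<lambda>s'. s' 0 = int (?d * coprime_threshold x y h))"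
        by (rule does_main_prog[OF xy(4) d xy(1-3) pqk])
      then obtain t m' s' where ex: "exec main_prog (input p q h) t m'" "t \<le> main_cost k" "agree m' s'"
        "s' 0 = int (?d * coprime_threshold x y h)"
        unfolding does_def agree_def by blast
      have "real t \<le> real c0 + real k * real c1" using ex(2) unfolding lin
        by (metis of_nat_add of_nat_le_iff of_nat_mult)
      also have "\<dots> \<le> real c0 * ?l + (?l + ?l) * real c1"
        using l1 k(2) by (intro add_mono mult_right_mono) (simp_all add: mult_le_cancel_left1)
      also have "\<dots> = real (c0 + 2 * c1) * ?l" by (simp add: algebra_simps)
      finally have "real t \<le> real (c0 + 2 * c1) * ?l" .
      moreover have "m' 0 = int (threshold \<Sigma> h p q)" using ex(3,4) th by (simp add: agree_def)
      ultimately show ?thesis unfolding computes_within_def using ex(1) by blast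
    qed
    then show ?thesis by blast
  qed
qed

end
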